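(* Let $A_1,A_2\in\mathcal{L}(H)$ be such that, for $j=1,2$, $-A_j$ is sectorial and $\|e^{-t_0A_j}\|<1$ for some $t_0>0$, and let $B:\mathbf{C}\to H$ and $C:H\to\mathbf{C}$ be bounded operators such that $(-A_1,-A_2;B,C)$ gives a $(2,2)$ admissible linear system, with tau function $\tau(x;t)$ (see context). Let $t\in\mathbf{C}^\infty_0$ and $x>0$, and let $s_0,s_1,s_2,s_3,1/\zeta\in\mathbf{C}$ have modulus small enough ($|s_j|\max\{\|A_1\|,\|A_2\|\}<1$, $|\zeta|>\max\{\|A_1\|,\|A_2\|\}$) for the shifted tau functions below to be defined. (i) With $\sigma_{jk}=(s_j-s_k)\,\tau(x;t+[s_j]+[s_k])$, Fay's identity holds: $$\sigma_{01}\sigma_{23}-\sigma_{02}\sigma_{13}+\sigma_{03}\sigma_{12}=0.$$ (ii) For the Wronskian $\mathrm{Wr}(f,g)=f\,\partial_xg-g\,\partial_xf$ with derivatives in the $x$-variable, and $s_1,s_2\ne0$, the differential form of Fay's identity holds: $$\mathrm{Wr}\big(\tau(x;t+[s_1]),\tau(x;t+[s_2])\big)=\frac{s_1-s_2}{s_1s_2}\det\begin{pmatrix}\tau(x;t)&\tau(x;t+[s_2])\\ \tau(x;t+[s_1])&\tau(x;t+[s_1]+[s_2])\end{pmatrix}.$$ (iii) The second-order differential identity holds (where $\tau(x;t+[1/\zeta])\neq0$): $$\frac{\partial^2}{\partial\zeta\,\partial x}\log\tau\big(x;t+[1/\zeta]\big)=1-\frac{\tau(x;t)\,\tau(x;t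+2[1/\zeta])}{\tau(x;t+[1/\zeta])^2}.$$
   Context: $H$ is a complex separable Hilbert space, $\mathcal{L}(H)$ its bounded operators. A linear system $(-A,B,C)$ with input/output space $\mathbf{C}$ is $(2,2)$ admissible if $\Theta_0f=\int_0^\infty e^{-sA^\dagger}C^\dagger f(s)\,ds$ and $\Xi_0f=\int_0^\infty e^{-sA}Bf(s)\,ds$ define Hilbert--Schmidt operators $L^2((0,\infty);\mathbf{C})\to H$; $(-A_1,-A_2;B,C)$ is shorthand for the pair of $(2,2)$ admissible systems $(-A_1,B,C)$ and $(-A_2,B,C)$. An operator $-A$ is sectorial if for some $\pi/2<\theta<\pi$ the sector $S_\theta=\{z\neq0:|\arg z|<\theta\}$ lies in the resolvent set of $-A$ and $|\lambda|\|(\lambda I+A)^{-1}\|$ is bounded on $S_\theta$. $\mathbf{C}^\infty_0=\{(t_j)_{j=1}^\infty: t_j\in\mathbf{C},\ \lim_{j\to\infty}|t_j|^{1/j}=0\}$. Let $$V(t)=\exp\Big(\sum_{j=1}^\infty t_jA_2^j\Big),\qquad W(t)=\exp\Big(-\sum_{j=1}^\infty t_j(-A_1)^j\Big)$$ for $t\in\mathbf{C}^\infty_0$, and for other $t$ whenever these series converge absolutely. The tau function is $\tau(x;t)=\det\big(I+V(t)R_xW(t)\big)$, where $R_x=\int_x^\infty e^{-vA_2}BCe^{-vA_1}\,dv$. For $s\in\mathbf{C}$, $[s]=(s^j/j)_{j=1}^\infty$.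
   Formalization: In (iii) the sign of the right-hand side is reversed to τ(x;t)τ(x;t+2[1/ζ])/τ(x;t+[1/ζ])² − 1; the printed sign is false (H=C, A1=A2=B=C=1, t=0, real ζ>1: left side positive, printed right side negative) and contradicts (ii). *)

theory Defs
  imports "HOL-Analysis.Analysis"
begin

section \<open>Separable complex Hilbert spaces\<close>

text \<open>The real inner product inherited from \<^class>\<open>real_inner\<close> is the real part of the complex one,
  so norm and topology are those of \<^term>\<open>cinner\<close>, which is linear in its first argument. Separability is
  expressed by second countability.\<close>

class complex_hilbert = real_inner + banach + second_countable_topology +
  fixes scaleC :: "complex \<Rightarrow> 'a \<Rightarrow> 'a" (infixr "*\<^sub>C" 75)
    and cinner :: "'a \<Rightarrow> 'a \<Rightarrow> complex"
  assumes scaleC_add_left: "(a + b) *\<^sub>C x = a *\<^sub>C x + b *\<^sub>C x"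
    and scaleC_add_right: "a *\<^sub>C (x + y) = a *\<^sub>C x + a *\<^sub>C y"
    and scaleC_scaleC: "a *\<^sub>C (b *\<^sub>C x) = (a * b) *\<^sub>C x"
    and scaleC_complex_of_real: "complex_of_real r *\<^sub>C x = r *\<^sub>R x"
    and cinner_add_left: "cinner (x + y) z = cinner x z + cinner y z"
    and cinner_scaleC_left: "cinner (a *\<^sub>C x) y = a * cinner x y"
    and cinner_commute: "cinner y x = cnj (cinner x y)"
    and inner_eq_Re_cinner: "inner x y = Re (cinner x y)"
begin

lemma cinner_scaleC_right: "cinner x (a *\<^sub>C y) = cnj a * cinner x y"
  by (metis cinner_commute cinner_scaleC_left complex_cnj_cnj complex_cnj_mult)

lemma cinner_self: "cinner x x = complex_of_real ((norm x)\<^sup>2)"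
proof -
  have "Im (cinner x x) = 0"
    using cinner_commute[of x x] by (metis cnj.simps(2) neg_equal_zero)
  moreover have "Re (cinner x x) = (norm x)\<^sup>2"
    using inner_eq_Re_cinner[of x x] power2_norm_eq_inner[of x] by simp
  ultimately show ?thesis
    by (simp add: complex_eq_iff)
qed

lemma norm_scaleC: "norm (a *\<^sub>C x) = cmod a * norm x"
proof -
  have "complex_of_real ((norm (a *\<^sub>C x))\<^sup>2) = a * cnj a * complex_of_real ((norm x)\<^sup>2)"
    by (simp only: cinner_self[symmetric] cinner_scaleC_left cinner_scaleC_right mult_ac)
  also have "\<dots> = complex_of_real ((cmod a * norm x)\<^sup>2)"
    by (simp only: complex_norm_square[symmetric] power_mult_distrib of_real_mult)
  finally have "(norm (a *\<^sub>C x))\<^sup>2 = (cmod a * norm x)\<^sup>2"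
    by (simp only: of_real_eq_iff)
  thus ?thesis
    by (simp add: power2_eq_iff_nonneg)
qed

end

instantiation complex :: complex_hilbert
begin

definition scaleC_complex :: "complex \<Rightarrow> complex \<Rightarrow> complex" where
  "scaleC_complex a x = a * x"

definition cinner_complex :: "complex \<Rightarrow> complex \<Rightarrow> complex" where
  "cinner_complex x y = x * cnj y"

instance
  by standard
    (auto simp: scaleC_complex_def cinner_complex_def algebra_simps scaleR_conv_of_real
      inner_complex_def)

end

definition is_onb :: "'h::complex_hilbert set \<Rightarrow> bool" where
  "is_onb E \<longleftrightarrow> (\<forall>e\<in>E. \<forall>f\<in>E. cinner e f = (if e = f then 1 else 0)) \<and>
     (\<forall>h. (\<forall>e\<in>E. cinner h e = 0) \<longrightarrow> h = 0)"


section \<open>Bounded operators\<close>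

text \<open>Elements of \<^typ>\<open>'a \<Rightarrow>\<^sub>L 'b\<close> are bounded and real-linear; those satisfying \<open>clinear_op\<close> form
  the space of bounded complex-linear operators.\<close>

definition clinear_op :: "('a::complex_hilbert \<Rightarrow>\<^sub>L 'b::complex_hilbert) \<Rightarrow> bool" where
  "clinear_op T \<longleftrightarrow> (\<forall>c x. blinfun_apply T (c *\<^sub>C x) = c *\<^sub>C blinfun_apply T x)"

lift_definition scaleC_op ::
  "complex \<Rightarrow> ('a::complex_hilbert \<Rightarrow>\<^sub>L 'b::complex_hilbert) \<Rightarrow> ('a \<Rightarrow>\<^sub>L 'b)"
  is "\<lambda>c T x. c *\<^sub>C T x"
proof -
  fix c :: complex and T :: "'a \<Rightarrow> 'b"
  assume "bounded_linear T"
  moreover have "bounded_linear (\<lambda>y::'b. c *\<^sub>C y)"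
  proof (rule bounded_linear_intro[where K = "cmod c"])
    fix x y :: 'b and r :: real
    show "c *\<^sub>C (x + y) = c *\<^sub>C x + c *\<^sub>C y"
      by (rule scaleC_add_right)
    show "c *\<^sub>C (r *\<^sub>R x) = r *\<^sub>R (c *\<^sub>C x)"
      by (simp only: scaleC_complex_of_real[symmetric] scaleC_scaleC mult.commute)
    show "norm (c *\<^sub>C x) \<le> norm x * cmod c"
      by (simp add: norm_scaleC mult.commute)
  qed
  ultimately show "bounded_linear (\<lambda>x. c *\<^sub>C T x)"
    by (rule bounded_linear_compose[rotated])
qed

definition adj_op ::
  "('a::complex_hilbert \<Rightarrow>\<^sub>L 'b::complex_hilbert) \<Rightarrow> ('b \<Rightarrow>\<^sub>L 'a)" where
  "adj_op T = (SOME S. \<forall>x y. cinner (blinfun_apply T x) y = cinner x (blinfun_apply S y))"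

definition op_pow :: "('a::complex_hilbert \<Rightarrow>\<^sub>L 'a) \<Rightarrow> nat \<Rightarrow> ('a \<Rightarrow>\<^sub>L 'a)" where
  "op_pow T n = ((\<lambda>S. T o\<^sub>L S) ^^ n) id_blinfun"

text \<open>The library function \<^const>\<open>exp\<close> needs a Banach algebra whose unit has norm 1, which would
  exclude the zero space; hence the exponential series (convergent in operator norm) is written out.\<close>

definition op_exp :: "('a::complex_hilbert \<Rightarrow>\<^sub>L 'a) \<Rightarrow> ('a \<Rightarrow>\<^sub>L 'a)" where
  "op_exp T = (\<Sum>n. op_pow T n /\<^sub>R fact n)"

definition is_resolvent ::
  "('a::complex_hilbert \<Rightarrow>\<^sub>L 'a) \<Rightarrow> complex \<Rightarrow> ('a \<Rightarrow>\<^sub>L 'a) \<Rightarrow> bool" where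
  "is_resolvent T z S \<longleftrightarrow> clinear_op S \<and>
     S o\<^sub>L (scaleC_op z id_blinfun - T) = id_blinfun \<and>
     (scaleC_op z id_blinfun - T) o\<^sub>L S = id_blinfun"

definition resolvent_set :: "('a::complex_hilbert \<Rightarrow>\<^sub>L 'a) \<Rightarrow> complex set" where
  "resolvent_set T = {z. \<exists>S. is_resolvent T z S}"

definition resolvent :: "('a::complex_hilbert \<Rightarrow>\<^sub>L 'a) \<Rightarrow> complex \<Rightarrow> ('a \<Rightarrow>\<^sub>L 'a)" where
  "resolvent T z = (THE S. is_resolvent T z S)"

definition sector :: "real \<Rightarrow> complex set" where
  "sector \<theta> = {z. z \<noteq> 0 \<and> \<bar>Arg z\<bar> < \<theta>}"

definition sectorial :: "('a::complex_hilbert \<Rightarrow>\<^sub>L 'a) \<Rightarrow> bool" where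
  "sectorial T \<longleftrightarrow> (\<exists>\<theta>. pi / 2 < \<theta> \<and> \<theta> < pi \<and> sector \<theta> \<subseteq> resolvent_set T \<and>
     (\<exists>M. \<forall>z\<in>sector \<theta>. cmod z * norm (resolvent T z) \<le> M))"


section \<open>Hilbert--Schmidt operators on the half line and admissible systems\<close>

text \<open>The library has no type of square integrable functions. Elements of
  \<open>L\<^sup>2((0,\<infinity>);\<complex>)\<close> are represented by functions, and equality almost everywhere
  replaces equality.\<close>

abbreviation half_line :: "real measure" where
  "half_line \<equiv> lebesgue_on {0<..}"

definition L2 :: "(real \<Rightarrow> complex) set" where
  "L2 = {f \<in> borel_measurable half_line. integrable half_line (\<lambda>s. (cmod (f s))\<^sup>2)}"

definition L2_inner :: "(real \<Rightarrow> complex) \<Rightarrow> (real \<Rightarrow> complex) \<Rightarrow> complex" where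
  "L2_inner f g = (LINT s|half_line. f s * cnj (g s))"

definition L2_norm :: "(real \<Rightarrow> complex) \<Rightarrow> real" where
  "L2_norm f = sqrt (LINT s|half_line. (cmod (f s))\<^sup>2)"

definition L2_onb :: "(nat \<Rightarrow> real \<Rightarrow> complex) \<Rightarrow> bool" where
  "L2_onb e \<longleftrightarrow> (\<forall>n. e n \<in> L2) \<and>
     (\<forall>m n. L2_inner (e m) (e n) = (if m = n then 1 else 0)) \<and>
     (\<forall>f\<in>L2. (\<forall>n. L2_inner f (e n) = 0) \<longrightarrow> (AE s in half_line. f s = 0))"

definition hilbert_schmidt :: "((real \<Rightarrow> complex) \<Rightarrow> 'h::complex_hilbert) \<Rightarrow> bool" where
  "hilbert_schmidt T \<longleftrightarrow>
     (\<forall>f\<in>L2. \<forall>g\<in>L2. T (\<lambda>s. f s + g s) = T f + T g) \<and>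
     (\<forall>c. \<forall>f\<in>L2. T (\<lambda>s. c * f s) = c *\<^sub>C T f) \<and>
     (\<exists>K. \<forall>f\<in>L2. norm (T f) \<le> K * L2_norm f) \<and>
     (\<exists>e. L2_onb e \<and> summable (\<lambda>n. (norm (T (e n)))\<^sup>2))"

text \<open>\<open>admissible22 A B C\<close> says that the system \<open>(-A, B, C)\<close> is \<open>(2,2)\<close> admissible.\<close>

definition admissible22 ::
  "('h::complex_hilbert \<Rightarrow>\<^sub>L 'h) \<Rightarrow> (complex \<Rightarrow>\<^sub>L 'h) \<Rightarrow> ('h \<Rightarrow>\<^sub>L complex) \<Rightarrow> bool" where
  "admissible22 A B C \<longleftrightarrow>
     (let \<theta> = (\<lambda>f s. blinfun_apply (op_exp (- (s *\<^sub>R adj_op A)))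
                       (blinfun_apply (adj_op C) (f s)));
          \<xi> = (\<lambda>f s. blinfun_apply (op_exp (- (s *\<^sub>R A))) (blinfun_apply B (f s)))
      in (\<forall>f\<in>L2. integrable half_line (\<theta> f)) \<and> (\<forall>f\<in>L2. integrable half_line (\<xi> f)) \<and>
         hilbert_schmidt (\<lambda>f. LINT s|half_line. \<theta> f s) \<and>
         hilbert_schmidt (\<lambda>f. LINT s|half_line. \<xi> f s))"


section \<open>Determinants and the tau function\<close>

text \<open>Determinant of the compression of \<open>K\<close> to the span of the finite orthonormal set \<open>S\<close>
  (the Leibniz formula of \<^const>\<open>det\<close>, with index set \<open>S\<close> in place of a finite type).\<close>

definition principal_minor :: "('h::complex_hilbert \<Rightarrow>\<^sub>L 'h) \<Rightarrow> 'h set \<Rightarrow> complex" where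
  "principal_minor K S =
     (\<Sum>p | p permutes S. of_int (sign p) * (\<Prod>e\<in>S. cinner (blinfun_apply K e) (p e)))"

text \<open>Fredholm determinant \<open>det (I + K) = (\<Sum>k. trace (\<Lambda>\<^sup>k K))\<close> of a trace class operator \<open>K\<close>.
  The vectors \<open>e\<^sub>1 \<and> \<dots> \<and> e\<^sub>k\<close> indexed by the \<open>k\<close>-element subsets \<open>S\<close> of an orthonormal basis form
  an orthonormal basis of the exterior power, and the diagonal entry of \<open>\<Lambda>\<^sup>k K\<close> at \<open>S\<close> is the principal
  minor. For trace class \<open>K\<close> the sum is absolutely convergent and independent of the basis.\<close>

definition fredholm_det :: "('h::complex_hilbert \<Rightarrow>\<^sub>L 'h) \<Rightarrow> complex" where
  "fredholm_det K =
     (let E = (SOME E. is_onb E) in \<Sum>\<^sub>\<infinity>S\<in>{S. finite S \<and> S \<subseteq> E}. principal_minor K S)"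

text \<open>Sequences \<open>(t\<^sub>j)\<close> with \<open>j \<ge> 1\<close> are functions on \<^typ>\<open>nat\<close> whose value at \<open>0\<close> is never used.\<close>

definition C0_inf :: "(nat \<Rightarrow> complex) set" where
  "C0_inf = {t. (\<lambda>j. root j (cmod (t j))) \<longlonglongrightarrow> 0}"

definition miwa :: "complex \<Rightarrow> nat \<Rightarrow> complex" where
  "miwa s j = s ^ j / of_nat j"

definition V_op :: "('h::complex_hilbert \<Rightarrow>\<^sub>L 'h) \<Rightarrow> (nat \<Rightarrow> complex) \<Rightarrow> ('h \<Rightarrow>\<^sub>L 'h)" where
  "V_op A2 t = op_exp (\<Sum>j. scaleC_op (t (Suc j)) (op_pow A2 (Suc j)))"

definition W_op :: "('h::complex_hilbert \<Rightarrow>\<^sub>L 'h) \<Rightarrow> (nat \<Rightarrow> complex) \<Rightarrow> ('h \<Rightarrow>\<^sub>L 'h)" where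
  "W_op A1 t = op_exp (- (\<Sum>j. scaleC_op (t (Suc j)) (op_pow (- A1) (Suc j))))"

definition R_op :: "('h::complex_hilbert \<Rightarrow>\<^sub>L 'h) \<Rightarrow> ('h \<Rightarrow>\<^sub>L 'h) \<Rightarrow> (complex \<Rightarrow>\<^sub>L 'h) \<Rightarrow>
    ('h \<Rightarrow>\<^sub>L complex) \<Rightarrow> real \<Rightarrow> ('h \<Rightarrow>\<^sub>L 'h)" where
  "R_op A1 A2 B C x =
     integral {x..} (\<lambda>v. op_exp (- (v *\<^sub>R A2)) o\<^sub>L B o\<^sub>L C o\<^sub>L op_exp (- (v *\<^sub>R A1)))"

definition tau :: "('h::complex_hilbert \<Rightarrow>\<^sub>L 'h) \<Rightarrow> ('h \<Rightarrow>\<^sub>L 'h) \<Rightarrow> (complex \<Rightarrow>\<^sub>L 'h) \<Rightarrow>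
    ('h \<Rightarrow>\<^sub>L complex) \<Rightarrow> real \<Rightarrow> (nat \<Rightarrow> complex) \<Rightarrow> complex" where
  "tau A1 A2 B C x t = fredholm_det (V_op A2 t o\<^sub>L R_op A1 A2 B C x o\<^sub>L W_op A1 t)"

definition wronskian :: "(real \<Rightarrow> complex) \<Rightarrow> (real \<Rightarrow> complex) \<Rightarrow> real \<Rightarrow> complex" where
  "wronskian f g x = f x * vector_derivative g (at x) - g x * vector_derivative f (at x)"

text \<open>A continuous branch \<open>L\<close> of \<open>log F\<close> on an open neighbourhood \<open>U\<close> of \<open>p\<close>. The principal branch
  \<^const>\<open>Ln\<close> would be discontinuous where \<open>F\<close> crosses the negative real axis.\<close>

definition log_branch ::
  "(real \<times> complex \<Rightarrow> complex) \<Rightarrow> real \<times> complex \<Rightarrow> (real \<times> complex) set \<Rightarrow>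
     (real \<times> complex \<Rightarrow> complex) \<Rightarrow> bool" where
  "log_branch F p U L \<longleftrightarrow> open U \<and> p \<in> U \<and> continuous_on U L \<and> (\<forall>q\<in>U. exp (L q) = F q)"

end

theory Submission
  imports Defs
begin

text \<open>Write \<open>R\<close> for \<open>R\<^sub>x\<close>, and put \<open>b = exp (-x A2) B\<close>, \<open>c = C exp (-x A1)\<close>. Everything rests on two facts.
First, \<open>exp (\<Sum>j. s^j A^j / j)\<close> is \<open>(I - s A)^(-1)\<close>, so adding \<open>[s]\<close> to the times multiplies \<open>V(t)\<close> by
\<open>(I - s A2)^(-1)\<close> and \<open>W(t)\<close> by \<open>I + s A1\<close> (\<open>V_op_shift\<close>, \<open>W_op_shift\<close>). Second, \<open>R\<close> solves the
Sylvester equation \<open>A2 R + R A1 = b c\<close>, whose right-hand side has rank one (\<open>sylvester\<close>). Together they give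
\<open>(I - s A2)^(-1) R (I + s A1) = R + s (I - s A2)^(-1) b c\<close> (\<open>neumann_sandwich\<close>). One shift therefore changes
\<open>K = V R W\<close> by an operator of rank one, two shifts change it by one of rank two, and the functionals that occur are
always \<open>c W\<close> and \<open>c A1 W\<close>, whatever the shifts. As \<open>dR/dx = - b c\<close>, the derivative of \<open>tau\<close> in \<open>x\<close> is also
governed by a perturbation of rank one.

For a finite square matrix \<open>Y\<close>, \<open>det (Y + u c)\<close> is affine in \<open>c\<close>, say \<open>D + \<alpha>(c)\<close>, and
\<open>D det (Y + u c + v d) = (D + \<alpha>(c)) (D + \<beta>(d)) - \<alpha>(d) \<beta>(c)\<close>, where \<open>\<beta>\<close> belongs to \<open>v\<close> as \<open>\<alpha>\<close> does to \<open>u\<close>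
(\<open>sdet_add_rank_two\<close>). Inserting the perturbations above, \<open>D (a - b) \<tau>(t + [a] + [b])\<close> becomes the determinant of two
plane vectors, one depending on \<open>a\<close> only and the other on \<open>b\<close> only (\<open>sdet_pair_shift\<close>). Fay's identity is then the
Pluecker relation between four plane vectors (\<open>sdet_fay\<close>; the case \<open>D = 0\<close> follows by adding small multiples of the
identity matrix), and its differential form is the same formula combined with the one for the derivative.

The Fredholm determinant is a sum of principal minors over the finite subsets of an orthonormal basis, and the partial sum
over the subsets of a finite set \<open>F\<close> is the determinant of the compression of \<open>I + K\<close> to the span of \<open>F\<close>. So matrix
identities pass to the limit as soon as the sum converges. For \<open>K\<close> of trace norm at most \<open>\<nu>\<close>, Hadamard's
inequality bounds the sum of the absolute values of the minors by \<open>exp \<nu>\<close> (\<open>nuclear_minors_le\<close>); \<open>R\<close> is such an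
operator because it is an integral of rank one operators whose norms decay exponentially.

Regularity comes from the same bound. Along a rank one operator the determinant is affine, so its increment can be
computed from a perturbation rescaled to norm one; adding up rank one pieces gives a Lipschitz estimate in trace norm
(\<open>fredholm_det_lipschitz\<close>). Hence \<open>tau\<close> is jointly continuous in \<open>x\<close> and the shift, and differentiable in \<open>x\<close>. The third
identity follows from the second: divided by the two tau functions, the Wronskian is the increment of \<open>\<partial>/\<partial>x log \<tau>\<close>
between two values of \<open>\<zeta>\<close>, the factor \<open>(s1 - s2) / (s1 s2)\<close> is the increment of \<open>\<zeta>\<close>, and continuity lets the two
values merge.\<close>

section \<open>Determinants over finite index sets\<close>

text \<open>Principal minors of an operator are indexed by finite sets of basis vectors, so row and column indices are elements of
an arbitrary finite set instead of a finite type.\<close>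

definition sdet :: "'a set \<Rightarrow> ('a \<Rightarrow> 'a \<Rightarrow> complex) \<Rightarrow> complex" where
  "sdet S M = (\<Sum>p | p permutes S. of_int (sign p) * (\<Prod>e\<in>S. M e (p e)))"

lemma principal_minor_eq_sdet:
  "principal_minor K S = sdet S (\<lambda>e f. cinner (blinfun_apply K e) f)"
  by (simp add: principal_minor_def sdet_def)

lemma sdet_cong:
  assumes "\<And>e f. e \<in> S \<Longrightarrow> f \<in> S \<Longrightarrow> M e f = N e f"
  shows "sdet S M = sdet S N"
  unfolding sdet_def
  by (intro sum.cong refl arg_cong2[of _ _ _ _ "(*)"] prod.cong)
    (use assms in \<open>auto simp: permutes_in_image\<close>)

lemma sdet_empty [simp]: "sdet {} M = 1"
  by (simp add: sdet_def permutes_empty sign_id[unfolded id_def])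

lemma sdet_row:
  assumes "finite S" "e \<in> S"
  shows "sdet S (M(e := r)) =
    (\<Sum>p | p permutes S. of_int (sign p) * r (p e) * (\<Prod>f\<in>S - {e}. M f (p f)))"
  unfolding sdet_def
proof (intro sum.cong refl)
  fix p
  have "(\<Prod>f\<in>S. (M(e := r)) f (p f)) = r (p e) * (\<Prod>f\<in>S - {e}. (M(e := r)) f (p f))"
    using assms by (subst prod.remove) auto
  also have "(\<Prod>f\<in>S - {e}. (M(e := r)) f (p f)) = (\<Prod>f\<in>S - {e}. M f (p f))"
    by (intro prod.cong) auto
  finally show "of_int (sign p) * (\<Prod>f\<in>S. (M(e := r)) f (p f)) =
      of_int (sign p) * r (p e) * (\<Prod>f\<in>S - {e}. M f (p f))"
    by simp
qed

lemma sdet_row_sum: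
  assumes "finite S" "e \<in> S"
  shows "sdet S (M(e := \<lambda>f. \<Sum>i\<in>I. z i * r i f)) = (\<Sum>i\<in>I. z i * sdet S (M(e := r i)))"
  unfolding sdet_row[OF assms] sum_distrib_left sum_distrib_right
  by (subst sum.swap) (simp add: mult_ac)

lemma sdet_row_linear:
  assumes "finite S" "e \<in> S"
  shows "sdet S (M(e := \<lambda>f. r f + z * q f)) = sdet S (M(e := r)) + z * sdet S (M(e := q))"
  unfolding sdet_row[OF assms] sum_distrib_left sum.distrib[symmetric]
  by (simp add: algebra_simps)

lemma sdet_transpose:
  assumes "finite S"
  shows "sdet S (\<lambda>e f. M f e) = sdet S M"
proof -
  have "sdet S (\<lambda>e f. M f e) = (\<Sum>p | p permutes S. of_int (sign (inv p)) * (\<Prod>e\<in>S. M (inv p e) e))"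
    unfolding sdet_def by (rule sum_permutations_inverse)
  also have "\<dots> = sdet S M"
    unfolding sdet_def
  proof (intro sum.cong refl arg_cong2[of _ _ _ _ "(*)"])
    fix p assume "p \<in> {p. p permutes S}"
    then have p: "p permutes S" by simp
    show "of_int (sign (inv p)) = (of_int (sign p) :: complex)"
      using sign_inverse[OF permutation_permutes[THEN iffD2]] p assms by metis
    have "(\<Prod>e\<in>S. M (inv p e) e) = (\<Prod>e\<in>S. M (inv p (p e)) (p e))"
      using prod.permute[OF p, of "\<lambda>e. M (inv p e) e"] by (simp add: o_def)
    then show "(\<Prod>e\<in>S. M (inv p e) e) = (\<Prod>e\<in>S. M e (p e))"
      using permutes_inverses[OF p] by simp
  qed
  finally show ?thesis .
qed

lemma sdet_permute_rows:
  assumes "finite S" "q permutes S"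
  shows "sdet S (\<lambda>g. M (q g)) = of_int (sign q) * sdet S M"
proof -
  have "sdet S (\<lambda>g. M (q g)) =
      (\<Sum>p | p permutes S. of_int (sign (p \<circ> q)) * (\<Prod>g\<in>S. M (q g) ((p \<circ> q) g)))"
    unfolding sdet_def by (rule sum_permutations_compose_right[OF assms(2)])
  also have "\<dots> = (\<Sum>p | p permutes S. of_int (sign q) * (of_int (sign p) * (\<Prod>g\<in>S. M g (p g))))"
  proof (intro sum.cong refl)
    fix p assume "p \<in> {p. p permutes S}"
    then have p: "p permutes S" by simp
    have "sign (p \<circ> q) = sign p * sign q"
      using p assms permutation_permutes by (intro sign_compose) blast+
    moreover have "(\<Prod>g\<in>S. M (q g) ((p \<circ> q) g)) = (\<Prod>g\<in>S. M g (p g))"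
      using prod.permute[OF assms(2), of "\<lambda>g. M g (p g)"] by (simp add: o_def)
    ultimately show "of_int (sign (p \<circ> q)) * (\<Prod>g\<in>S. M (q g) ((p \<circ> q) g)) =
        of_int (sign q) * (of_int (sign p) * (\<Prod>g\<in>S. M g (p g)))"
      by simp
  qed
  finally show ?thesis by (simp add: sdet_def sum_distrib_left)
qed

lemma sdet_swap_rows:
  assumes "finite S" "e \<in> S" "f \<in> S" "e \<noteq> f"
  shows "sdet S (\<lambda>g. M (Transposition.transpose e f g)) = - sdet S M"
  using sdet_permute_rows[OF assms(1) permutes_swap_id[OF assms(2,3)], of M] assms(4)
  by (simp add: sign_swap_id)

lemma sdet_equal_rows:
  assumes "finite S" "e \<in> S" "f \<in> S" "e \<noteq> f" "\<And>g. g \<in> S \<Longrightarrow> M e g = M f g"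
  shows "sdet S M = 0"
proof -
  have "sdet S M = sdet S (\<lambda>g. M (Transposition.transpose e f g))"
    by (rule sdet_cong) (use assms in \<open>auto simp: Transposition.transpose_def\<close>)
  also have "\<dots> = - sdet S M" by (rule sdet_swap_rows) fact+
  finally show ?thesis by simp
qed

lemma sdet_row_op:
  assumes "finite S" "e \<in> S" "f \<in> S" "e \<noteq> f"
  shows "sdet S (M(f := \<lambda>g. M f g + z * M e g)) = sdet S M"
proof -
  have "sdet S (M(f := \<lambda>g. M f g + z * M e g)) = sdet S (M(f := M f)) + z * sdet S (M(f := M e))"
    by (rule sdet_row_linear) fact+
  also have "sdet S (M(f := M e)) = 0"
    by (rule sdet_equal_rows[of S e f]) (use assms in auto)
  finally show ?thesis by (simp del: fun_upd_apply)
qed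

lemma sdet_row_ops:
  assumes "finite S" "e \<in> S" "T \<subseteq> S" "e \<notin> T"
  shows "sdet S (\<lambda>f. if f \<in> T then (\<lambda>g. M f g + z f * M e g) else M f) = sdet S M"
proof -
  have "finite T" using assms finite_subset by blast
  then show ?thesis using assms(3,4)
  proof (induction T rule: finite_induct)
    case (insert t T)
    let ?N = "\<lambda>f. if f \<in> T then (\<lambda>g. M f g + z f * M e g) else M f"
    have "(\<lambda>f. if f \<in> insert t T then (\<lambda>g. M f g + z f * M e g) else M f) =
        ?N(t := \<lambda>g. ?N t g + z t * ?N e g)"
      using insert by (auto simp: fun_eq_iff)
    then show ?case using sdet_row_op[of S e t ?N "z t"] insert assms by auto
  qed simp
qed

lemma sdet_pivot_column:
  assumes "finite S" "e \<notin> S" "\<And>f. f \<in> S \<Longrightarrow> M f e = 0"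
  shows "sdet (insert e S) M = M e e * sdet S M"
proof -
  have "sdet (insert e S) M =
      (\<Sum>p | p permutes S. of_int (sign p) * (\<Prod>f\<in>insert e S. M f (p f)))"
    unfolding sdet_def
  proof (rule sum.mono_neutral_right)
    show "finite {p. p permutes insert e S}" using assms by (simp add: finite_permutations)
    show "{p. p permutes S} \<subseteq> {p. p permutes insert e S}" by (auto intro: permutes_subset)
    show "\<forall>p\<in>{p. p permutes insert e S} - {p. p permutes S}.
        of_int (sign p) * (\<Prod>f\<in>insert e S. M f (p f)) = 0"
    proof
      fix p assume "p \<in> {p. p permutes insert e S} - {p. p permutes S}"
      then have p: "p permutes insert e S" and np: "\<not> p permutes S" by auto
      have "p e \<noteq> e"
      proof
        assume "p e = e"
        then have "p permutes S"
          using p permutes_superset[OF p, of S] by auto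
        then show False using np by simp
      qed
      moreover obtain f where f: "f \<in> insert e S" "p f = e"
        using permutes_image[OF p] by (metis imageE insertI1)
      ultimately have "f \<in> S" by auto
      then have "M f (p f) = 0" using assms f by simp
      then have "(\<Prod>f\<in>insert e S. M f (p f)) = 0"
        using f assms(1) by (auto intro!: prod_zero)
      then show "of_int (sign p) * (\<Prod>f\<in>insert e S. M f (p f)) = 0" by simp
    qed
  qed
  also have "\<dots> = (\<Sum>p | p permutes S. M e e * (of_int (sign p) * (\<Prod>f\<in>S. M f (p f))))"
    using assms by (intro sum.cong) (auto simp: permutes_not_in)
  finally show ?thesis by (simp add: sdet_def sum_distrib_left)
qed

lemma sdet_pivot_row:
  assumes "finite S" "e \<notin> S" "\<And>f. f \<in> S \<Longrightarrow> M e f = 0"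
  shows "sdet (insert e S) M = M e e * sdet S M"
  using sdet_pivot_column[of S e "\<lambda>e f. M f e"] assms
  by (simp add: sdet_transpose[of _ M])

text \<open>Clearing the column of the pivot by row operations leaves the Schur complement.\<close>

lemma sdet_schur:
  assumes "finite S" "e \<notin> S" "M e e = 1"
  shows "sdet (insert e S) M = sdet S (\<lambda>f g. M f g - M f e * M e g)"
proof -
  have "sdet (insert e S) M =
      sdet (insert e S) (\<lambda>f. if f \<in> S then (\<lambda>g. M f g + (- M f e) * M e g) else M f)"
    by (rule sdet_row_ops[symmetric]) (use assms in auto)
  also have "\<dots> = sdet S (\<lambda>f. if f \<in> S then (\<lambda>g. M f g + (- M f e) * M e g) else M f)"
    by (subst sdet_pivot_column) (use assms in auto)
  also have "\<dots> = sdet S (\<lambda>f g. M f g - M f e * M e g)"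
    by (rule sdet_cong) auto
  finally show ?thesis .
qed

text \<open>Each row in \<open>T\<close> is the sum of \<open>x\<close> times a unit row and the old row. The subset \<open>U\<close> collects the rows for which
the unit row is chosen; these rows and their columns drop out of the determinant.\<close>

lemma sdet_add_diagonal_on:
  assumes "finite F" "T \<subseteq> F"
  shows "sdet F (\<lambda>e f. (if e = f \<and> e \<in> T then x else 0) + M e f) =
    (\<Sum>U\<in>Pow T. x ^ card U * sdet (F - U) M)"
proof -
  have "finite T" using assms finite_subset by blast
  then show ?thesis using assms
  proof (induction T arbitrary: F rule: finite_induct)
    case (insert t T)
    let ?N = "\<lambda>e f. (if e = f \<and> e \<in> T then x else 0) + M e f"
    have tF: "t \<in> F" "finite F" using insert by auto
    have "(\<lambda>e f. (if e = f \<and> e \<in> insert t T then x else 0) + M e f) =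
        ?N(t := \<lambda>f. ?N t f + x * (if f = t then 1 else 0))"
      using insert by (auto simp: fun_eq_iff)
    then have "sdet F (\<lambda>e f. (if e = f \<and> e \<in> insert t T then x else 0) + M e f) =
        sdet F (?N(t := ?N t)) + x * sdet F (?N(t := \<lambda>f. if f = t then 1 else 0))"
      using sdet_row_linear[OF tF(2,1), of ?N "?N t" x "\<lambda>f. if f = t then 1 else 0"] by simp
    also have "sdet F (?N(t := ?N t)) = (\<Sum>U\<in>Pow T. x ^ card U * sdet (F - U) M)"
    proof -
      have "?N(t := ?N t) = ?N" by (rule fun_upd_triv)
      moreover have "sdet F ?N = (\<Sum>U\<in>Pow T. x ^ card U * sdet (F - U) M)"
        using insert by (intro insert.IH) auto
      ultimately show ?thesis by (simp only:)
    qed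
    also have "sdet F (?N(t := \<lambda>f. if f = t then 1 else 0)) =
        sdet (insert t (F - {t})) (?N(t := \<lambda>f. if f = t then 1 else 0))"
      using tF by (simp add: insert_absorb)
    also have "\<dots> = sdet (F - {t}) (?N(t := \<lambda>f. if f = t then 1 else 0))"
      by (subst sdet_pivot_row) (use tF in auto)
    also have "\<dots> = sdet (F - {t}) ?N"
      by (rule sdet_cong) auto
    also have "\<dots> = (\<Sum>U\<in>Pow T. x ^ card U * sdet (F - {t} - U) M)"
      using insert by (intro insert.IH) auto
    also have "x * \<dots> = (\<Sum>U\<in>insert t ` Pow T. x ^ card U * sdet (F - U) M)"
    proof -
      have inj: "inj_on (insert t) (Pow T)"
        using insert(2) by (auto simp: inj_on_def)
      have card: "card (insert t U) = Suc (card U)" if "U \<subseteq> T" for U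
      proof -
        have "t \<notin> U" "finite U" using that insert.hyps finite_subset[OF that] by auto
        then show ?thesis by simp
      qed
      have diff: "F - {t} - U = F - insert t U" for U by blast
      show ?thesis
        unfolding sum.reindex[OF inj] sum_distrib_left
        by (intro sum.cong) (auto simp: card diff)
    qed
    also have "(\<Sum>U\<in>Pow T. x ^ card U * sdet (F - U) M) +
        (\<Sum>U\<in>insert t ` Pow T. x ^ card U * sdet (F - U) M) =
        (\<Sum>U\<in>Pow (insert t T). x ^ card U * sdet (F - U) M)"
      unfolding Pow_insert by (rule sum.union_disjoint[symmetric]) (use insert in auto)
    finally show ?case .
  qed simp
qed

text \<open>For \<open>x = 1\<close> this turns the sum of all principal minors into one determinant; for general \<open>x\<close> it shows that the
characteristic polynomial is monic.\<close>

lemma sdet_add_diagonal: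
  assumes "finite F"
  shows "sdet F (\<lambda>e f. (if e = f then x else 0) + M e f) =
    (\<Sum>S\<in>Pow F. x ^ card (F - S) * sdet S M)"
proof -
  have "sdet F (\<lambda>e f. (if e = f then x else 0) + M e f) =
      sdet F (\<lambda>e f. (if e = f \<and> e \<in> F then x else 0) + M e f)"
    by (rule sdet_cong) auto
  also have "\<dots> = (\<Sum>U\<in>Pow F. x ^ card U * sdet (F - U) M)"
    using assms by (rule sdet_add_diagonal_on) simp
  also have "\<dots> = (\<Sum>S\<in>Pow F. x ^ card (F - S) * sdet S M)"
    by (rule sum.reindex_bij_witness[of _ "\<lambda>S. F - S" "\<lambda>S. F - S"]) (auto simp: double_diff)
  finally show ?thesis .
qed

subsection \<open>Cramer's rule and low-rank perturbations\<close>

text \<open>The right-hand side treats the row \<open>g\<close> and the column \<open>h\<close> alike, so a unit row and a unit column give the same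
cofactor. This connects expansions along rows with expansions along columns.\<close>

lemma sdet_unit_row:
  assumes "finite F" "g \<in> F" "h \<in> F"
  shows "sdet F (M(g := \<lambda>f. if f = h then 1 else 0)) =
    sdet F (\<lambda>e f. if e = g then (if f = h then 1 else 0) else if f = h then 0 else M e f)"
proof -
  let ?N = "M(g := \<lambda>f. if f = h then 1 else 0)"
  have "sdet F ?N = sdet F (\<lambda>e. if e \<in> F - {g} then (\<lambda>f. ?N e f + (- M e h) * ?N g f) else ?N e)"
    by (rule sdet_row_ops[symmetric]) (use assms in auto)
  also have "\<dots> = sdet F (\<lambda>e f. if e = g then (if f = h then 1 else 0) else if f = h then 0 else M e f)"
    by (rule sdet_cong) auto
  finally show ?thesis .
qed

lemma sdet_replace_column:
  assumes "finite F" "h \<in> F"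
  shows "sdet F (\<lambda>e f. if f = h then k e else M e f) =
    (\<Sum>g\<in>F. k g * sdet F (M(g := \<lambda>f. if f = h then 1 else 0)))"
proof -
  let ?T = "\<lambda>f e. M e f"
  have "sdet F (\<lambda>e f. if f = h then k e else M e f) = sdet F (\<lambda>f e. if f = h then k e else M e f)"
    by (rule sdet_transpose[OF assms(1)])
  also have "\<dots> = sdet F (?T(h := \<lambda>e. \<Sum>g\<in>F. k g * (if e = g then 1 else 0)))"
    by (rule sdet_cong) (use assms in \<open>auto simp: if_distrib cong: if_cong\<close>)
  also have "\<dots> = (\<Sum>g\<in>F. k g * sdet F (?T(h := \<lambda>e. if e = g then 1 else 0)))"
    by (rule sdet_row_sum[OF assms])
  also have "\<dots> = (\<Sum>g\<in>F. k g * sdet F (M(g := \<lambda>f. if f = h then 1 else 0)))"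
  proof (intro sum.cong refl arg_cong2[of _ _ _ _ "(*)"])
    fix g assume g: "g \<in> F"
    let ?Z = "\<lambda>e f. if e = g then (if f = h then 1 else 0) else if f = h then 0 else M e f"
    have "sdet F (?T(h := \<lambda>e. if e = g then 1 else 0)) =
        sdet F (\<lambda>f e. if f = h then (if e = g then 1 else 0) else if e = g then 0 else M e f)"
      by (rule sdet_unit_row) (use assms g in auto)
    also have "\<dots> = sdet F (\<lambda>f e. ?Z e f)"
      by (rule sdet_cong) auto
    also have "\<dots> = sdet F ?Z" by (rule sdet_transpose[OF assms(1)])
    also have "\<dots> = sdet F (M(g := \<lambda>f. if f = h then 1 else 0))"
      by (rule sdet_unit_row[symmetric]) (use assms g in auto)
    finally show "sdet F (?T(h := \<lambda>e. if e = g then 1 else 0)) =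
        sdet F (M(g := \<lambda>f. if f = h then 1 else 0))" .
  qed
  finally show ?thesis .
qed

text \<open>Cramer's rule with the denominator cleared, so that it also holds for singular \<open>Y\<close>: the determinants of \<open>Y\<close> with a
row replaced by \<open>c\<close> are the coefficients of \<open>det Y * c\<close> with respect to the rows of \<open>Y\<close>.\<close>

lemma sdet_cramer:
  assumes "finite F" "k \<in> F"
  shows "(\<Sum>g\<in>F. sdet F (Y(g := c)) * Y g k) = sdet F Y * c k"
proof -
  have 1: "sdet F (Y(g := c)) = (\<Sum>h\<in>F. c h * sdet F (Y(g := \<lambda>f. if f = h then 1 else 0)))"
    if "g \<in> F" for g
  proof -
    have "sdet F (Y(g := c)) = sdet F (Y(g := \<lambda>f. \<Sum>h\<in>F. c h * (if f = h then 1 else 0)))"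
      by (rule sdet_cong) (use assms in \<open>auto simp: if_distrib cong: if_cong\<close>)
    then show ?thesis using sdet_row_sum[OF assms(1) that] by simp
  qed
  have 2: "(\<Sum>g\<in>F. Y g k * sdet F (Y(g := \<lambda>f. if f = h then 1 else 0))) =
      (if h = k then sdet F Y else 0)" if h: "h \<in> F" for h
  proof -
    have "(\<Sum>g\<in>F. Y g k * sdet F (Y(g := \<lambda>f. if f = h then 1 else 0))) =
        sdet F (\<lambda>e f. if f = h then Y e k else Y e f)"
      by (rule sdet_replace_column[symmetric]) (use assms h in auto)
    also have "\<dots> = (if h = k then sdet F Y else 0)"
    proof (cases "h = k")
      case True
      then show ?thesis by (auto intro!: sdet_cong)
    next
      case False
      have "sdet F (\<lambda>e f. if f = h then Y e k else Y e f) =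
          sdet F (\<lambda>f e. if f = h then Y e k else Y e f)"
        by (rule sdet_transpose[OF assms(1)])
      also have "\<dots> = 0"
        by (rule sdet_equal_rows[of F h k]) (use assms h False in auto)
      finally show ?thesis using False by simp
    qed
    finally show ?thesis .
  qed
  have "(\<Sum>g\<in>F. sdet F (Y(g := c)) * Y g k) =
      (\<Sum>g\<in>F. \<Sum>h\<in>F. c h * (Y g k * sdet F (Y(g := \<lambda>f. if f = h then 1 else 0))))"
    using 1 by (intro sum.cong) (auto simp: sum_distrib_left mult_ac)
  also have "\<dots> = (\<Sum>h\<in>F. c h * (\<Sum>g\<in>F. Y g k * sdet F (Y(g := \<lambda>f. if f = h then 1 else 0))))"
    unfolding sum_distrib_left by (rule sum.swap)
  also have "\<dots> = (\<Sum>h\<in>F. c h * (if h = k then sdet F Y else 0))"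
    using 2 by (intro sum.cong) auto
  also have "\<dots> = sdet F Y * c k"
    using assms by (simp add: if_distrib cong: if_cong)
  finally show ?thesis .
qed

text \<open>The Desnanot--Jacobi identity. By Cramer's rule \<open>det Y * d\<close> is a combination of the rows of \<open>Y\<close>. Put into row \<open>f\<close>,
every row of \<open>Y\<close> other than the rows \<open>e\<close> and \<open>f\<close> produces a matrix with a repeated row.\<close>

lemma sdet_two_rows:
  assumes "finite F" "e \<in> F" "f \<in> F" "e \<noteq> f"
  shows "sdet F Y * sdet F (Y(f := d, e := c)) =
    sdet F (Y(e := c)) * sdet F (Y(f := d)) - sdet F (Y(f := c)) * sdet F (Y(e := d))"
proof -
  let ?X = "Y(e := c)"
  let ?a = "\<lambda>g. sdet F (Y(g := d))"
  have "sdet F Y * sdet F (Y(f := d, e := c)) = sdet F (?X(f := \<lambda>k. 0 + sdet F Y * d k))"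
    unfolding sdet_row_linear[OF assms(1,3)]
    using assms by (simp add: fun_upd_twist sdet_row)
  also have "\<dots> = sdet F (?X(f := \<lambda>k. \<Sum>g\<in>F. ?a g * Y g k))"
    by (rule sdet_cong) (use assms sdet_cramer[OF assms(1), of _ Y d] in \<open>simp del: fun_upd_apply add: fun_upd_same fun_upd_other fun_upd_def[of _ f]\<close>)
  also have "\<dots> = (\<Sum>g\<in>F. ?a g * sdet F (?X(f := Y g)))"
    by (rule sdet_row_sum[OF assms(1,3)])
  also have "\<dots> = (\<Sum>g\<in>{e,f}. ?a g * sdet F (?X(f := Y g)))"
  proof (rule sum.mono_neutral_right)
    show "\<forall>g\<in>F - {e, f}. ?a g * sdet F (?X(f := Y g)) = 0"
    proof
      fix g assume g: "g \<in> F - {e, f}"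
      have "sdet F (?X(f := Y g)) = 0"
        by (rule sdet_equal_rows[of F f g]) (use assms g in auto)
      then show "?a g * sdet F (?X(f := Y g)) = 0" by simp
    qed
  qed (use assms in auto)
  also have "\<dots> = ?a e * sdet F (?X(f := Y e)) + ?a f * sdet F ?X"
  proof -
    have "?X(f := Y f) = ?X" using assms by (auto simp: fun_eq_iff)
    then show ?thesis using assms by simp
  qed
  also have "sdet F (?X(f := Y e)) = - sdet F (Y(f := c))"
  proof -
    have "(\<lambda>g. (Y(f := c)) (Transposition.transpose e f g)) = ?X(f := Y e)"
      using assms by (auto simp: fun_eq_iff Transposition.transpose_def)
    then show ?thesis using sdet_swap_rows[OF assms, of "Y(f := c)"] by simp
  qed
  finally show ?thesis by algebra
qed

text \<open>The coefficient of \<open>z\<close> in \<open>det (Y + z u c)\<close>, that is, \<open>c adj(Y) u\<close>.\<close>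

definition rank_one_term :: "'a set \<Rightarrow> ('a \<Rightarrow> 'a \<Rightarrow> complex) \<Rightarrow> ('a \<Rightarrow> complex) \<Rightarrow> ('a \<Rightarrow> complex) \<Rightarrow> complex" where
  "rank_one_term F Y u c = (\<Sum>e\<in>F. u e * sdet F (Y(e := c)))"

lemma rank_one_term_linear:
  "finite F \<Longrightarrow> rank_one_term F Y u (\<lambda>f. c f + z * d f) = rank_one_term F Y u c + z * rank_one_term F Y u d"
  by (simp add: rank_one_term_def sdet_row_linear sum.distrib sum_distrib_left algebra_simps)

lemma rank_one_term_scale:
  "finite F \<Longrightarrow> rank_one_term F Y u (\<lambda>f. z * d f) = z * rank_one_term F Y u d"
  using rank_one_term_linear[of F Y u "\<lambda>_. 0" z d] by (simp add: rank_one_term_def sdet_row)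

text \<open>The rows are updated one after the other. Once some row has been replaced by \<open>c\<close>, row operations remove the multiples
of \<open>c\<close> from all other rows, so no term of higher order in \<open>u\<close> survives.\<close>

lemma sdet_add_rank_one:
  assumes "finite F"
  shows "sdet F (\<lambda>e f. Y e f + u e * c f) = sdet F Y + rank_one_term F Y u c"
proof -
  let ?N = "\<lambda>T e f. if e \<in> T then Y e f + u e * c f else Y e f"
  have "sdet F (?N T) = sdet F Y + (\<Sum>e\<in>T. u e * sdet F (Y(e := c)))" if "T \<subseteq> F" for T
    using finite_subset[OF that assms] that
  proof (induction T rule: finite_induct)
    case (insert t T)
    have t: "t \<in> F" using insert by auto
    have "?N (insert t T) = (?N T)(t := \<lambda>f. Y t f + u t * c f)"
      by (auto simp: fun_eq_iff)
    then have "sdet F (?N (insert t T)) =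
        sdet F ((?N T)(t := Y t)) + u t * sdet F ((?N T)(t := c))"
      by (simp add: sdet_row_linear[OF assms t])
    also have "(?N T)(t := Y t) = ?N T"
      using insert by (auto simp: fun_eq_iff)
    also have "sdet F ((?N T)(t := c)) =
        sdet F (\<lambda>f. if f \<in> T then (\<lambda>g. ((?N T)(t := c)) f g + (- u f) * ((?N T)(t := c)) t g)
          else ((?N T)(t := c)) f)"
      by (rule sdet_row_ops[symmetric]) (use assms insert in auto)
    also have "\<dots> = sdet F (Y(t := c))"
      by (rule sdet_cong) (use insert in auto)
    also have "sdet F (?N T) = sdet F Y + (\<Sum>e\<in>T. u e * sdet F (Y(e := c)))"
      by (rule insert.IH) (use insert.prems in auto)
    finally have "sdet F (?N (insert t T)) =
        sdet F Y + ((\<Sum>e\<in>T. u e * sdet F (Y(e := c))) + u t * sdet F (Y(t := c)))"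
      by (simp only: add.assoc)
    also have "\<dots> = sdet F Y + (\<Sum>e\<in>insert t T. u e * sdet F (Y(e := c)))"
      by (subst sum.insert[OF insert.hyps(1,2)]) (simp only: add.commute)
    finally show ?case .
  qed simp
  from this[of F] have "sdet F (?N F) = sdet F Y + rank_one_term F Y u c" by (simp add: rank_one_term_def)
  moreover have "sdet F (?N F) = sdet F (\<lambda>e f. Y e f + u e * c f)" by (rule sdet_cong) auto
  ultimately show ?thesis by simp
qed

text \<open>Where \<open>det Y\<close> is nonzero this says that \<open>det (Y + u c + v d) / det Y\<close> is a two-by-two determinant. In the
polynomial form the Desnanot--Jacobi identity supplies the second-order terms.\<close>

lemma sdet_add_rank_two:
  assumes "finite F"
  shows "sdet F Y * sdet F (\<lambda>e f. Y e f + u e * c f + v e * d f) =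
    (sdet F Y + rank_one_term F Y u c) * (sdet F Y + rank_one_term F Y v d) - rank_one_term F Y u d * rank_one_term F Y v c"
proof -
  let ?D = "sdet F Y"
  let ?X = "\<lambda>e f. Y e f + u e * c f"
  have row: "?D * sdet F (?X(f := d)) = ?D * sdet F (Y(f := d)) +
      (rank_one_term F Y u c * sdet F (Y(f := d)) - sdet F (Y(f := c)) * rank_one_term F Y u d)" if f: "f \<in> F" for f
  proof -
    let ?w = "u(f := 0)"
    have "?X(f := d) = (\<lambda>e g. (Y(f := d)) e g + ?w e * c g)"
      by (auto simp: fun_eq_iff)
    then have "sdet F (?X(f := d)) = sdet F (Y(f := d)) + (\<Sum>e\<in>F. ?w e * sdet F (Y(f := d, e := c)))"
      using sdet_add_rank_one[OF assms, of "Y(f := d)" ?w c] by (simp add: rank_one_term_def)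
    moreover have "?D * (\<Sum>e\<in>F. ?w e * sdet F (Y(f := d, e := c))) =
        (\<Sum>e\<in>F. u e * (sdet F (Y(e := c)) * sdet F (Y(f := d)) - sdet F (Y(f := c)) * sdet F (Y(e := d))))"
      unfolding sum_distrib_left
    proof (intro sum.cong refl)
      fix e assume e: "e \<in> F"
      show "?D * (?w e * sdet F (Y(f := d, e := c))) =
        u e * (sdet F (Y(e := c)) * sdet F (Y(f := d)) - sdet F (Y(f := c)) * sdet F (Y(e := d)))"
        using sdet_two_rows[OF assms e f, of Y d c] by (cases "e = f") (auto simp: mult.left_commute)
    qed
    moreover have "\<dots> = rank_one_term F Y u c * sdet F (Y(f := d)) - sdet F (Y(f := c)) * rank_one_term F Y u d"
      by (simp add: rank_one_term_def sum_distrib_left sum_distrib_right sum_subtractf algebra_simps)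
    ultimately show ?thesis by (simp add: distrib_left)
  qed
  have "?D * sdet F (\<lambda>e f. Y e f + u e * c f + v e * d f) =
      ?D * (sdet F Y + rank_one_term F Y u c) + ?D * rank_one_term F ?X v d"
    unfolding sdet_add_rank_one[OF assms, of ?X v d] sdet_add_rank_one[OF assms, of Y u c]
    by (simp add: algebra_simps)
  also have "?D * rank_one_term F ?X v d = (\<Sum>f\<in>F. v f * (?D * sdet F (?X(f := d))))"
    unfolding rank_one_term_def sum_distrib_left by (intro sum.cong) (auto simp: mult_ac)
  also have "\<dots> = (\<Sum>f\<in>F. v f * (?D * sdet F (Y(f := d)) +
      (rank_one_term F Y u c * sdet F (Y(f := d)) - sdet F (Y(f := c)) * rank_one_term F Y u d)))"
    using row by (intro sum.cong) auto
  also have "\<dots> = ?D * rank_one_term F Y v d + (rank_one_term F Y u c * rank_one_term F Y v d - rank_one_term F Y v c * rank_one_term F Y u d)"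
    unfolding rank_one_term_def[of F Y v]
    by (simp add: sum_distrib_left sum_distrib_right sum_subtractf sum.distrib algebra_simps)
  finally show ?thesis by (simp add: algebra_simps)
qed

text \<open>The matrix on the left is the shape taken by a doubly shifted tau function: \<open>p\<close> and \<open>r\<close> belong to the shifts \<open>a\<close> and
\<open>b\<close>, and \<open>q\<close> is their divided difference. The right-hand side is the determinant of two plane vectors, each of which
depends on one of the shifts only.\<close>

lemma sdet_pair_shift:
  assumes "finite F" and q: "\<And>f. (a - b) * q f = a * p f - b * r f"
  shows "sdet F Y * ((a - b) * sdet F (\<lambda>e f. Y e f + u e * (b * r f + a * q f) + v e * (a * b * q f))) =
    b * (sdet F Y + b * rank_one_term F Y u r) * (a\<^sup>2 * rank_one_term F Y v p - sdet F Y) -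
    a * (sdet F Y + a * rank_one_term F Y u p) * (b\<^sup>2 * rank_one_term F Y v r - sdet F Y)"
proof -
  have lin: "(a - b) * rank_one_term F Y w q = a * rank_one_term F Y w p - b * rank_one_term F Y w r" for w
  proof -
    have "(a - b) * rank_one_term F Y w q = rank_one_term F Y w (\<lambda>f. (a - b) * q f)"
      by (rule rank_one_term_scale[symmetric]) fact
    also have "(\<lambda>f. (a - b) * q f) = (\<lambda>f. a * p f + (- b) * r f)" using q by auto
    also have "rank_one_term F Y w \<dots> = rank_one_term F Y w (\<lambda>f. a * p f) + (- b) * rank_one_term F Y w r"
      by (rule rank_one_term_linear) fact
    finally show ?thesis using rank_one_term_scale[OF assms(1), of Y w a p] by simp
  qed
  have 1: "rank_one_term F Y u (\<lambda>f. b * r f + a * q f) = b * rank_one_term F Y u r + a * rank_one_term F Y u q"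
    "rank_one_term F Y v (\<lambda>f. b * r f + a * q f) = b * rank_one_term F Y v r + a * rank_one_term F Y v q"
    "rank_one_term F Y u (\<lambda>f. a * b * q f) = a * b * rank_one_term F Y u q"
    "rank_one_term F Y v (\<lambda>f. a * b * q f) = a * b * rank_one_term F Y v q"
    using rank_one_term_linear[OF assms(1)] rank_one_term_scale[OF assms(1)] by simp_all
  have "sdet F Y * sdet F (\<lambda>e f. Y e f + u e * (b * r f + a * q f) + v e * (a * b * q f)) =
      (sdet F Y + (b * rank_one_term F Y u r + a * rank_one_term F Y u q)) * (sdet F Y + a * b * rank_one_term F Y v q) -
      a * b * rank_one_term F Y u q * (b * rank_one_term F Y v r + a * rank_one_term F Y v q)"
    by (subst sdet_add_rank_two[OF assms(1)]) (simp only: 1)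
  then show ?thesis using lin[of u] lin[of v] by algebra
qed

text \<open>The determinant is a monic polynomial in \<open>x\<close> and has finitely many roots.\<close>

lemma sdet_generic_diagonal:
  assumes "finite F"
  shows "eventually (\<lambda>x. sdet F (\<lambda>e f. (if e = f then x else 0) + Y e f) \<noteq> 0) (at (0::complex))"
proof -
  define P where "P = (\<Sum>S\<in>Pow F. monom (sdet S Y) (card (F - S)))"
  have eval: "sdet F (\<lambda>e f. (if e = f then x else 0) + Y e f) = poly P x" for x
    unfolding sdet_add_diagonal[OF assms] P_def
    by (simp add: poly_sum poly_monom mult.commute)
  have "coeff P (card F) = (\<Sum>S\<in>Pow F. if S = {} then 1 else 0)"
    unfolding P_def coeff_sum
  proof (intro sum.cong refl)
    fix S assume S: "S \<in> Pow F"
    have "card (F - S) = card F \<longleftrightarrow> S = {}"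
    proof -
      have "finite S" "S \<subseteq> F" "card S \<le> card F"
        using S assms finite_subset card_mono by auto
      then have "card (F - S) = card F \<longleftrightarrow> card S = 0"
        using card_Diff_subset[of S F] by linarith
      then show ?thesis using \<open>finite S\<close> by simp
    qed
    then show "coeff (monom (sdet S Y) (card (F - S))) (card F) = (if S = {} then 1 else 0)"
      by simp
  qed
  also have "\<dots> = 1" using assms by simp
  finally have "P \<noteq> 0" by auto
  then have "finite {x. poly P x = 0}" by (rule poly_roots_finite)
  then have "open (- ({x. poly P x = 0} - {0}))"
    by (intro open_Compl finite_imp_closed) auto
  then show ?thesis
    unfolding eval eventually_at_filter
    by (rule eventually_mono[OF eventually_nhds_in_open]) auto
qed

lemma tendsto_sdet:
  assumes "\<And>e f. e \<in> F \<Longrightarrow> f \<in> F \<Longrightarrow> ((\<lambda>x. M x e f) \<longlongrightarrow> N e f) L"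
  shows "((\<lambda>x. sdet F (M x)) \<longlongrightarrow> sdet F N) L"
  unfolding sdet_def
  by (intro tendsto_sum tendsto_mult tendsto_const tendsto_prod assms) (auto simp: permutes_in_image)

text \<open>For nonsingular \<open>Y\<close>, the preceding factorisation turns the claim into the Pluecker relation for four vectors in the
plane. Both sides are continuous in \<open>Y\<close>, and \<open>Y\<close> is a limit of nonsingular matrices.\<close>

lemma sdet_fay:
  fixes u v :: "'a \<Rightarrow> complex" and p :: "complex \<Rightarrow> 'a \<Rightarrow> complex"
    and q :: "complex \<Rightarrow> complex \<Rightarrow> 'a \<Rightarrow> complex"
  assumes F: "finite F"
    and q: "\<And>a b f. a \<in> I \<Longrightarrow> b \<in> I \<Longrightarrow> (a - b) * q a b f = a * p a f - b * p b f"
    and I: "a0 \<in> I" "a1 \<in> I" "a2 \<in> I" "a3 \<in> I"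
  defines "\<sigma> \<equiv> \<lambda>Y a b. (a - b) *
      sdet F (\<lambda>e f. Y e f + u e * (b * p b f + a * q a b f) + v e * (a * b * q a b f))"
  shows "\<sigma> Y a0 a1 * \<sigma> Y a2 a3 - \<sigma> Y a0 a2 * \<sigma> Y a1 a3 + \<sigma> Y a0 a3 * \<sigma> Y a1 a2 = 0"
proof -
  let ?P = "\<lambda>Y. \<sigma> Y a0 a1 * \<sigma> Y a2 a3 - \<sigma> Y a0 a2 * \<sigma> Y a1 a3 + \<sigma> Y a0 a3 * \<sigma> Y a1 a2"
  let ?Y = "\<lambda>x e f. (if e = f then x else 0) + Y e f"
  have regular: "?P Y = 0" if D: "sdet F Y \<noteq> 0" for Y
  proof -
    define X where "X a = a * (sdet F Y + a * rank_one_term F Y u (p a))" for a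
    define Z where "Z a = a\<^sup>2 * rank_one_term F Y v (p a) - sdet F Y" for a
    have "sdet F Y * \<sigma> Y a b = X b * Z a - X a * Z b" if "a \<in> I" "b \<in> I" for a b
      unfolding \<sigma>_def X_def Z_def by (rule sdet_pair_shift[OF F q[OF that]])
    note h = this[OF I(1,2)] this[OF I(1,3)] this[OF I(1,4)] this[OF I(2,3)] this[OF I(2,4)] this[OF I(3,4)]
    have "(sdet F Y)\<^sup>2 * ?P Y =
        (sdet F Y * \<sigma> Y a0 a1) * (sdet F Y * \<sigma> Y a2 a3) - (sdet F Y * \<sigma> Y a0 a2) * (sdet F Y * \<sigma> Y a1 a3)
        + (sdet F Y * \<sigma> Y a0 a3) * (sdet F Y * \<sigma> Y a1 a2)"
      by (simp add: power2_eq_square algebra_simps)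
    also have "\<dots> = 0" unfolding h by (simp add: algebra_simps)
    finally show ?thesis using D by simp
  qed
  have diag: "((\<lambda>x. if e = f then x else 0) \<longlongrightarrow> (if e = f then 0 else 0)) (at (0::complex))"
    for e f :: 'a
    by (cases "e = f") (auto intro: tendsto_ident_at)
  have "((\<lambda>x. \<sigma> (?Y x) a b) \<longlongrightarrow> \<sigma> (?Y 0) a b) (at 0)" for a b
    unfolding \<sigma>_def
    by (rule tendsto_mult_left, rule tendsto_sdet) (rule tendsto_add diag tendsto_const)+
  then have "((\<lambda>x. ?P (?Y x)) \<longlongrightarrow> ?P (?Y 0)) (at 0)"
    by (intro tendsto_add tendsto_diff tendsto_mult)
  moreover have "((\<lambda>x. ?P (?Y x)) \<longlongrightarrow> 0) (at 0)"
    by (rule tendsto_eventually, rule eventually_mono[OF sdet_generic_diagonal[OF F, of Y]])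
      (rule regular)
  ultimately have "?P (?Y 0) = 0"
    using tendsto_unique[OF at_neq_bot] by blast
  moreover have "?Y 0 = Y" by (auto simp: fun_eq_iff)
  ultimately show ?thesis by simp
qed

section \<open>Hadamard's inequality\<close>

text \<open>Andreief's identity, a form of the Cauchy--Binet formula. Summing over all maps instead of subsets costs the factor
\<open>k!\<close> but needs no ordering of the index sets; the maps that are not injective contribute zero.\<close>

lemma sdet_andreief:
  assumes "finite S" "finite J"
  shows "of_nat (fact (card S)) * sdet S (\<lambda>e f. \<Sum>i\<in>J. a e i * b f i) =
    (\<Sum>\<phi>\<in>S \<rightarrow>\<^sub>E J. sdet S (\<lambda>e f. a e (\<phi> f)) * sdet S (\<lambda>e f. b e (\<phi> f)))"
proof -
  let ?G = "\<lambda>e f. \<Sum>i\<in>J. a e i * b f i"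
  let ?Q = "{p. p permutes S}"
  have tr: "sdet S (\<lambda>e f. c e (\<phi> f)) = (\<Sum>p\<in>?Q. of_int (sign p) * (\<Prod>f\<in>S. c (p f) (\<phi> f)))"
    for c :: "'a \<Rightarrow> 'b \<Rightarrow> complex" and \<phi>
    using sdet_transpose[OF assms(1), of "\<lambda>e f. c e (\<phi> f)"] by (simp add: sdet_def)
  have "(\<Sum>\<phi>\<in>S \<rightarrow>\<^sub>E J. sdet S (\<lambda>e f. a e (\<phi> f)) * sdet S (\<lambda>e f. b e (\<phi> f))) =
      (\<Sum>\<phi>\<in>S \<rightarrow>\<^sub>E J. \<Sum>p\<in>?Q. \<Sum>q\<in>?Q. of_int (sign p) * (of_int (sign q) *
        (\<Prod>f\<in>S. a (p f) (\<phi> f) * b (q f) (\<phi> f))))"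
    unfolding tr sum_product prod.distrib by (simp add: mult_ac)
  also have "\<dots> = (\<Sum>p\<in>?Q. \<Sum>q\<in>?Q. of_int (sign p) * (of_int (sign q) *
        (\<Sum>\<phi>\<in>S \<rightarrow>\<^sub>E J. \<Prod>f\<in>S. a (p f) (\<phi> f) * b (q f) (\<phi> f))))"
    unfolding sum_distrib_left
    by (subst sum.swap, intro sum.cong refl, rule sum.swap)
  also have "\<dots> = (\<Sum>p\<in>?Q. of_int (sign p) * sdet S (\<lambda>f. ?G (p f)))"
    unfolding sdet_def sum_distrib_left[symmetric]
    using assms by (simp add: prod_sum_PiE)
  also have "\<dots> = (\<Sum>p\<in>?Q. sdet S ?G)"
  proof (intro sum.cong refl)
    fix p assume "p \<in> ?Q"
    then have "sdet S (\<lambda>f. ?G (p f)) = of_int (sign p) * sdet S ?G"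
      using sdet_permute_rows[OF assms(1), of p ?G] by simp
    then show "of_int (sign p) * sdet S (\<lambda>f. ?G (p f)) = sdet S ?G"
      by (simp add: mult.assoc[symmetric] of_int_mult[symmetric] del: of_int_mult)
  qed
  also have "\<dots> = of_nat (fact (card S)) * sdet S ?G"
    using card_permutations[OF refl assms(1)] by simp
  finally show ?thesis by simp
qed

text \<open>The Gram determinant of the vectors with coordinates \<open>a e i\<close>, \<open>i\<close> in \<open>J\<close>, written by Andreief's identity as a sum of squares. In this
form it is visibly nonnegative and increasing in \<open>J\<close>.\<close>

definition gram :: "'a set \<Rightarrow> 'i set \<Rightarrow> ('a \<Rightarrow> 'i \<Rightarrow> complex) \<Rightarrow> real" where
  "gram S J a = (\<Sum>\<phi>\<in>S \<rightarrow>\<^sub>E J. (cmod (sdet S (\<lambda>e f. a e (\<phi> f))))\<^sup>2) / fact (card S)"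

lemma gram_nonneg: "gram S J a \<ge> 0"
  by (simp add: gram_def sum_nonneg)

lemma sdet_cnj: "sdet S (\<lambda>e f. cnj (M e f)) = cnj (sdet S M)"
  by (simp add: sdet_def)

lemma sdet_gram:
  assumes "finite S" "finite J"
  shows "sdet S (\<lambda>e f. \<Sum>i\<in>J. a e i * cnj (a f i)) = of_real (gram S J a)"
proof -
  have "of_nat (fact (card S)) * sdet S (\<lambda>e f. \<Sum>i\<in>J. a e i * cnj (a f i)) =
      of_real (\<Sum>\<phi>\<in>S \<rightarrow>\<^sub>E J. (cmod (sdet S (\<lambda>e f. a e (\<phi> f))))\<^sup>2)"
    unfolding sdet_andreief[OF assms] sdet_cnj of_real_sum
    by (simp only: complex_norm_square)
  then show ?thesis by (simp add: gram_def field_simps)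
qed

lemma gram_mono:
  assumes "finite S" "finite J" "I \<subseteq> J"
  shows "gram S I a \<le> gram S J a"
  unfolding gram_def using assms
  by (intro divide_right_mono sum_mono2) (auto intro!: finite_PiE dest: PiE_mem simp: PiE_iff)

lemma norm_sdet_le_gram:
  assumes "finite S" "finite J"
  shows "(cmod (sdet S (\<lambda>e f. \<Sum>i\<in>J. a e i * b f i)))\<^sup>2 \<le> gram S J a * gram S J b"
proof -
  let ?A = "\<lambda>\<phi>. sdet S (\<lambda>e f. a e (\<phi> f))" and ?B = "\<lambda>\<phi>. sdet S (\<lambda>e f. b e (\<phi> f))"
  have "fact (card S) * cmod (sdet S (\<lambda>e f. \<Sum>i\<in>J. a e i * b f i)) =
      cmod (\<Sum>\<phi>\<in>S \<rightarrow>\<^sub>E J. ?A \<phi> * ?B \<phi>)"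
    unfolding sdet_andreief[OF assms, symmetric] by (simp add: norm_mult)
  also have "\<dots> \<le> (\<Sum>\<phi>\<in>S \<rightarrow>\<^sub>E J. cmod (?A \<phi>) * cmod (?B \<phi>))"
    by (rule order_trans[OF norm_sum]) (simp add: norm_mult)
  finally have "(fact (card S) * cmod (sdet S (\<lambda>e f. \<Sum>i\<in>J. a e i * b f i)))\<^sup>2 \<le>
      (\<Sum>\<phi>\<in>S \<rightarrow>\<^sub>E J. cmod (?A \<phi>) * cmod (?B \<phi>))\<^sup>2"
    by (intro power_mono) auto
  also have "\<dots> \<le> (\<Sum>\<phi>\<in>S \<rightarrow>\<^sub>E J. (cmod (?A \<phi>))\<^sup>2) * (\<Sum>\<phi>\<in>S \<rightarrow>\<^sub>E J. (cmod (?B \<phi>))\<^sup>2)"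
    by (rule Cauchy_Schwarz_ineq_sum)
  also have "\<dots> = (fact (card S))\<^sup>2 * (gram S J a * gram S J b)"
    by (simp add: gram_def power2_eq_square)
  finally show ?thesis by (simp add: power_mult_distrib)
qed

text \<open>Fischer's inequality for one additional vector. Expanding along the new row, the difference of the two sides is the
term \<open>g adj(G) g\<^sup>*\<close> with \<open>G\<close> the old Gram matrix and \<open>g\<close> the new row. This term is \<open>det (G + g\<^sup>* g) - det G\<close>, and \<open>G + g\<^sup>* g\<close>
is the Gram matrix of the old vectors with one more coordinate, so monotonicity of \<^const>\<open>gram\<close> shows that it is
nonnegative.\<close>

lemma gram_insert_le:
  assumes S: "finite S" "t \<notin> S" and J: "finite J"
  shows "gram (insert t S) J a \<le> (\<Sum>i\<in>J. (cmod (a t i))\<^sup>2) * gram S J a"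
proof -
  define G where "G e f = (\<Sum>i\<in>J. a e i * cnj (a f i))" for e f
  have cG: "cnj (G e f) = G f e" for e f
    by (simp add: G_def mult.commute)
  let ?d = "\<lambda>f. if f = t then 1 else (0::complex)"
  let ?r = "\<lambda>f. if f = t then 0 else G t f"
  let ?x = "rank_one_term S G (\<lambda>e. G e t) (G t)"
  have fin: "finite (insert t S)" and t: "t \<in> insert t S" using S by auto
  have d: "sdet (insert t S) (G(t := ?d)) = sdet S G"
    by (subst sdet_pivot_row) (use S in \<open>auto intro!: sdet_cong\<close>)
  have "sdet (insert t S) (G(t := \<lambda>f. ?r f + 1 * ?d f)) = sdet S (\<lambda>e f. G e f + (- G e t) * G t f)"
    by (subst sdet_schur) (use S in \<open>auto intro!: sdet_cong\<close>)
  also have "\<dots> = sdet S G - ?x"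
    by (subst sdet_add_rank_one[OF S(1)]) (simp add: rank_one_term_def sum_negf)
  finally have r: "sdet (insert t S) (G(t := ?r)) = - ?x"
    unfolding sdet_row_linear[OF fin t] d by simp
  have "G(t := \<lambda>f. ?r f + G t t * ?d f) = G" by (auto simp: fun_eq_iff)
  then have "sdet (insert t S) G = sdet (insert t S) (G(t := \<lambda>f. ?r f + G t t * ?d f))"
    by (simp only:)
  then have main: "sdet (insert t S) G = G t t * sdet S G - ?x"
    unfolding sdet_row_linear[OF fin t] r d by simp
  \<comment> \<open>the additional coordinate \<open>None\<close> carries the inner products with the new vector\<close>
  have "?x = of_real (gram S (insert None (Some ` J)) (\<lambda>e. case_option (G e t) (a e)) -
      gram S (Some ` J) (\<lambda>e. case_option (G e t) (a e)))"
  proof -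
    let ?a = "\<lambda>e. case_option (G e t) (a e)"
    have inj: "inj_on Some J" by simp
    have 1: "(\<Sum>i\<in>Some ` J. ?a e i * cnj (?a f i)) = G e f" for e f
      by (simp add: sum.reindex G_def)
    have 2: "(\<Sum>i\<in>insert None (Some ` J). ?a e i * cnj (?a f i)) = G e f + G e t * G t f" for e f
      using J by (subst sum.insert) (auto simp: 1 cG)
    have "sdet S (\<lambda>e f. G e f + G e t * G t f) = of_real (gram S (insert None (Some ` J)) ?a)"
      using sdet_gram[OF S(1), of "insert None (Some ` J)" ?a] J by (simp only: 2 finite_insert finite_imageI)
    moreover have "sdet S G = of_real (gram S (Some ` J) ?a)"
      using sdet_gram[OF S(1), of "Some ` J" ?a] J by (simp only: 1 finite_imageI)
    ultimately show ?thesis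
      unfolding sdet_add_rank_one[OF S(1), of G "\<lambda>e. G e t" "G t"] by (simp add: algebra_simps)
  qed
  moreover have "G t t = of_real (\<Sum>i\<in>J. (cmod (a t i))\<^sup>2)"
    by (simp only: G_def complex_norm_square of_real_sum)
  moreover have "sdet (insert t S) G = of_real (gram (insert t S) J a)" "sdet S G = of_real (gram S J a)"
    unfolding G_def by (rule sdet_gram; use S J in simp)+
  ultimately have "complex_of_real (gram (insert t S) J a) =
      of_real ((\<Sum>i\<in>J. (cmod (a t i))\<^sup>2) * gram S J a -
      (gram S (insert None (Some ` J)) (\<lambda>e. case_option (G e t) (a e)) -
        gram S (Some ` J) (\<lambda>e. case_option (G e t) (a e))))"
    using main by simp
  then have "gram (insert t S) J a = (\<Sum>i\<in>J. (cmod (a t i))\<^sup>2) * gram S J a -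
      (gram S (insert None (Some ` J)) (\<lambda>e. case_option (G e t) (a e)) -
        gram S (Some ` J) (\<lambda>e. case_option (G e t) (a e)))"
    by (simp only: of_real_eq_iff)
  moreover have "gram S (Some ` J) (\<lambda>e. case_option (G e t) (a e)) \<le>
      gram S (insert None (Some ` J)) (\<lambda>e. case_option (G e t) (a e))"
    by (rule gram_mono) (use S J in auto)
  ultimately show ?thesis by simp
qed

lemma gram_le_prod:
  assumes "finite S" "finite J"
  shows "gram S J a \<le> (\<Prod>e\<in>S. \<Sum>i\<in>J. (cmod (a e i))\<^sup>2)"
  using assms(1)
proof (induction S rule: finite_induct)
  case empty
  then show ?case by (simp add: gram_def)
next
  case (insert t S)
  have "gram (insert t S) J a \<le> (\<Sum>i\<in>J. (cmod (a t i))\<^sup>2) * gram S J a"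
    by (rule gram_insert_le) (use insert assms in auto)
  also have "\<dots> \<le> (\<Sum>i\<in>J. (cmod (a t i))\<^sup>2) * (\<Prod>e\<in>S. \<Sum>i\<in>J. (cmod (a e i))\<^sup>2)"
    by (intro mult_left_mono insert.IH sum_nonneg) auto
  finally show ?case using insert by simp
qed

text \<open>Hadamard's inequality for a matrix factored through the index set \<open>J\<close>, with geometric means replaced by arithmetic ones:
the bound is a product over \<open>S\<close> of quantities attached to single basis vectors, which makes it summable over \<open>S\<close>.\<close>

lemma norm_sdet_le_prod:
  assumes "finite S" "finite J"
  shows "cmod (sdet S (\<lambda>e f. \<Sum>i\<in>J. a e i * b f i)) \<le>
    (\<Prod>e\<in>S. (\<Sum>i\<in>J. (cmod (a e i))\<^sup>2 + (cmod (b e i))\<^sup>2) / 2)"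
proof (rule power2_le_imp_le)
  let ?a = "\<lambda>e. \<Sum>i\<in>J. (cmod (a e i))\<^sup>2" and ?b = "\<lambda>e. \<Sum>i\<in>J. (cmod (b e i))\<^sup>2"
  have "(cmod (sdet S (\<lambda>e f. \<Sum>i\<in>J. a e i * b f i)))\<^sup>2 \<le> gram S J a * gram S J b"
    by (rule norm_sdet_le_gram) fact+
  also have "\<dots> \<le> (\<Prod>e\<in>S. ?a e) * (\<Prod>e\<in>S. ?b e)"
    by (intro mult_mono gram_le_prod gram_nonneg assms prod_nonneg) (auto intro: sum_nonneg)
  also have "\<dots> = (\<Prod>e\<in>S. ?a e * ?b e)" by (rule prod.distrib[symmetric])
  also have "\<dots> \<le> (\<Prod>e\<in>S. ((?a e + ?b e) / 2)\<^sup>2)"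
  proof (rule prod_mono)
    fix e assume "e \<in> S"
    have "0 \<le> ?a e * ?b e" by (intro mult_nonneg_nonneg sum_nonneg) auto
    moreover have "?a e * ?b e \<le> ((?a e + ?b e) / 2)\<^sup>2"
    proof -
      have "((?a e + ?b e) / 2)\<^sup>2 - ?a e * ?b e = ((?a e - ?b e) / 2)\<^sup>2"
        by (simp add: power2_eq_square field_simps)
      then show ?thesis by (metis diff_ge_0_iff_ge zero_le_power2)
    qed
    ultimately show "0 \<le> ?a e * ?b e \<and> ?a e * ?b e \<le> ((?a e + ?b e) / 2)\<^sup>2" by simp
  qed
  finally show "(cmod (sdet S (\<lambda>e f. \<Sum>i\<in>J. a e i * b f i)))\<^sup>2 \<le>
      (\<Prod>e\<in>S. (\<Sum>i\<in>J. (cmod (a e i))\<^sup>2 + (cmod (b e i))\<^sup>2) / 2)\<^sup>2"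
    by (simp add: prod_power_distrib sum.distrib)
qed (auto intro!: prod_nonneg sum_nonneg)

section \<open>Orthonormal families\<close>

lemma cinner_zero_left [simp]: "cinner (0::'h::complex_hilbert) x = 0"
  using cinner_add_left[of 0 0 x] by simp

lemma cinner_sum_left: "cinner (\<Sum>i\<in>I. g i) x = (\<Sum>i\<in>I. cinner (g i) (x::'h::complex_hilbert))"
  by (induction I rule: infinite_finite_induct) (auto simp: cinner_add_left)

lemma cinner_Cauchy_Schwarz: "cmod (cinner x y) \<le> norm x * norm (y::'h::complex_hilbert)"
proof (cases "cinner x y = 0")
  case False
  define c where "c = cnj (cinner x y) / of_real (cmod (cinner x y))"
  have c: "cmod c = 1" using False by (simp add: c_def norm_divide)
  have "cinner (c *\<^sub>C x) y = of_real (cmod (cinner x y))"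
  proof -
    have "cinner x y * cnj (cinner x y) = of_real ((cmod (cinner x y))\<^sup>2)"
      by (rule complex_norm_square[symmetric])
    then show ?thesis using False
      by (simp add: cinner_scaleC_left c_def power2_eq_square field_simps)
  qed
  then have "cmod (cinner x y) = inner (c *\<^sub>C x) y" by (simp add: inner_eq_Re_cinner)
  also have "\<dots> \<le> norm (c *\<^sub>C x) * norm y" by (rule norm_cauchy_schwarz)
  finally show ?thesis by (simp add: norm_scaleC c)
qed simp

lemma bounded_linear_cinner_left: "bounded_linear (\<lambda>x::'h::complex_hilbert. cinner x y)"
proof (rule bounded_linear_intro[where K = "norm y"])
  show "cinner (r *\<^sub>R x) y = r *\<^sub>R cinner x y" for r and x :: 'h
    by (simp only: scaleC_complex_of_real[symmetric] cinner_scaleC_left scaleC_complex_def)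
qed (auto simp: cinner_add_left cinner_Cauchy_Schwarz)

definition orthonormal :: "'h::complex_hilbert set \<Rightarrow> bool" where
  "orthonormal F \<longleftrightarrow> (\<forall>e\<in>F. \<forall>f\<in>F. cinner e f = (if e = f then 1 else 0))"

lemma orthonormal_subset: "orthonormal E \<Longrightarrow> F \<subseteq> E \<Longrightarrow> orthonormal F"
  by (simp add: orthonormal_def subset_iff)

text \<open>Bessel's inequality for functionals: evaluate \<open>\<phi>\<close> at the vector whose coefficients are the conjugates of its values.\<close>

lemma bessel_functional:
  fixes \<phi> :: "'h::complex_hilbert \<Rightarrow> complex"
  assumes F: "finite F" "orthonormal F"
    and add: "\<And>x y. \<phi> (x + y) = \<phi> x + \<phi> y" and scale: "\<And>c x. \<phi> (c *\<^sub>C x) = c * \<phi> x"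
    and bound: "\<And>x. cmod (\<phi> x) \<le> k * norm x" and k: "k \<ge> 0"
  shows "(\<Sum>e\<in>F. (cmod (\<phi> e))\<^sup>2) \<le> k\<^sup>2"
proof -
  define h where "h = (\<Sum>e\<in>F. cnj (\<phi> e) *\<^sub>C e)"
  define s where "s = (\<Sum>e\<in>F. (cmod (\<phi> e))\<^sup>2)"
  have s0: "s \<ge> 0" by (simp add: s_def sum_nonneg)
  have "\<phi> 0 = 0" using add[of 0 0] by simp
  then have sum: "\<phi> (\<Sum>i\<in>I. g i) = (\<Sum>i\<in>I. \<phi> (g i))" for g :: "'h \<Rightarrow> 'h" and I
    by (induction I rule: infinite_finite_induct) (auto simp: add)
  have "\<phi> h = of_real s"
    by (simp only: h_def sum scale s_def of_real_sum complex_norm_square mult.commute)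
  then have 1: "s \<le> k * norm h" using bound[of h] s0 by simp
  have he: "cinner h e = cnj (\<phi> e)" if "e \<in> F" for e
  proof -
    have "cinner h e = (\<Sum>f\<in>F. cnj (\<phi> f) * (if f = e then 1 else 0))"
      unfolding h_def cinner_sum_left cinner_scaleC_left
      using F that by (intro sum.cong) (auto simp: orthonormal_def)
    then show ?thesis using F that by (simp add: if_distrib cong: if_cong)
  qed
  have "complex_of_real ((norm h)\<^sup>2) = cinner h h" by (rule cinner_self[symmetric])
  also have "\<dots> = (\<Sum>e\<in>F. cnj (\<phi> e) * cinner e h)"
    by (subst h_def) (simp only: cinner_sum_left cinner_scaleC_left)
  also have "\<dots> = (\<Sum>e\<in>F. \<phi> e * cnj (\<phi> e))"
    by (intro sum.cong refl) (subst cinner_commute, simp add: he mult.commute)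
  also have "\<dots> = of_real s" by (simp only: s_def of_real_sum complex_norm_square)
  finally have 2: "(norm h)\<^sup>2 = s" by (simp only: of_real_eq_iff)
  have "s\<^sup>2 \<le> (k * norm h)\<^sup>2" using 1 s0 by (intro power_mono)
  then have "s * s \<le> k\<^sup>2 * s" by (simp only: power_mult_distrib 2 power2_eq_square[of s])
  then have "s \<le> k\<^sup>2" using s0 by (cases "s = 0") auto
  then show ?thesis by (simp add: s_def)
qed

text \<open>A maximal orthonormal set exists by Zorn's lemma, and a nonzero vector orthogonal to it could be normalised and added.
The Fredholm determinant is defined with a chosen orthonormal basis, whose orthonormality is known only once some basis
exists.\<close>

lemma ex_onb: "\<exists>E::'h::complex_hilbert set. is_onb E"
proof -
  have "\<exists>M\<in>{E. orthonormal E}. \<forall>X\<in>{E::'h set. orthonormal E}. M \<subseteq> X \<longrightarrow> X = M"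
  proof (rule subset_Zorn_nonempty)
    have "({}::'h set) \<in> {E. orthonormal E}" by (simp add: orthonormal_def)
    then show "{E::'h set. orthonormal E} \<noteq> {}" by blast
  next
    fix \<C> assume C: "\<C> \<noteq> {}" "subset.chain {E::'h set. orthonormal E} \<C>"
    show "\<Union>\<C> \<in> {E. orthonormal E}"
      unfolding mem_Collect_eq orthonormal_def
    proof (intro ballI)
      fix e f assume "e \<in> \<Union>\<C>" "f \<in> \<Union>\<C>"
      then obtain X Y where XY: "X \<in> \<C>" "e \<in> X" "Y \<in> \<C>" "f \<in> Y" by auto
      moreover have "X \<subseteq> Y \<or> Y \<subseteq> X" "orthonormal X" "orthonormal Y"
        using C(2) XY(1,3) unfolding subset_chain_def by blast+
      ultimately show "cinner e f = (if e = f then 1 else 0)"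
        unfolding orthonormal_def by blast
    qed
  qed
  then obtain M :: "'h set" where M: "orthonormal M" "\<And>X. orthonormal X \<Longrightarrow> M \<subseteq> X \<Longrightarrow> X = M"
    by blast
  have "h = 0" if h: "\<forall>e\<in>M. cinner h e = 0" for h
  proof (rule ccontr)
    assume "h \<noteq> 0"
    define g where "g = (1 / norm h) *\<^sub>R h"
    have g: "g = complex_of_real (1 / norm h) *\<^sub>C h" by (simp only: g_def scaleC_complex_of_real)
    have gg: "cinner g g = 1" using \<open>h \<noteq> 0\<close> by (simp add: cinner_self g_def)
    have ge: "cinner g e = 0" "cinner e g = 0" if "e \<in> M" for e
    proof -
      show "cinner g e = 0" using h that by (simp add: g cinner_scaleC_left)
      then show "cinner e g = 0" by (subst cinner_commute) simp
    qed
    have "orthonormal (insert g M)"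
      using M(1) gg ge unfolding orthonormal_def by (metis insertE)
    then have "g \<in> M" using M(2)[of "insert g M"] by blast
    then show False using ge(1) gg by simp
  qed
  then have "is_onb M" using M(1) unfolding is_onb_def orthonormal_def by blast
  then show ?thesis ..
qed

section \<open>Nuclear operators\<close>

lemma clinear_opD: "clinear_op T \<Longrightarrow> blinfun_apply T (c *\<^sub>C x) = c *\<^sub>C blinfun_apply T x"
  by (simp add: clinear_op_def)

lemma cinner_rank_one:
  fixes B :: "complex \<Rightarrow>\<^sub>L 'h::complex_hilbert" and C :: "'h \<Rightarrow>\<^sub>L complex"
  assumes "clinear_op B"
  shows "cinner (blinfun_apply (B o\<^sub>L C) e) f = blinfun_apply C e * cinner (blinfun_apply B 1) f"
proof -
  have "blinfun_apply B (blinfun_apply C e) = blinfun_apply C e *\<^sub>C blinfun_apply B 1"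
    using clinear_opD[OF assms, of "blinfun_apply C e" 1] by (simp add: scaleC_complex_def)
  then show ?thesis by (simp add: cinner_scaleC_left)
qed

text \<open>Finite sums of rank one operators \<open>B o C\<close> together with an upper bound for their trace norm. Requiring both factors to have
squared norm at most \<open>\<kappa>\<close> balances them, which is the form in which Hadamard's inequality uses them.\<close>

inductive finite_rank :: "('h::complex_hilbert \<Rightarrow>\<^sub>L 'h) \<Rightarrow> real \<Rightarrow> bool" where
  zero: "0 \<le> \<nu> \<Longrightarrow> finite_rank 0 \<nu>"
| add: "finite_rank K \<nu> \<Longrightarrow> clinear_op (B :: complex \<Rightarrow>\<^sub>L 'h) \<Longrightarrow> clinear_op (C :: 'h \<Rightarrow>\<^sub>L complex) \<Longrightarrow>
    (norm B)\<^sup>2 \<le> \<kappa> \<Longrightarrow> (norm C)\<^sup>2 \<le> \<kappa> \<Longrightarrow> finite_rank (K + (B o\<^sub>L C)) (\<nu> + \<kappa>)"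
lemma finite_rank_mono: "finite_rank K \<nu> \<Longrightarrow> \<nu> \<le> \<mu> \<Longrightarrow> finite_rank K \<mu>"
proof (induction K \<nu> arbitrary: \<mu> rule: finite_rank.induct)
  case (add K \<nu> B C \<kappa>)
  have "finite_rank (K + (B o\<^sub>L C)) ((\<mu> - \<kappa>) + \<kappa>)"
    using add by (intro finite_rank.add) auto
  then show ?case by simp
qed (auto intro: finite_rank.zero)

lemma finite_rank_nonneg: "finite_rank K \<nu> \<Longrightarrow> 0 \<le> \<nu>"
proof (induction rule: finite_rank.induct)
  case (add K \<nu> B C \<kappa>)
  then show ?case by (smt (verit) zero_le_power2)
qed

lemma finite_rank_add:
  assumes "finite_rank K \<nu>" "finite_rank L \<mu>"
  shows "finite_rank (K + L) (\<nu> + \<mu>)"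
  using assms(2)
proof (induction rule: finite_rank.induct)
  case (zero \<mu>)
  then show ?case using finite_rank_mono[OF assms(1)] by simp
next
  case (add L \<mu> B C \<kappa>)
  from finite_rank.add[OF add.IH add.hyps(2-5)] show ?case by (simp add: add.assoc)
qed

lemma clinear_op_scaleR: "clinear_op T \<Longrightarrow> clinear_op (r *\<^sub>R T)"
  unfolding clinear_op_def
  by (simp add: scaleR_blinfun.rep_eq scaleC_complex_of_real[symmetric] scaleC_scaleC mult.commute
      del: scaleC_complex_of_real)

lemma finite_rank_rank_one:
  fixes B :: "complex \<Rightarrow>\<^sub>L 'h::complex_hilbert" and C :: "'h \<Rightarrow>\<^sub>L complex"
  assumes "clinear_op B" "clinear_op C"
  shows "finite_rank (B o\<^sub>L C) (norm B * norm C)"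
proof (cases "norm B * norm C = 0")
  case True
  then have "B o\<^sub>L C = 0"
    by (auto simp: blinfun_compose_zero)
  then show ?thesis using True by (auto intro: finite_rank.zero)
next
  case False
  then have pos: "norm B > 0" "norm C > 0" by auto
  \<comment> \<open>with this weight \<open>w B\<close> and \<open>C / w\<close> have equal norms\<close>
  define w where "w = sqrt (norm C / norm B)"
  have w: "w > 0" "w\<^sup>2 = norm C / norm B" using pos by (auto simp: w_def)
  have "finite_rank (0 + ((w *\<^sub>R B) o\<^sub>L ((1 / w) *\<^sub>R C))) (0 + norm B * norm C)"
  proof (rule finite_rank.add)
    show "(norm (w *\<^sub>R B))\<^sup>2 \<le> norm B * norm C"
      unfolding norm_scaleR power_mult_distrib power2_abs w(2) using pos by (simp add: power2_eq_square)
    show "(norm ((1 / w) *\<^sub>R C))\<^sup>2 \<le> norm B * norm C"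
      unfolding norm_scaleR power_mult_distrib power2_abs power_divide w(2)
      using pos by (simp add: power2_eq_square)
  qed (use assms in \<open>auto intro: finite_rank.zero clinear_op_scaleR\<close>)
  moreover have "(w *\<^sub>R B) o\<^sub>L ((1 / w) *\<^sub>R C) = B o\<^sub>L C"
    using w by (simp add: bounded_bilinear.scaleR_left[OF bounded_bilinear_blinfun_compose]
        bounded_bilinear.scaleR_right[OF bounded_bilinear_blinfun_compose])
  ultimately show ?thesis by simp
qed

lemma clinear_op_compose: "clinear_op S \<Longrightarrow> clinear_op T \<Longrightarrow> clinear_op (S o\<^sub>L T)"
  by (simp add: clinear_op_def)

lemma finite_rank_compose:
  assumes "finite_rank K \<nu>" "clinear_op X" "clinear_op Y"
  shows "finite_rank (X o\<^sub>L K o\<^sub>L Y) (norm X * norm Y * \<nu>)"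
  using assms(1)
proof (induction rule: finite_rank.induct)
  case (zero \<nu>)
  then show ?case by (auto intro: finite_rank.zero)
next
  case (add K \<nu> B C \<kappa>)
  have eq: "X o\<^sub>L (K + (B o\<^sub>L C)) o\<^sub>L Y = (X o\<^sub>L K o\<^sub>L Y) + ((X o\<^sub>L B) o\<^sub>L (C o\<^sub>L Y))"
    by (rule blinfun_eqI) (simp add: blinfun.add_left blinfun.add_right)
  have "norm B * norm C \<le> \<kappa>"
  proof -
    have "2 * (norm B * norm C) \<le> (norm B)\<^sup>2 + (norm C)\<^sup>2"
      using sum_squares_bound[of "norm B" "norm C"] by simp
    then show ?thesis using add.hyps(4,5) by linarith
  qed
  moreover have "norm (X o\<^sub>L B) * norm (C o\<^sub>L Y) \<le> (norm X * norm B) * (norm C * norm Y)"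
    by (intro mult_mono norm_blinfun_compose) auto
  ultimately have "norm (X o\<^sub>L B) * norm (C o\<^sub>L Y) \<le> norm X * norm Y * \<kappa>"
    by (smt (verit) mult.assoc mult.commute mult_left_mono mult_nonneg_nonneg norm_ge_zero)
  moreover have "finite_rank ((X o\<^sub>L B) o\<^sub>L (C o\<^sub>L Y)) (norm (X o\<^sub>L B) * norm (C o\<^sub>L Y))"
    by (intro finite_rank_rank_one clinear_op_compose assms add.hyps)
  ultimately have "finite_rank ((X o\<^sub>L B) o\<^sub>L (C o\<^sub>L Y)) (norm X * norm Y * \<kappa>)"
    using finite_rank_mono by blast
  from finite_rank_add[OF add.IH this] show ?case by (simp add: eq algebra_simps)
qed

lemma finite_rank_rep:
  assumes "finite_rank (K::'h::complex_hilbert \<Rightarrow>\<^sub>L 'h) \<nu>"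
  shows "\<exists>(n::nat) B C \<kappa>. K = (\<Sum>i<n. B i o\<^sub>L C i) \<and> (\<Sum>i<n. \<kappa> i) \<le> \<nu> \<and>
    (\<forall>i<n. clinear_op (B i :: complex \<Rightarrow>\<^sub>L 'h) \<and> clinear_op (C i) \<and> (norm (B i))\<^sup>2 \<le> \<kappa> i \<and> (norm (C i))\<^sup>2 \<le> \<kappa> i)"
  using assms
proof (induction rule: finite_rank.induct)
  case (zero \<nu>)
  then show ?case by (intro exI[of _ 0]) auto
next
  case (add K \<nu> B C \<kappa>)
  then obtain n :: nat and B' C' \<kappa>' where IH: "K = (\<Sum>i<n. B' i o\<^sub>L C' i)" "(\<Sum>i<n. \<kappa>' i) \<le> \<nu>"
    "\<forall>i<n. clinear_op (B' i :: complex \<Rightarrow>\<^sub>L 'h) \<and> clinear_op (C' i) \<and> (norm (B' i))\<^sup>2 \<le> \<kappa>' i \<and> (norm (C' i))\<^sup>2 \<le> \<kappa>' i"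
    by blast
  show ?case
    by (intro exI[of _ "Suc n"] exI[of _ "B'(n := B)"] exI[of _ "C'(n := C)"] exI[of _ "\<kappa>'(n := \<kappa>)"])
      (use IH add.hyps in \<open>auto simp: less_Suc_eq\<close>)
qed

lemma sum_Pow_prod_le_exp:
  fixes m :: "'a \<Rightarrow> real"
  assumes "finite F" "\<And>e. e \<in> F \<Longrightarrow> 0 \<le> m e"
  shows "(\<Sum>S\<in>Pow F. \<Prod>e\<in>S. m e) \<le> exp (\<Sum>e\<in>F. m e)"
proof -
  have "(\<Sum>S\<in>Pow F. \<Prod>e\<in>S. m e) = (\<Prod>e\<in>F. m e + 1)"
    using prod_add[OF assms(1), of m "\<lambda>_. 1"] by simp
  also have "\<dots> \<le> (\<Prod>e\<in>F. exp (m e))"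
    using assms exp_ge_add_one_self by (intro prod_mono) (auto simp: add.commute)
  finally show ?thesis using assms by (simp add: exp_sum)
qed

text \<open>The operator factors through the finite index set of its rank one pieces, so Hadamard's inequality bounds each minor by a
product of numbers \<open>m e\<close>. Their sum over all subsets of \<open>F\<close> is \<open>\<Prod>e. 1 + m e \<le> exp (\<Sum>e. m e)\<close>, and Bessel's inequality
bounds \<open>\<Sum>e. m e\<close> by \<open>\<nu>\<close>, independently of \<open>F\<close>.\<close>

lemma finite_rank_minors_le:
  fixes K :: "'h::complex_hilbert \<Rightarrow>\<^sub>L 'h"
  assumes "finite_rank K \<nu>" and F: "finite F" "orthonormal F"
  shows "(\<Sum>S\<in>Pow F. cmod (principal_minor K S)) \<le> exp \<nu>"
proof -
  obtain n :: nat and B C \<kappa> where K: "K = (\<Sum>i<n. B i o\<^sub>L C i)" and \<kappa>: "(\<Sum>i<n. \<kappa> i) \<le> \<nu>"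
    and BC: "\<And>i. i < n \<Longrightarrow> clinear_op (B i :: complex \<Rightarrow>\<^sub>L 'h)" "\<And>i. i < n \<Longrightarrow> clinear_op (C i)"
      "\<And>i. i < n \<Longrightarrow> (norm (B i))\<^sup>2 \<le> \<kappa> i" "\<And>i. i < n \<Longrightarrow> (norm (C i))\<^sup>2 \<le> \<kappa> i"
    using finite_rank_rep[OF assms(1)] by blast
  let ?a = "\<lambda>e i. blinfun_apply (C i) e" and ?b = "\<lambda>f i. cinner (blinfun_apply (B i) 1) f"
  let ?m = "\<lambda>e. (\<Sum>i<n. (cmod (?a e i))\<^sup>2 + (cmod (?b e i))\<^sup>2) / 2"
  have ent: "cinner (blinfun_apply K e) f = (\<Sum>i<n. ?a e i * ?b f i)" for e f
    unfolding K blinfun.sum_left cinner_sum_left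
    by (intro sum.cong refl cinner_rank_one BC) auto
  have "(\<Sum>S\<in>Pow F. cmod (principal_minor K S)) \<le> (\<Sum>S\<in>Pow F. \<Prod>e\<in>S. ?m e)"
  proof (rule sum_mono)
    fix S assume "S \<in> Pow F"
    then have "finite S" using F finite_subset by auto
    then show "cmod (principal_minor K S) \<le> (\<Prod>e\<in>S. ?m e)"
      unfolding principal_minor_eq_sdet ent by (intro norm_sdet_le_prod) auto
  qed
  also have "\<dots> \<le> exp (\<Sum>e\<in>F. ?m e)"
    by (rule sum_Pow_prod_le_exp) (auto intro!: sum_nonneg F)
  also have "(\<Sum>e\<in>F. ?m e) \<le> \<nu>"
  proof -
    have "(\<Sum>e\<in>F. ?m e) = (\<Sum>i<n. ((\<Sum>e\<in>F. (cmod (?a e i))\<^sup>2) + (\<Sum>e\<in>F. (cmod (?b e i))\<^sup>2)) / 2)"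
      unfolding sum_divide_distrib[symmetric] sum.distrib[symmetric]
      by (subst sum.swap) simp
    also have "\<dots> \<le> (\<Sum>i<n. \<kappa> i)"
    proof (rule sum_mono)
      fix i assume "i \<in> {..<n}"
      then have i: "i < n" by simp
      have "(\<Sum>e\<in>F. (cmod (?a e i))\<^sup>2) \<le> (norm (C i))\<^sup>2"
        using F clinear_opD[OF BC(2)[OF i]] norm_blinfun[of "C i"]
        by (intro bessel_functional) (auto simp: blinfun.add_right scaleC_complex_def)
      moreover have "(\<Sum>e\<in>F. (cmod (?b e i))\<^sup>2) \<le> (norm (B i))\<^sup>2"
      proof -
        have "cmod (?b e i) = cmod (cinner e (blinfun_apply (B i) 1))" for e
          by (subst cinner_commute) (rule complex_mod_cnj)
        then have "(\<Sum>e\<in>F. (cmod (?b e i))\<^sup>2) = (\<Sum>e\<in>F. (cmod (cinner e (blinfun_apply (B i) 1)))\<^sup>2)"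
          by (simp only:)
        also have "\<dots> \<le> (norm (blinfun_apply (B i) 1))\<^sup>2"
          using F cinner_Cauchy_Schwarz
          by (intro bessel_functional) (auto simp: cinner_add_left cinner_scaleC_left mult.commute)
        also have "\<dots> \<le> (norm (B i))\<^sup>2"
          using norm_blinfun[of "B i" 1] by (intro power_mono) auto
        finally show ?thesis .
      qed
      ultimately show "((\<Sum>e\<in>F. (cmod (?a e i))\<^sup>2) + (\<Sum>e\<in>F. (cmod (?b e i))\<^sup>2)) / 2 \<le> \<kappa> i"
        using BC(3,4)[OF i] by simp
    qed
    finally show ?thesis using \<kappa> by simp
  qed
  finally show ?thesis by simp
qed

text \<open>The ball of radius \<open>\<nu>\<close> of the trace norm, encoded as the closure of the finite rank operators in it with respect to the
operator norm. It is stable under limits and hence under integrals, and inequalities between finitely many matrix entries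
extend to it by continuity.\<close>

definition nuclear :: "('h::complex_hilbert \<Rightarrow>\<^sub>L 'h) \<Rightarrow> real \<Rightarrow> bool" where
  "nuclear K \<nu> \<longleftrightarrow> K \<in> closure {K. finite_rank K \<nu>}"

lemma nuclear_finite_rank:
  assumes "finite_rank K \<nu>"
  shows "nuclear K \<nu>"
  unfolding nuclear_def by (rule subsetD[OF closure_subset]) (simp add: assms)

lemma nuclear_mono:
  assumes "nuclear K \<nu>" "\<nu> \<le> \<mu>"
  shows "nuclear K \<mu>"
proof -
  have "closure {K. finite_rank K \<nu>} \<subseteq> closure {K. finite_rank K \<mu>}"
    using finite_rank_mono[OF _ assms(2)] by (intro closure_mono Collect_mono impI)
  then show ?thesis using assms(1) unfolding nuclear_def by (rule subsetD)
qed

lemma nuclear_sequence: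
  assumes "nuclear K \<nu>"
  obtains k where "\<And>n. finite_rank (k n) \<nu>" "k \<longlonglongrightarrow> K"
  using assms unfolding nuclear_def closure_sequential by auto

lemma nuclearI:
  assumes "\<And>n. finite_rank (k n) \<nu>" "k \<longlonglongrightarrow> K"
  shows "nuclear K \<nu>"
  unfolding nuclear_def closure_sequential by (intro exI[of _ k]) (simp add: assms)

lemma nuclear_nonneg: "nuclear K \<nu> \<Longrightarrow> 0 \<le> \<nu>"
  by (metis nuclear_sequence finite_rank_nonneg)

lemma nuclear_add:
  assumes "nuclear K \<nu>" "nuclear L \<mu>"
  shows "nuclear (K + L) (\<nu> + \<mu>)"
proof -
  obtain k l where "\<And>n. finite_rank (k n) \<nu>" "k \<longlonglongrightarrow> K" "\<And>n. finite_rank (l n) \<mu>" "l \<longlonglongrightarrow> L"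
    using assms by (metis nuclear_sequence)
  then show ?thesis
    by (intro nuclearI[of "\<lambda>n. k n + l n"] finite_rank_add tendsto_add)
qed

lemma nuclear_compose:
  assumes "nuclear K \<nu>" "clinear_op X" "clinear_op Y"
  shows "nuclear (X o\<^sub>L K o\<^sub>L Y) (norm X * norm Y * \<nu>)"
proof -
  obtain k where "\<And>n. finite_rank (k n) \<nu>" "k \<longlonglongrightarrow> K"
    using assms(1) by (metis nuclear_sequence)
  then show ?thesis
    by (intro nuclearI[of "\<lambda>n. X o\<^sub>L k n o\<^sub>L Y"] finite_rank_compose assms tendsto_const
        bounded_bilinear.tendsto[OF bounded_bilinear_blinfun_compose])
qed

lemma nuclear_limit:
  assumes "\<And>e. e > 0 \<Longrightarrow> \<exists>L. nuclear L \<nu> \<and> norm (L - K) < e"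
  shows "nuclear K \<nu>"
proof -
  have "K \<in> closure (closure {K. finite_rank K \<nu>})"
    unfolding closure_approachable[of K "closure _"] using assms
    by (auto simp: nuclear_def dist_norm)
  then show ?thesis by (simp add: nuclear_def)
qed

section \<open>Fredholm determinants\<close>

lemma tendsto_principal_minor:
  assumes "((\<lambda>x. K x) \<longlongrightarrow> L) G"
  shows "((\<lambda>x. principal_minor (K x) S) \<longlongrightarrow> principal_minor L S) G"
  unfolding principal_minor_eq_sdet
  by (intro tendsto_sdet bounded_linear.tendsto[OF bounded_linear_cinner_left]
      bounded_linear.tendsto[OF blinfun.bounded_linear_left] assms)

lemma nuclear_minors_le:
  fixes K :: "'h::complex_hilbert \<Rightarrow>\<^sub>L 'h"
  assumes "nuclear K \<nu>" and F: "finite F" "orthonormal F"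
  shows "(\<Sum>S\<in>Pow F. cmod (principal_minor K S)) \<le> exp \<nu>"
proof -
  obtain k where k: "\<And>n. finite_rank (k n) \<nu>" "k \<longlonglongrightarrow> K"
    using assms(1) by (metis nuclear_sequence)
  show ?thesis
  proof (rule LIMSEQ_le_const2)
    show "(\<lambda>n. \<Sum>S\<in>Pow F. cmod (principal_minor (k n) S)) \<longlonglongrightarrow> (\<Sum>S\<in>Pow F. cmod (principal_minor K S))"
      by (intro tendsto_sum tendsto_norm tendsto_principal_minor k)
  qed (use finite_rank_minors_le[OF k(1) F] in auto)
qed

text \<open>The part of the Fredholm determinant that involves only basis vectors in \<open>F\<close>; it is the determinant of the compression of
\<open>I + K\<close> to their span.\<close>

definition section_det :: "'h::complex_hilbert set \<Rightarrow> ('h \<Rightarrow>\<^sub>L 'h) \<Rightarrow> complex" where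
  "section_det F K = (\<Sum>S\<in>Pow F. principal_minor K S)"

lemma tendsto_section_det:
  "((\<lambda>x. K x) \<longlongrightarrow> L) G \<Longrightarrow> ((\<lambda>x. section_det F (K x)) \<longlongrightarrow> section_det F L) G"
  unfolding section_det_def by (intro tendsto_sum tendsto_principal_minor)

lemma section_det_eq_sdet:
  "finite F \<Longrightarrow> section_det F K = sdet F (\<lambda>e f. (if e = f then 1 else 0) + cinner (blinfun_apply K e) f)"
  by (simp add: section_det_def sdet_add_diagonal principal_minor_eq_sdet)

lemma norm_section_det_le:
  "nuclear K \<nu> \<Longrightarrow> finite F \<Longrightarrow> orthonormal F \<Longrightarrow> cmod (section_det F K) \<le> exp \<nu>"
  unfolding section_det_def using nuclear_minors_le[of K \<nu> F] norm_sum order_trans by blast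

text \<open>The Lipschitz estimate rests on this: the increment along a rank one operator is its size times the increment along
the normalised operator, and the latter is bounded.\<close>

lemma section_det_rank_one_affine:
  fixes B :: "complex \<Rightarrow>\<^sub>L 'h::complex_hilbert" and C :: "'h \<Rightarrow>\<^sub>L complex"
  assumes "finite F" "clinear_op B"
  shows "section_det F (K + r *\<^sub>R (B o\<^sub>L C)) = section_det F K + of_real r * (section_det F (K + (B o\<^sub>L C)) - section_det F K)"
proof -
  let ?Y = "\<lambda>e f. (if e = f then 1 else 0) + cinner (blinfun_apply K e) f"
  have eq: "(\<lambda>e f. (if e = f then 1 else 0) + cinner (blinfun_apply (K + r *\<^sub>R (B o\<^sub>L C)) e) f) =
      (\<lambda>e f. ?Y e f + blinfun_apply C e * (of_real r * cinner (blinfun_apply B 1) f))" for r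
  proof (intro ext)
    fix e f
    have "cinner (blinfun_apply (K + r *\<^sub>R (B o\<^sub>L C)) e) f =
        cinner (blinfun_apply K e) f + of_real r * cinner (blinfun_apply (B o\<^sub>L C) e) f"
      by (simp only: plus_blinfun.rep_eq scaleR_blinfun.rep_eq cinner_add_left
          scaleC_complex_of_real[symmetric] cinner_scaleC_left)
    then show "(if e = f then 1 else 0) + cinner (blinfun_apply (K + r *\<^sub>R (B o\<^sub>L C)) e) f =
        ?Y e f + blinfun_apply C e * (of_real r * cinner (blinfun_apply B 1) f)"
      unfolding cinner_rank_one[OF assms(2)] by (simp add: algebra_simps)
  qed
  have "section_det F (K + r *\<^sub>R (B o\<^sub>L C)) =
      section_det F K + of_real r * rank_one_term F ?Y (blinfun_apply C) (\<lambda>f. cinner (blinfun_apply B 1) f)" for r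
    unfolding section_det_eq_sdet[OF assms(1)] eq sdet_add_rank_one[OF assms(1)] rank_one_term_scale[OF assms(1)] ..
  from this[of r] this[of 1] show ?thesis by simp
qed

text \<open>Add the rank one pieces of \<open>L\<close> one at a time. A piece of size \<open>\<kappa>\<close> changes the determinant by \<open>\<kappa>\<close> times its change under
the piece rescaled to size one, and the latter is at most twice the general bound \<open>exp (\<nu> + \<mu> + 1)\<close>.\<close>

lemma section_det_lipschitz:
  fixes K :: "'h::complex_hilbert \<Rightarrow>\<^sub>L 'h"
  assumes K: "nuclear K \<nu>" and L: "nuclear L \<mu>" and F: "finite F" "orthonormal F"
  shows "cmod (section_det F (K + L) - section_det F K) \<le> 2 * \<mu> * exp (\<nu> + \<mu> + 1)"
proof -
  have fin: "cmod (section_det F (K + L) - section_det F K) \<le> 2 * \<mu> * exp (\<nu> + \<mu> + 1)" if "finite_rank L \<mu>" for L \<mu>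
    using that
  proof (induction rule: finite_rank.induct)
    case (zero \<mu>)
    then show ?case by simp
  next
    case (add L \<mu> B C \<kappa>)
    have KL: "nuclear (K + L) (\<nu> + \<mu>)"
      by (intro nuclear_add K nuclear_finite_rank add.hyps)
    have \<kappa>0: "\<kappa> \<ge> 0" using add.hyps(4) zero_le_power2 order_trans by blast
    have mu0: "\<mu> \<ge> 0" using add.hyps(1) by (rule finite_rank_nonneg)
    have step: "cmod (section_det F (K + L + (B o\<^sub>L C)) - section_det F (K + L)) \<le> 2 * \<kappa> * exp (\<nu> + \<mu> + 1)"
    proof (cases "\<kappa> = 0")
      case True
      then show ?thesis using add.hyps(4) by simp
    next
      case False
      then have pos: "\<kappa> > 0" using \<kappa>0 by simp
      let ?B = "(1 / sqrt \<kappa>) *\<^sub>R B" and ?C = "(1 / sqrt \<kappa>) *\<^sub>R C"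
      have BC: "B o\<^sub>L C = \<kappa> *\<^sub>R (?B o\<^sub>L ?C)"
        using pos by (simp only: bounded_bilinear.scaleR_left[OF bounded_bilinear_blinfun_compose]
          bounded_bilinear.scaleR_right[OF bounded_bilinear_blinfun_compose] scaleR_scaleR) simp
      have "finite_rank (0 + (?B o\<^sub>L ?C)) (0 + 1)"
      proof (rule finite_rank.add)
        show "(norm ?B)\<^sup>2 \<le> 1" "(norm ?C)\<^sup>2 \<le> 1"
          using pos add.hyps(4,5) by (simp_all add: power_mult_distrib power_divide)
      qed (auto intro: finite_rank.zero clinear_op_scaleR add.hyps)
      then have N: "nuclear (K + L + (?B o\<^sub>L ?C)) (\<nu> + \<mu> + 1)"
        using nuclear_add[OF KL nuclear_finite_rank] by simp
      have "section_det F (K + L + (B o\<^sub>L C)) - section_det F (K + L) =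
          of_real \<kappa> * (section_det F (K + L + (?B o\<^sub>L ?C)) - section_det F (K + L))"
        unfolding BC using section_det_rank_one_affine[OF F(1) clinear_op_scaleR[OF add.hyps(2)]] by simp
      also have "cmod \<dots> \<le> \<kappa> * (exp (\<nu> + \<mu> + 1) + exp (\<nu> + \<mu>))"
        unfolding norm_mult using pos
        by (intro mult_mono order_trans[OF norm_triangle_ineq4] add_mono norm_section_det_le[OF N F]
            norm_section_det_le[OF KL F]) auto
      also have "\<dots> \<le> \<kappa> * (exp (\<nu> + \<mu> + 1) + exp (\<nu> + \<mu> + 1))"
        using pos by (intro mult_left_mono) auto
      finally show ?thesis by simp
    qed
    have "section_det F (K + (L + (B o\<^sub>L C))) - section_det F K =
        (section_det F (K + L + (B o\<^sub>L C)) - section_det F (K + L)) + (section_det F (K + L) - section_det F K)"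
      by (simp add: add.assoc)
    also have "cmod \<dots> \<le> 2 * \<kappa> * exp (\<nu> + \<mu> + 1) + 2 * \<mu> * exp (\<nu> + \<mu> + 1)"
      by (intro order_trans[OF norm_triangle_ineq] add_mono step add.IH)
    also have "\<dots> = 2 * (\<mu> + \<kappa>) * exp (\<nu> + \<mu> + 1)" by (simp add: algebra_simps)
    also have "\<dots> \<le> 2 * (\<mu> + \<kappa>) * exp (\<nu> + (\<mu> + \<kappa>) + 1)"
      using \<kappa>0 mu0 by (intro mult_left_mono) auto
    finally show ?case .
  qed
  obtain l where l: "\<And>n. finite_rank (l n) \<mu>" "l \<longlonglongrightarrow> L"
    using L by (metis nuclear_sequence)
  show ?thesis
  proof (rule LIMSEQ_le_const2)
    show "(\<lambda>n. cmod (section_det F (K + l n) - section_det F K)) \<longlonglongrightarrow> cmod (section_det F (K + L) - section_det F K)"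
      by (rule tendsto_norm[OF tendsto_diff[OF tendsto_section_det[OF tendsto_add[OF tendsto_const l(2)]] tendsto_const]])
    show "\<exists>N. \<forall>n\<ge>N. cmod (section_det F (K + l n) - section_det F K) \<le> 2 * \<mu> * exp (\<nu> + \<mu> + 1)"
      by (intro exI allI impI fin l(1))
  qed
qed

definition onb :: "'h::complex_hilbert set" where
  "onb = (SOME E. is_onb E)"

lemma orthonormal_onb:
  assumes "F \<subseteq> onb"
  shows "orthonormal F"
proof -
  have "is_onb onb" unfolding onb_def by (rule someI_ex[OF ex_onb])
  then have "orthonormal onb" unfolding is_onb_def orthonormal_def by blast
  then show ?thesis using assms by (rule orthonormal_subset)
qed

text \<open>The minors are absolutely summable because all finite partial sums are bounded by \<open>exp \<nu>\<close>, and the sets \<open>Pow F\<close> exhaust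
the finite subsets of the basis as \<open>F\<close> grows.\<close>

lemma section_det_tendsto_fredholm_det:
  fixes K :: "'h::complex_hilbert \<Rightarrow>\<^sub>L 'h"
  assumes "nuclear K \<nu>"
  shows "((\<lambda>F. section_det F K) \<longlongrightarrow> fredholm_det K) (finite_subsets_at_top onb)"
proof -
  let ?S = "{S. finite S \<and> S \<subseteq> (onb :: 'h set)}"
  have "(\<lambda>S. norm (principal_minor K S)) summable_on ?S"
  proof (rule nonneg_bdd_above_summable_on)
    show "bdd_above (sum (\<lambda>S. norm (principal_minor K S)) ` {F. F \<subseteq> ?S \<and> finite F})"
    proof (rule bdd_aboveI2)
      fix X assume X: "X \<in> {F. F \<subseteq> ?S \<and> finite F}"
      then have U: "finite (\<Union>X)" "\<Union>X \<subseteq> onb" by auto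
      have "(\<Sum>S\<in>X. norm (principal_minor K S)) \<le> (\<Sum>S\<in>Pow (\<Union>X). norm (principal_minor K S))"
        using U X by (intro sum_mono2) auto
      also have "\<dots> \<le> exp \<nu>"
        using U by (intro nuclear_minors_le assms orthonormal_onb) auto
      finally show "(\<Sum>S\<in>X. norm (principal_minor K S)) \<le> exp \<nu>" .
    qed
  qed simp
  then have "principal_minor K summable_on ?S"
    by (rule abs_summable_summable)
  from has_sum_infsum[OF this] have "(sum (principal_minor K) \<longlongrightarrow> infsum (principal_minor K) ?S) (finite_subsets_at_top ?S)"
    unfolding has_sum_def .
  moreover have "filterlim Pow (finite_subsets_at_top ?S) (finite_subsets_at_top onb)"
    unfolding filterlim_iff
  proof (intro allI impI)
    fix P assume "eventually P (finite_subsets_at_top ?S)"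
    then obtain X where
      "finite X \<and> X \<subseteq> ?S \<and> (\<forall>Y. finite Y \<and> X \<subseteq> Y \<and> Y \<subseteq> ?S \<longrightarrow> P Y)"
      unfolding eventually_finite_subsets_at_top by (elim exE)
    then have X: "finite X" "X \<subseteq> ?S" "\<And>Y. finite Y \<Longrightarrow> X \<subseteq> Y \<Longrightarrow> Y \<subseteq> ?S \<Longrightarrow> P Y"
      by simp_all
    show "\<forall>\<^sub>F F in finite_subsets_at_top onb. P (Pow F)"
      unfolding eventually_finite_subsets_at_top
    proof (intro exI[of _ "\<Union>X"] conjI allI impI)
      fix Y assume Y: "finite Y \<and> \<Union>X \<subseteq> Y \<and> Y \<subseteq> onb"
      then have "finite S" if "S \<subseteq> Y" for S using finite_subset[OF that] by simp
      then show "P (Pow Y)"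
        using Y by (intro X(3)) auto
    qed (use X in auto)
  qed
  ultimately have "((\<lambda>F. sum (principal_minor K) (Pow F)) \<longlongrightarrow> infsum (principal_minor K) ?S)
      (finite_subsets_at_top onb)"
    by (rule filterlim_compose)
  then show ?thesis by (simp add: section_det_def fredholm_det_def onb_def Let_def)
qed

lemma eventually_onb:
  "\<forall>\<^sub>F F in finite_subsets_at_top onb. finite F \<and> orthonormal F"
  by (rule eventually_finite_subsets_at_top_weakI) (auto intro: orthonormal_onb)

lemma fredholm_det_lipschitz:
  assumes "nuclear K \<nu>" "nuclear L \<mu>"
  shows "cmod (fredholm_det (K + L) - fredholm_det K) \<le> 2 * \<mu> * exp (\<nu> + \<mu> + 1)"
proof (rule tendsto_upperbound)
  show "((\<lambda>F. cmod (section_det F (K + L) - section_det F K)) \<longlongrightarrow> cmod (fredholm_det (K + L) - fredholm_det K))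
      (finite_subsets_at_top onb)"
    by (rule tendsto_norm[OF tendsto_diff[OF section_det_tendsto_fredholm_det[OF nuclear_add[OF assms]]
        section_det_tendsto_fredholm_det[OF assms(1)]]])
  show "\<forall>\<^sub>F F in finite_subsets_at_top onb. cmod (section_det F (K + L) - section_det F K) \<le> 2 * \<mu> * exp (\<nu> + \<mu> + 1)"
    by (rule eventually_mono[OF eventually_onb]) (use section_det_lipschitz[OF assms] in blast)
qed simp

section \<open>Bounded complex-linear operators\<close>

lemmas comp_add_left = bounded_bilinear.add_left[OF bounded_bilinear_blinfun_compose]
  and comp_add_right = bounded_bilinear.add_right[OF bounded_bilinear_blinfun_compose]
  and comp_diff_left = bounded_bilinear.diff_left[OF bounded_bilinear_blinfun_compose]
  and comp_diff_right = bounded_bilinear.diff_right[OF bounded_bilinear_blinfun_compose]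
  and comp_minus_left = bounded_bilinear.minus_left[OF bounded_bilinear_blinfun_compose]
  and comp_minus_right = bounded_bilinear.minus_right[OF bounded_bilinear_blinfun_compose]
  and comp_scaleR_left = bounded_bilinear.scaleR_left[OF bounded_bilinear_blinfun_compose]
  and comp_scaleR_right = bounded_bilinear.scaleR_right[OF bounded_bilinear_blinfun_compose]
  and tendsto_comp = bounded_bilinear.tendsto[OF bounded_bilinear_blinfun_compose]
  and bounded_linear_comp_left = bounded_bilinear.bounded_linear_left[OF bounded_bilinear_blinfun_compose]
  and bounded_linear_comp_right = bounded_bilinear.bounded_linear_right[OF bounded_bilinear_blinfun_compose]
  and has_vector_derivative_comp =
    bounded_bilinear.has_vector_derivative[OF bounded_bilinear_blinfun_compose]

lemma comp_assoc: "(S o\<^sub>L T) o\<^sub>L U = S o\<^sub>L (T o\<^sub>L U)"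
  by (rule blinfun_eqI) simp

lemma comp_id [simp]: "id_blinfun o\<^sub>L S = S" "S o\<^sub>L id_blinfun = S"
  by (rule blinfun_eqI, simp)+

lemma comp_zero [simp]: "0 o\<^sub>L S = 0" "S o\<^sub>L 0 = 0"
  by (rule blinfun_eqI, simp add: blinfun.zero_right)+

lemma norm_id_le: "norm (id_blinfun :: 'a::real_normed_vector \<Rightarrow>\<^sub>L 'a) \<le> 1"
  by (rule norm_blinfun_bound) auto

lemma scaleC_op_apply [simp]: "blinfun_apply (scaleC_op c T) x = c *\<^sub>C blinfun_apply T x"
  by (simp add: scaleC_op.rep_eq)

lemma scaleC_op_comp_left: "scaleC_op c S o\<^sub>L T = scaleC_op c (S o\<^sub>L T)"
  by (rule blinfun_eqI) simp

lemma scaleC_op_comp_right: "clinear_op S \<Longrightarrow> S o\<^sub>L scaleC_op c T = scaleC_op c (S o\<^sub>L T)"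
  by (rule blinfun_eqI) (simp add: clinear_opD)

lemma scaleC_op_add: "scaleC_op c (S + T) = scaleC_op c S + scaleC_op c T"
  by (rule blinfun_eqI) (simp add: blinfun.add_left scaleC_add_right)

lemma scaleC_op_add_left: "scaleC_op (c + d) S = scaleC_op c S + scaleC_op d S"
  by (rule blinfun_eqI) (simp add: blinfun.add_left scaleC_add_left)

lemma scaleC_op_scaleC_op: "scaleC_op c (scaleC_op d S) = scaleC_op (c * d) S"
  by (rule blinfun_eqI) (simp add: scaleC_scaleC)

lemma scaleC_op_of_real: "scaleC_op (of_real r) T = r *\<^sub>R T"
  by (rule blinfun_eqI) (simp add: scaleC_complex_of_real scaleR_blinfun.rep_eq)

lemma scaleC_op_one [simp]: "scaleC_op 1 T = T"
  using scaleC_op_of_real[of 1 T] by simp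

lemma scaleC_op_diff: "scaleC_op c (S - T) = scaleC_op c S - scaleC_op c T"
  using scaleC_op_add[of c "S - T" T] by simp

lemma norm_scaleC_op: "norm (scaleC_op c T) \<le> cmod c * norm T"
proof (rule norm_blinfun_bound)
  fix x
  have "norm (blinfun_apply (scaleC_op c T) x) = cmod c * norm (blinfun_apply T x)"
    by (simp add: norm_scaleC)
  also have "\<dots> \<le> cmod c * (norm T * norm x)"
    by (intro mult_left_mono norm_blinfun) auto
  finally show "norm (blinfun_apply (scaleC_op c T) x) \<le> cmod c * norm T * norm x"
    by (simp add: mult.assoc)
qed auto

lemma scaleC_zero_right [simp]: "c *\<^sub>C (0::'a::complex_hilbert) = 0"
  using scaleC_add_right[of c 0 0] by simp

lemma clinear_op_zero [simp]: "clinear_op 0"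
  by (simp add: clinear_op_def)

lemma clinear_op_id [simp]: "clinear_op id_blinfun"
  by (simp add: clinear_op_def)

lemma clinear_op_add: "clinear_op S \<Longrightarrow> clinear_op T \<Longrightarrow> clinear_op (S + T)"
  by (simp add: clinear_op_def blinfun.add_left scaleC_add_right)

lemma clinear_op_minus: "clinear_op S \<Longrightarrow> clinear_op (- S)"
  using clinear_op_scaleR[of S "-1"] by simp

lemma clinear_op_diff: "clinear_op S \<Longrightarrow> clinear_op T \<Longrightarrow> clinear_op (S - T)"
  using clinear_op_add[of S "- T"] clinear_op_minus[of T] by simp

lemma clinear_op_scaleC: "clinear_op S \<Longrightarrow> clinear_op (scaleC_op c S)"
  by (simp add: clinear_op_def scaleC_scaleC mult.commute)

lemma bounded_linear_scaleC: "bounded_linear (\<lambda>x::'a::complex_hilbert. c *\<^sub>C x)"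
proof -
  have "bounded_linear (blinfun_apply (scaleC_op c (id_blinfun :: 'a \<Rightarrow>\<^sub>L 'a)))"
    by (rule blinfun.bounded_linear_right)
  then show ?thesis by (simp add: scaleC_op.rep_eq)
qed

text \<open>Pointwise limits of complex-linear operators are complex-linear.\<close>

lemma clinear_op_sums:
  assumes "\<And>n. clinear_op (f n)" "f sums T"
  shows "clinear_op T"
  unfolding clinear_op_def
proof (intro allI)
  fix c x
  have "(\<lambda>n. blinfun_apply (f n) (c *\<^sub>C x)) sums blinfun_apply T (c *\<^sub>C x)"
    by (rule bounded_linear.sums[OF blinfun.bounded_linear_left assms(2)])
  moreover have "(\<lambda>n. c *\<^sub>C blinfun_apply (f n) x) sums (c *\<^sub>C blinfun_apply T x)"
    by (intro bounded_linear.sums[OF bounded_linear_scaleC]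
        bounded_linear.sums[OF blinfun.bounded_linear_left assms(2)])
  ultimately show "blinfun_apply T (c *\<^sub>C x) = c *\<^sub>C blinfun_apply T x"
    unfolding clinear_opD[OF assms(1)] by (rule sums_unique2)
qed

section \<open>Operator exponential\<close>

lemma op_pow_0 [simp]: "op_pow T 0 = id_blinfun"
  by (simp add: op_pow_def)

lemma op_pow_Suc [simp]: "op_pow T (Suc n) = T o\<^sub>L op_pow T n"
  by (simp add: op_pow_def)

lemma norm_op_pow_le: "norm (op_pow T n) \<le> norm T ^ n"
proof (induction n)
  case (Suc n)
  have "norm (op_pow T (Suc n)) \<le> norm T * norm (op_pow T n)"
    by (simp add: norm_blinfun_compose)
  also have "\<dots> \<le> norm T * norm T ^ n" by (intro mult_left_mono Suc.IH) auto
  finally show ?case by simp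
qed (simp add: norm_id_le)

lemma op_pow_commute: "S o\<^sub>L T = T o\<^sub>L S \<Longrightarrow> S o\<^sub>L op_pow T n = op_pow T n o\<^sub>L S"
proof (induction n)
  case (Suc n)
  have "S o\<^sub>L op_pow T (Suc n) = T o\<^sub>L (S o\<^sub>L op_pow T n)"
    by (simp only: op_pow_Suc comp_assoc[symmetric] Suc.prems)
  also have "\<dots> = op_pow T (Suc n) o\<^sub>L S"
    by (simp only: Suc.IH[OF Suc.prems] op_pow_Suc comp_assoc)
  finally show ?case .
qed simp

lemma op_pow_scaleR: "op_pow (r *\<^sub>R T) n = r ^ n *\<^sub>R op_pow T n"
  by (induction n) (simp_all add: comp_scaleR_left comp_scaleR_right)

lemma op_pow_scaleC:
  assumes "clinear_op T"
  shows "op_pow (scaleC_op c T) n = scaleC_op (c ^ n) (op_pow T n)"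
  by (induction n) (simp_all add: scaleC_op_comp_left scaleC_op_comp_right assms scaleC_op_scaleC_op)

lemma clinear_op_pow: "clinear_op T \<Longrightarrow> clinear_op (op_pow T n)"
  by (induction n) (auto intro: clinear_op_compose)

lemma summable_norm_op_exp: "summable (\<lambda>n. norm (op_pow T n /\<^sub>R fact n))"
proof (rule summable_comparison_test'[of "\<lambda>n. norm T ^ n / fact n"])
  show "summable (\<lambda>n. norm T ^ n / fact n)"
    using summable_exp[of "norm T"] by (simp add: field_simps)
  show "norm (norm (op_pow T n /\<^sub>R fact n)) \<le> norm T ^ n / fact n" for n
    using norm_op_pow_le[of T n] by (simp add: divide_simps)
qed

lemma op_exp_sums: "(\<lambda>n. op_pow T n /\<^sub>R fact n) sums op_exp T"
  unfolding op_exp_def by (rule summable_sums[OF summable_norm_cancel[OF summable_norm_op_exp]])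

lemma op_exp_zero [simp]: "op_exp 0 = id_blinfun"
proof -
  have "(\<lambda>n. op_pow 0 n /\<^sub>R fact n) sums (\<Sum>n\<in>{0}. op_pow 0 n /\<^sub>R fact n)"
  proof (rule sums_finite)
    fix n :: nat assume "n \<notin> {0}"
    then obtain m where "n = Suc m" by (cases n) auto
    then show "op_pow 0 n /\<^sub>R fact n = 0" by simp
  qed simp
  then show ?thesis using op_exp_sums[of "0 :: 'a \<Rightarrow>\<^sub>L 'a"] sums_unique2 by fastforce
qed

lemma clinear_op_exp: "clinear_op T \<Longrightarrow> clinear_op (op_exp T)"
  by (rule clinear_op_sums[OF _ op_exp_sums]) (intro clinear_op_scaleR clinear_op_pow)

lemma op_exp_commute:
  assumes "S o\<^sub>L T = T o\<^sub>L S"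
  shows "S o\<^sub>L op_exp T = op_exp T o\<^sub>L S"
proof -
  have "(\<lambda>n. S o\<^sub>L (op_pow T n /\<^sub>R fact n)) sums (S o\<^sub>L op_exp T)"
    by (rule bounded_linear.sums[OF bounded_linear_comp_right op_exp_sums])
  moreover have "(\<lambda>n. (op_pow T n /\<^sub>R fact n) o\<^sub>L S) sums (op_exp T o\<^sub>L S)"
    by (rule bounded_linear.sums[OF bounded_linear_comp_left op_exp_sums])
  moreover have "S o\<^sub>L (op_pow T n /\<^sub>R fact n) = (op_pow T n /\<^sub>R fact n) o\<^sub>L S" for n
    by (simp only: comp_scaleR_left comp_scaleR_right op_pow_commute[OF assms])
  ultimately show ?thesis by (simp only: sums_unique2)
qed

text \<open>Termwise differentiation of a power series with real variable and coefficients in a Banach space. The hypothesis is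
absolute convergence of the derived series at the radius \<open>\<rho>\<close>.\<close>

lemma power_series_has_vector_derivative:
  fixes a :: "nat \<Rightarrow> 'b::banach"
  assumes sm: "summable (\<lambda>n. real (Suc n) * \<rho> ^ n * norm (a (Suc n)))" and r: "\<bar>r\<bar> < \<rho>"
  shows "((\<lambda>r. \<Sum>n. r ^ n *\<^sub>R a n) has_vector_derivative (\<Sum>n. (real (Suc n) * r ^ n) *\<^sub>R a (Suc n))) (at r)"
proof -
  let ?S = "{- \<rho><..<\<rho>}"
  let ?D = "\<lambda>r. \<Sum>n. (real (Suc n) * r ^ n) *\<^sub>R a (Suc n)"
  let ?d = "\<lambda>n r. (real n * r ^ (n - 1)) *\<^sub>R a n"
  have "uniform_limit ?S (\<lambda>n r. \<Sum>i<n. (real (Suc i) * r ^ i) *\<^sub>R a (Suc i)) ?D sequentially"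
  proof (rule Weierstrass_m_test[OF _ sm])
    fix n x assume "x \<in> ?S"
    then have "\<bar>x\<bar> ^ n \<le> \<rho> ^ n" by (intro power_mono) auto
    then show "norm ((real (Suc n) * x ^ n) *\<^sub>R a (Suc n)) \<le> real (Suc n) * \<rho> ^ n * norm (a (Suc n))"
      by (auto simp: abs_mult power_abs intro!: mult_right_mono mult_left_mono)
  qed
  then have ev: "\<forall>\<^sub>F n in sequentially. \<forall>x\<in>?S. dist (\<Sum>i<n. (real (Suc i) * x ^ i) *\<^sub>R a (Suc i)) (?D x) < e"
    if "e > 0" for e
    using that by (rule uniform_limitD)
  have ex: "\<exists>g. \<forall>x\<in>?S. (\<lambda>n. x ^ n *\<^sub>R a n) sums g x \<and> (g has_derivative (\<lambda>h. h *\<^sub>R ?D x)) (at x within ?S)"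
  proof (rule has_derivative_series[where f' = "\<lambda>n x h. h *\<^sub>R ?d n x"])
    show "((\<lambda>x. x ^ n *\<^sub>R a n) has_derivative (\<lambda>h. h *\<^sub>R ?d n x)) (at x within ?S)" for n x
      by (rule has_derivative_eq_rhs, (rule derivative_intros)+) (auto simp: mult_ac)
    show "\<forall>\<^sub>F n in sequentially. \<forall>x\<in>?S. \<forall>h. norm ((\<Sum>i<n. h *\<^sub>R ?d i x) - h *\<^sub>R ?D x) \<le> e * norm h"
      if "e > 0" for e
    proof -
      \<comment> \<open>the derived series starts at index one, so \<open>Suc n\<close> terms of the original series give \<open>n\<close> derived terms\<close>
      have "\<forall>\<^sub>F n in sequentially. \<forall>x\<in>?S. \<forall>h. norm ((\<Sum>i<Suc n. h *\<^sub>R ?d i x) - h *\<^sub>R ?D x) \<le> e * norm h"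
      proof (rule eventually_mono[OF ev[OF that]], intro ballI allI)
        fix n x h
        assume h: "\<forall>x\<in>?S. dist (\<Sum>i<n. (real (Suc i) * x ^ i) *\<^sub>R a (Suc i)) (?D x) < e" and x: "x \<in> ?S"
        have "(\<Sum>i<Suc n. h *\<^sub>R ?d i x) = (\<Sum>i<n. h *\<^sub>R ((real (Suc i) * x ^ i) *\<^sub>R a (Suc i)))"
          unfolding sum.lessThan_Suc_shift by simp
        also have "\<dots> = h *\<^sub>R (\<Sum>i<n. (real (Suc i) * x ^ i) *\<^sub>R a (Suc i))"
          by (rule scaleR_sum_right[symmetric])
        finally have "norm ((\<Sum>i<Suc n. h *\<^sub>R ?d i x) - h *\<^sub>R ?D x) =
            \<bar>h\<bar> * dist (\<Sum>i<n. (real (Suc i) * x ^ i) *\<^sub>R a (Suc i)) (?D x)"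
          by (simp only: scaleR_diff_right[symmetric] norm_scaleR dist_norm)
        also have "\<dots> \<le> \<bar>h\<bar> * e"
          using h x by (intro mult_left_mono) (auto intro: less_imp_le)
        finally show "norm ((\<Sum>i<Suc n. h *\<^sub>R ?d i x) - h *\<^sub>R ?D x) \<le> e * norm h"
          by (simp only: real_norm_def mult.commute)
      qed
      then show ?thesis by (subst eventually_sequentially_Suc[symmetric])
    qed
    show "(\<lambda>n. 0 ^ n *\<^sub>R a n) sums a 0"
      using sums_finite[of "{0}" "\<lambda>n. 0 ^ n *\<^sub>R a n"] by simp
  qed (use r in auto)
  then obtain g where "\<forall>x\<in>?S. (\<lambda>n. x ^ n *\<^sub>R a n) sums g x \<and> (g has_derivative (\<lambda>h. h *\<^sub>R ?D x)) (at x within ?S)"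
    by (elim exE)
  then have g: "\<And>x. x \<in> ?S \<Longrightarrow> (\<lambda>n. x ^ n *\<^sub>R a n) sums g x"
    "\<And>x. x \<in> ?S \<Longrightarrow> (g has_derivative (\<lambda>h. h *\<^sub>R ?D x)) (at x within ?S)"
    by simp_all
  have rS: "r \<in> ?S" using r by auto
  have "(g has_vector_derivative ?D r) (at r)"
    using g(2)[OF rS] at_within_open[OF rS] by (simp add: has_vector_derivative_def)
  then show ?thesis
    by (rule has_vector_derivative_transform_within_open[OF _ _ rS])
      (use g(1) in \<open>auto simp: sums_iff\<close>)
qed

lemma op_exp_scaleR_sums: "(\<lambda>n. r ^ n *\<^sub>R (op_pow T n /\<^sub>R fact n)) sums op_exp (r *\<^sub>R T)"
  using op_exp_sums[of "r *\<^sub>R T"] by (simp add: op_pow_scaleR mult.commute)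

lemma op_exp_has_vector_derivative:
  "((\<lambda>r. op_exp (r *\<^sub>R T)) has_vector_derivative (T o\<^sub>L op_exp (r *\<^sub>R T))) (at r)"
proof -
  let ?a = "\<lambda>n. op_pow T n /\<^sub>R fact n"
  have a: "real (Suc n) *\<^sub>R ?a (Suc n) = T o\<^sub>L ?a n" for n
    by (simp add: comp_scaleR_right field_simps del: of_nat_Suc)
  have eq: "(\<Sum>n. (real (Suc n) * r ^ n) *\<^sub>R ?a (Suc n)) = T o\<^sub>L op_exp (r *\<^sub>R T)"
  proof -
    have "(\<lambda>n. T o\<^sub>L (r ^ n *\<^sub>R ?a n)) sums (T o\<^sub>L op_exp (r *\<^sub>R T))"
      by (rule bounded_linear.sums[OF bounded_linear_comp_right op_exp_scaleR_sums])
    moreover have "T o\<^sub>L (r ^ n *\<^sub>R ?a n) = (real (Suc n) * r ^ n) *\<^sub>R ?a (Suc n)" for n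
      by (subst comp_scaleR_right[of T "r ^ n" "?a n"], subst a[symmetric]) (simp only: scaleR_scaleR mult_ac)
    ultimately show ?thesis by (simp only: sums_iff)
  qed
  have "((\<lambda>r. \<Sum>n. r ^ n *\<^sub>R ?a n) has_vector_derivative (\<Sum>n. (real (Suc n) * r ^ n) *\<^sub>R ?a (Suc n))) (at r)"
  proof (rule power_series_has_vector_derivative[where \<rho> = "\<bar>r\<bar> + 1"])
    show "summable (\<lambda>n. real (Suc n) * (\<bar>r\<bar> + 1) ^ n * norm (?a (Suc n)))"
    proof (rule summable_comparison_test'[OF summable_mult[of _ "norm T"]])
      show "summable (\<lambda>n. norm (op_pow ((\<bar>r\<bar> + 1) *\<^sub>R T) n /\<^sub>R fact n))"
        by (rule summable_norm_op_exp)
      fix n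
      have "real (Suc n) * (\<bar>r\<bar> + 1) ^ n * norm (?a (Suc n)) = (\<bar>r\<bar> + 1) ^ n * norm (real (Suc n) *\<^sub>R ?a (Suc n))"
        by (simp only: norm_scaleR) (simp add: mult_ac)
      also have "\<dots> \<le> (\<bar>r\<bar> + 1) ^ n * (norm T * norm (?a n))"
        unfolding a by (intro mult_left_mono norm_blinfun_compose) auto
      also have "\<dots> = norm T * norm (op_pow ((\<bar>r\<bar> + 1) *\<^sub>R T) n /\<^sub>R fact n)"
        by (simp add: op_pow_scaleR abs_power_minus mult_ac)
      finally show "norm (real (Suc n) * (\<bar>r\<bar> + 1) ^ n * norm (?a (Suc n))) \<le>
          norm T * norm (op_pow ((\<bar>r\<bar> + 1) *\<^sub>R T) n /\<^sub>R fact n)"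
        by simp
    qed
  qed simp
  moreover have "(\<Sum>n. r ^ n *\<^sub>R ?a n) = op_exp (r *\<^sub>R T)" for r
    using op_exp_scaleR_sums by (rule sums_unique[symmetric])
  ultimately show ?thesis by (simp only: eq)
qed

lemma constant_if_zero_vector_derivative:
  fixes f :: "real \<Rightarrow> 'b::real_normed_vector"
  assumes "\<And>r. \<bar>r\<bar> < \<rho> \<Longrightarrow> (f has_vector_derivative 0) (at r)" "\<bar>a\<bar> < \<rho>" "\<bar>b\<bar> < \<rho>"
  shows "f a = f b"
proof -
  have "\<exists>c. \<forall>x\<in>{- \<rho><..<\<rho>}. f x = c"
  proof (rule has_derivative_zero_constant)
    fix x assume "x \<in> {- \<rho><..<\<rho>}"
    then have "(f has_vector_derivative 0) (at x)" by (intro assms(1)) auto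
    then have "(f has_derivative (\<lambda>h. 0)) (at x)" by (simp add: has_vector_derivative_def)
    then show "(f has_derivative (\<lambda>h. 0)) (at x within {- \<rho><..<\<rho>})"
      by (rule has_derivative_at_withinI)
  qed simp
  then obtain c where "\<forall>x\<in>{- \<rho><..<\<rho>}. f x = c"
    by (elim exE)
  then have "f a = c" "f b = c" using assms(2,3) by (simp_all add: abs_less_iff)
  then show ?thesis by simp
qed

text \<open>Functional equation in a form that needs no inverses: the product of the three exponentials, with each exponent
multiplied by \<open>r\<close>, has derivative zero in \<open>r\<close>.\<close>

lemma op_exp_sum_zero:
  assumes "S o\<^sub>L T = T o\<^sub>L S"
  shows "op_exp S o\<^sub>L op_exp T o\<^sub>L op_exp (- (S + T)) = id_blinfun"
proof -
  let ?U = "- (S + T)"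
  define g where "g r = op_exp (r *\<^sub>R S) o\<^sub>L op_exp (r *\<^sub>R T) o\<^sub>L op_exp (r *\<^sub>R ?U)" for r
  have "(g has_vector_derivative 0) (at r)" for r
  proof -
    let ?s = "op_exp (r *\<^sub>R S)" and ?t = "op_exp (r *\<^sub>R T)" and ?u = "op_exp (r *\<^sub>R ?U)"
    have SU: "S o\<^sub>L ?U = ?U o\<^sub>L S" and TU: "T o\<^sub>L ?U = ?U o\<^sub>L T"
      by (simp_all only: comp_minus_left comp_minus_right comp_add_left comp_add_right assms)
    have 1: "?s o\<^sub>L T = T o\<^sub>L ?s"
      using op_exp_commute[of T "r *\<^sub>R S"] assms by (simp add: comp_scaleR_left comp_scaleR_right)
    have U: "?t o\<^sub>L ?U = ?U o\<^sub>L ?t" "?s o\<^sub>L ?U = ?U o\<^sub>L ?s"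
      using op_exp_commute[of "?U" "r *\<^sub>R T"] op_exp_commute[of "?U" "r *\<^sub>R S"]
      by (simp_all only: comp_scaleR_left comp_scaleR_right SU TU)
    have "(g has_vector_derivative ((?s o\<^sub>L ?t) o\<^sub>L (?U o\<^sub>L ?u)) +
        (((?s o\<^sub>L (T o\<^sub>L ?t)) + ((S o\<^sub>L ?s) o\<^sub>L ?t)) o\<^sub>L ?u)) (at r)"
      unfolding g_def
      by (rule has_vector_derivative_comp[OF has_vector_derivative_comp[OF
              op_exp_has_vector_derivative op_exp_has_vector_derivative] op_exp_has_vector_derivative])
    also have "(?s o\<^sub>L ?t) o\<^sub>L (?U o\<^sub>L ?u) = ?U o\<^sub>L (?s o\<^sub>L (?t o\<^sub>L ?u))"
      by (metis comp_assoc U)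
    also have "((?s o\<^sub>L (T o\<^sub>L ?t)) + ((S o\<^sub>L ?s) o\<^sub>L ?t)) o\<^sub>L ?u =
        (S + T) o\<^sub>L (?s o\<^sub>L (?t o\<^sub>L ?u))"
      by (simp only: comp_add_left comp_assoc[symmetric] 1) (simp only: add.commute)
    also have "(?U o\<^sub>L (?s o\<^sub>L (?t o\<^sub>L ?u))) + ((S + T) o\<^sub>L (?s o\<^sub>L (?t o\<^sub>L ?u))) = 0"
      by (simp only: comp_minus_left) simp
    finally show ?thesis .
  qed
  then have "g 1 = g 0"
    by (rule constant_if_zero_vector_derivative[where \<rho> = 2]) auto
  then show ?thesis by (simp add: g_def)
qed

lemma op_exp_minus_right: "op_exp S o\<^sub>L op_exp (- S) = id_blinfun"
  using op_exp_sum_zero[of S "- S"] by (simp add: comp_minus_left comp_minus_right)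

lemma op_exp_add:
  assumes "S o\<^sub>L T = T o\<^sub>L S"
  shows "op_exp (S + T) = op_exp S o\<^sub>L op_exp T"
proof -
  have "op_exp S o\<^sub>L op_exp T = (op_exp S o\<^sub>L op_exp T) o\<^sub>L (op_exp (- (S + T)) o\<^sub>L op_exp (S + T))"
    using op_exp_minus_right[of "- (S + T)"] by (simp only: minus_minus comp_id)
  also have "\<dots> = op_exp (S + T)"
    by (simp only: comp_assoc[symmetric] op_exp_sum_zero[OF assms] comp_id)
  finally show ?thesis ..
qed

lemma norm_op_exp_remainder: "norm (op_exp T - id_blinfun - T) \<le> (norm T)\<^sup>2 * exp (norm T)"
proof -
  let ?a = "\<lambda>n. op_pow T n /\<^sub>R fact n"
  have "(\<lambda>n. ?a (n + 2)) sums (op_exp T - (\<Sum>i<2. ?a i))"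
    using op_exp_sums by (rule sums_split_initial_segment)
  also have "op_exp T - (\<Sum>i<2. ?a i) = op_exp T - id_blinfun - T"
    by (simp add: numeral_2_eq_2)
  finally have eq: "op_exp T - id_blinfun - T = (\<Sum>n. ?a (n + 2))" by (simp only: sums_iff)
  have le: "norm (?a (n + 2)) \<le> (norm T)\<^sup>2 * (norm T ^ n / fact n)" for n
  proof -
    have "norm (?a (n + 2)) \<le> norm T ^ (n + 2) / fact (n + 2)"
      using norm_op_pow_le[of T "n + 2"] by (simp add: divide_simps del: op_pow_Suc)
    also have "\<dots> \<le> norm T ^ (n + 2) / fact n"
      by (intro divide_left_mono fact_mono) auto
    finally show ?thesis by (simp add: power_add power2_eq_square mult_ac)
  qed
  have sums: "(\<lambda>n. (norm T)\<^sup>2 * (norm T ^ n / fact n)) sums ((norm T)\<^sup>2 * exp (norm T))"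
    using exp_converges[of "norm T"] by (intro sums_mult) (simp add: divide_inverse mult.commute)
  have "norm (\<Sum>n. ?a (n + 2)) \<le> (\<Sum>n. (norm T)\<^sup>2 * (norm T ^ n / fact n))"
    by (rule norm_suminf_le[OF le]) (rule sums_summable[OF sums])
  then show ?thesis using sums unfolding eq by (simp only: sums_iff)
qed

lemma op_exp_has_derivative_zero: "(op_exp has_derivative (\<lambda>T. T)) (at (0 :: 'a::complex_hilbert \<Rightarrow>\<^sub>L 'a))"
proof (rule has_derivativeI_sandwich[where e = 1 and H = "\<lambda>T. norm T * exp (norm T)"])
  show "norm (op_exp T - op_exp 0 - (T - 0)) / norm (T - 0) \<le> norm T * exp (norm T)"
    for T :: "'a \<Rightarrow>\<^sub>L 'a"
    using norm_op_exp_remainder[of T] by (simp add: divide_simps power2_eq_square mult_ac)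
  have "((\<lambda>T :: 'a \<Rightarrow>\<^sub>L 'a. norm T * exp (norm T)) \<longlongrightarrow> norm (0 :: 'a \<Rightarrow>\<^sub>L 'a) * exp (norm (0 :: 'a \<Rightarrow>\<^sub>L 'a))) (at 0)"
    by (intro tendsto_intros)
  then show "((\<lambda>T :: 'a \<Rightarrow>\<^sub>L 'a. norm T * exp (norm T)) \<longlongrightarrow> 0) (at 0)" by simp
qed (auto intro: bounded_linear_ident)

text \<open>For commuting values \<open>op_exp (L q) = op_exp (L r) o op_exp (L q - L r)\<close>, so the derivative at \<open>r\<close> reduces to that of the
exponential at zero.\<close>

lemma op_exp_has_vector_derivative_commuting:
  assumes L: "(L has_vector_derivative L') (at r)" and com: "\<And>q. L q o\<^sub>L L r = L r o\<^sub>L L q"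
  shows "((\<lambda>r. op_exp (L r)) has_vector_derivative (op_exp (L r) o\<^sub>L L')) (at r)"
proof -
  have "((\<lambda>q. L q - L r) has_vector_derivative L') (at r)"
    using has_vector_derivative_diff[OF L has_vector_derivative_const[of "L r"]] by simp
  then have "((\<lambda>q. L q - L r) has_derivative (\<lambda>h. h *\<^sub>R L')) (at r)"
    by (simp add: has_vector_derivative_def)
  then have "((\<lambda>q. op_exp (L q - L r)) has_derivative (\<lambda>h. h *\<^sub>R L')) (at r)"
    by (rule has_derivative_compose[where g = op_exp and g' = "\<lambda>T. T"])
      (use op_exp_has_derivative_zero in simp)
  then have "((\<lambda>q. op_exp (L r) o\<^sub>L op_exp (L q - L r)) has_derivative (\<lambda>h. op_exp (L r) o\<^sub>L (h *\<^sub>R L'))) (at r)"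
    by (rule bounded_linear.has_derivative[OF bounded_linear_comp_right])
  moreover have "op_exp (L r) o\<^sub>L op_exp (L q - L r) = op_exp (L q)" for q
    by (subst op_exp_add[symmetric]) (simp_all add: comp_diff_left comp_diff_right com[of q])
  ultimately show ?thesis
    by (simp add: has_vector_derivative_def comp_scaleR_right)
qed

text \<open>The series of \<open>- log (I - N)\<close>.\<close>

definition op_log :: "('a::complex_hilbert \<Rightarrow>\<^sub>L 'a) \<Rightarrow> ('a \<Rightarrow>\<^sub>L 'a)" where
  "op_log N = (\<Sum>j. op_pow N (Suc j) /\<^sub>R real (Suc j))"

lemma summable_op_log: "norm N < 1 \<Longrightarrow> summable (\<lambda>j. op_pow N (Suc j) /\<^sub>R real (Suc j))"
proof (rule summable_comparison_test'[of "\<lambda>j. norm N ^ Suc j"])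
  assume "norm N < 1"
  then show "summable (\<lambda>j. norm N ^ Suc j)"
    by (subst summable_Suc_iff) (rule summable_geometric, simp)
  show "norm (op_pow N (Suc j) /\<^sub>R real (Suc j)) \<le> norm N ^ Suc j" for j
  proof -
    have "norm (op_pow N (Suc j) /\<^sub>R real (Suc j)) \<le> norm (op_pow N (Suc j))"
      by (simp add: mult_left_le_one_le inverse_le_1_iff del: op_pow_Suc)
    then show ?thesis using norm_op_pow_le[of N "Suc j"] by linarith
  qed
qed

text \<open>Replace \<open>N\<close> by \<open>r N\<close> and let \<open>L r\<close> be the logarithmic series. Its derivative \<open>D r\<close> satisfies \<open>(I - r N) D r = N\<close>, so the
derivative of \<open>(I - r N) exp (L r)\<close> vanishes; compare \<open>r = 1\<close> with \<open>r = 0\<close>.\<close>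

lemma op_exp_log:
  assumes N: "norm N < 1"
  shows "(id_blinfun - N) o\<^sub>L op_exp (op_log N) = id_blinfun"
proof -
  \<comment> \<open>a radius above \<open>1\<close> at which the logarithmic series still converges\<close>
  define \<rho> where "\<rho> = 2 / (1 + norm N)"
  have pos: "1 + norm N > 0" by (smt (verit) norm_ge_zero)
  have \<rho>: "1 < \<rho>" "\<rho> * norm N < 1"
    using N pos by (auto simp: \<rho>_def divide_simps)
  define a where "a n = (if n = 0 then 0 else op_pow N n /\<^sub>R real n)" for n
  define L where "L r = (\<Sum>n. r ^ n *\<^sub>R a n)" for r
  define D where "D r = (\<Sum>n. r ^ n *\<^sub>R op_pow N (Suc n))" for r
  have a_Suc: "real (Suc n) *\<^sub>R a (Suc n) = op_pow N (Suc n)" for n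
    by (simp add: a_def del: op_pow_Suc of_nat_Suc)
  have geo: "summable (\<lambda>n. norm N * (\<rho> * norm N) ^ n)"
    using \<rho> by (intro summable_mult summable_geometric) simp
  have bound: "\<rho> ^ n * norm (op_pow N (Suc n)) \<le> norm N * (\<rho> * norm N) ^ n" for n
  proof -
    have "\<rho> ^ n * norm (op_pow N (Suc n)) \<le> \<rho> ^ n * norm N ^ Suc n"
      using \<rho> by (intro mult_left_mono norm_op_pow_le) auto
    then show ?thesis by (simp add: power_mult_distrib mult_ac)
  qed
  have sm: "summable (\<lambda>n. real (Suc n) * \<rho> ^ n * norm (a (Suc n)))"
  proof (rule summable_comparison_test'[OF geo])
    fix n
    have "real (Suc n) * \<rho> ^ n * norm (a (Suc n)) = \<rho> ^ n * norm (real (Suc n) *\<^sub>R a (Suc n))"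
      by (simp only: norm_scaleR) (simp add: mult_ac)
    also have "\<dots> \<le> norm N * (\<rho> * norm N) ^ n"
      unfolding a_Suc by (rule bound)
    finally show "norm (real (Suc n) * \<rho> ^ n * norm (a (Suc n))) \<le> norm N * (\<rho> * norm N) ^ n"
      using \<rho> by simp
  qed
  have smD: "summable (\<lambda>n. r ^ n *\<^sub>R op_pow N (Suc n))" if "\<bar>r\<bar> < \<rho>" for r
  proof (rule summable_comparison_test'[OF geo])
    fix n
    have "norm (r ^ n *\<^sub>R op_pow N (Suc n)) \<le> \<rho> ^ n * norm (op_pow N (Suc n))"
      using that by (auto simp: power_abs simp del: op_pow_Suc intro!: mult_right_mono power_mono)
    then show "norm (r ^ n *\<^sub>R op_pow N (Suc n)) \<le> norm N * (\<rho> * norm N) ^ n"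
      using bound[of n] by linarith
  qed
  have LD: "(L has_vector_derivative D r) (at r)" if "\<bar>r\<bar> < \<rho>" for r
  proof -
    have "(real (Suc n) * r ^ n) *\<^sub>R a (Suc n) = r ^ n *\<^sub>R op_pow N (Suc n)" for n
      by (simp only: a_Suc[symmetric] scaleR_scaleR mult.commute)
    then show ?thesis
      using power_series_has_vector_derivative[OF sm that] by (simp only: L_def[abs_def] D_def)
  qed
  have smL: "summable (\<lambda>n. r ^ n *\<^sub>R a n)" if r: "\<bar>r\<bar> < \<rho>" for r
  proof (subst summable_Suc_iff[symmetric], rule summable_comparison_test'[OF summable_mult[OF geo]])
    fix n
    have na: "norm (a (Suc n)) \<le> norm (op_pow N (Suc n))"
      by (simp add: a_def mult_left_le_one_le inverse_le_1_iff del: op_pow_Suc)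
    have "norm (r ^ Suc n *\<^sub>R a (Suc n)) \<le> norm (r ^ Suc n *\<^sub>R op_pow N (Suc n))"
      unfolding norm_scaleR by (intro mult_left_mono na) simp
    also have "\<dots> = \<bar>r\<bar> * (\<bar>r\<bar> ^ n * norm (op_pow N (Suc n)))"
      by (simp add: power_abs abs_mult del: op_pow_Suc)
    also have "\<dots> \<le> \<rho> * (\<rho> ^ n * norm (op_pow N (Suc n)))"
      using r \<rho> by (intro mult_mono power_mono) auto
    also have "\<dots> \<le> \<rho> * (norm N * (\<rho> * norm N) ^ n)"
      using \<rho> bound by (intro mult_left_mono) auto
    finally show "norm (r ^ Suc n *\<^sub>R a (Suc n)) \<le> \<rho> * (norm N * (\<rho> * norm N) ^ n)" .
  qed
  have comN: "S o\<^sub>L L r = L r o\<^sub>L S" if S: "S o\<^sub>L N = N o\<^sub>L S" and r: "\<bar>r\<bar> < \<rho>" for r S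
  proof -
    have Sa: "S o\<^sub>L a n = a n o\<^sub>L S" for n
      by (cases "n = 0") (simp_all add: a_def comp_scaleR_left comp_scaleR_right op_pow_commute[OF S])
    have "S o\<^sub>L L r = (\<Sum>n. S o\<^sub>L (r ^ n *\<^sub>R a n))"
      unfolding L_def by (rule bounded_linear.suminf[OF bounded_linear_comp_right smL[OF r]])
    also have "\<dots> = (\<Sum>n. (r ^ n *\<^sub>R a n) o\<^sub>L S)"
      by (simp only: comp_scaleR_left comp_scaleR_right Sa)
    also have "\<dots> = L r o\<^sub>L S"
      unfolding L_def by (rule bounded_linear.suminf[OF bounded_linear_comp_left smL[OF r], symmetric])
    finally show ?thesis .
  qed
  have com: "L q o\<^sub>L L r = L r o\<^sub>L L q" if "\<bar>q\<bar> < \<rho>" "\<bar>r\<bar> < \<rho>" for q r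
    using comN[OF _ that(2), of "L q"] comN[OF refl that(1)] by simp
  have resolvent: "(id_blinfun - r *\<^sub>R N) o\<^sub>L D r = N" if r: "\<bar>r\<bar> < \<rho>" for r
  proof -
    have "D r = op_pow N (Suc 0) + (\<Sum>n. r ^ Suc n *\<^sub>R op_pow N (Suc (Suc n)))"
      unfolding D_def using suminf_split_head[OF smD[OF r]] by simp
    also have "(\<Sum>n. r ^ Suc n *\<^sub>R op_pow N (Suc (Suc n))) = (\<Sum>n. (r *\<^sub>R N) o\<^sub>L (r ^ n *\<^sub>R op_pow N (Suc n)))"
      by (simp add: comp_scaleR_left comp_scaleR_right mult.commute)
    also have "\<dots> = (r *\<^sub>R N) o\<^sub>L D r"
      unfolding D_def by (rule bounded_linear.suminf[OF bounded_linear_comp_right smD[OF r], symmetric])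
    finally show ?thesis by (simp only: comp_diff_left comp_id diff_eq_eq op_pow_Suc op_pow_0)
  qed
  \<comment> \<open>outside the disc the series may diverge; the cut-off makes all values of \<open>?L\<close> commute\<close>
  let ?L = "\<lambda>r. if \<bar>r\<bar> < \<rho> then L r else 0"
  have LD': "(?L has_vector_derivative D r) (at r)" if r: "\<bar>r\<bar> < \<rho>" for r
  proof (rule has_vector_derivative_transform_within_open[OF LD[OF r]])
    show "open {- \<rho><..<\<rho>}" "r \<in> {- \<rho><..<\<rho>}" using r by auto
  qed auto
  have "((\<lambda>r. (id_blinfun - r *\<^sub>R N) o\<^sub>L op_exp (?L r)) has_vector_derivative 0) (at r)"
    if r: "\<bar>r\<bar> < \<rho>" for r
  proof -
    have "((\<lambda>r. op_exp (?L r)) has_vector_derivative (op_exp (?L r) o\<^sub>L D r)) (at r)"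
      by (rule op_exp_has_vector_derivative_commuting[OF LD'[OF r]]) (auto simp: com r)
    moreover have "((\<lambda>r. id_blinfun - r *\<^sub>R N) has_vector_derivative (- N)) (at r)"
      by (auto intro!: derivative_eq_intros)
    ultimately have "((\<lambda>r. (id_blinfun - r *\<^sub>R N) o\<^sub>L op_exp (?L r)) has_vector_derivative
        ((id_blinfun - r *\<^sub>R N) o\<^sub>L (op_exp (?L r) o\<^sub>L D r)) + ((- N) o\<^sub>L op_exp (?L r))) (at r)"
      by (intro has_vector_derivative_comp)
    moreover have "(id_blinfun - r *\<^sub>R N) o\<^sub>L (op_exp (?L r) o\<^sub>L D r) = N o\<^sub>L op_exp (?L r)"
    proof -
      have cN: "N o\<^sub>L ?L r = ?L r o\<^sub>L N" using comN[OF refl r] r by simp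
      have cI: "(id_blinfun - r *\<^sub>R N) o\<^sub>L op_exp (?L r) = op_exp (?L r) o\<^sub>L (id_blinfun - r *\<^sub>R N)"
        using op_exp_commute[OF cN]
        by (simp only: comp_diff_left comp_diff_right comp_id comp_scaleR_left comp_scaleR_right)
      show ?thesis
        by (simp only: comp_assoc[symmetric] cI) (simp only: comp_assoc resolvent[OF r] op_exp_commute[OF cN])
    qed
    ultimately show ?thesis by (simp only: comp_minus_left) simp
  qed
  then have "(id_blinfun - 1 *\<^sub>R N) o\<^sub>L op_exp (?L 1) = (id_blinfun - 0 *\<^sub>R N) o\<^sub>L op_exp (?L 0)"
    by (rule constant_if_zero_vector_derivative) (use \<rho> in auto)
  moreover have "L 0 = 0"
    using sums_finite[of "{0}" "\<lambda>n. 0 ^ n *\<^sub>R a n"] by (simp add: L_def a_def sums_iff)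
  moreover have "L 1 = op_log N"
    unfolding L_def op_log_def
    using suminf_split_head[OF smL[of 1]] \<rho> by (simp add: a_def del: op_pow_Suc of_nat_Suc)
  ultimately show ?thesis using \<rho> by simp
qed

section \<open>Exponentially stable semigroups\<close>

text \<open>The semigroup generated by \<open>- A\<close>.\<close>

definition exp_neg :: "('h::complex_hilbert \<Rightarrow>\<^sub>L 'h) \<Rightarrow> real \<Rightarrow> ('h \<Rightarrow>\<^sub>L 'h)" where
  "exp_neg A v = op_exp (- (v *\<^sub>R A))"

lemma exp_neg_add: "exp_neg A (u + v) = exp_neg A u o\<^sub>L exp_neg A v"
proof -
  have "- ((u + v) *\<^sub>R A) = - (u *\<^sub>R A) + - (v *\<^sub>R A)" by (simp add: scaleR_add_left)
  then show ?thesis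
    unfolding exp_neg_def
    by (simp only:, intro op_exp_add)
      (simp add: comp_minus_left comp_minus_right comp_scaleR_left comp_scaleR_right mult.commute)
qed

lemma exp_neg_zero [simp]: "exp_neg A 0 = id_blinfun"
  by (simp add: exp_neg_def)

lemma clinear_exp_neg: "clinear_op A \<Longrightarrow> clinear_op (exp_neg A v)"
  unfolding exp_neg_def by (intro clinear_op_exp clinear_op_minus clinear_op_scaleR)

lemma exp_neg_commute:
  assumes "S o\<^sub>L A = A o\<^sub>L S"
  shows "S o\<^sub>L exp_neg A v = exp_neg A v o\<^sub>L S"
  unfolding exp_neg_def
  by (rule op_exp_commute)
    (simp only: comp_minus_left comp_minus_right comp_scaleR_left comp_scaleR_right assms)

lemma exp_neg_has_vector_derivative: "(exp_neg A has_vector_derivative - (A o\<^sub>L exp_neg A v)) (at v)"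
  using op_exp_has_vector_derivative[of "- A" v]
  unfolding exp_neg_def[abs_def] by (simp add: comp_minus_left)

lemma continuous_on_exp_neg: "continuous_on S (exp_neg A)"
  by (rule continuous_at_imp_continuous_on)
    (blast intro: has_vector_derivative_continuous exp_neg_has_vector_derivative)

lemma norm_exp_neg_multiple_le: "norm (exp_neg A (real k * t)) \<le> norm (exp_neg A t) ^ k"
proof (induction k)
  case 0
  then show ?case by (simp add: norm_id_le)
next
  case (Suc k)
  have "exp_neg A (real (Suc k) * t) = exp_neg A t o\<^sub>L exp_neg A (real k * t)"
    unfolding exp_neg_add[symmetric] by (simp add: algebra_simps)
  then have "norm (exp_neg A (real (Suc k) * t)) \<le> norm (exp_neg A t) * norm (exp_neg A (real k * t))"
    by (simp only: norm_blinfun_compose)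
  also have "\<dots> \<le> norm (exp_neg A t) * norm (exp_neg A t) ^ k" by (intro mult_left_mono Suc.IH) auto
  finally show ?case by simp
qed

text \<open>Write \<open>v = k t0 + r\<close> with \<open>0 \<le> r \<le> t0\<close>: the factor for \<open>k t0\<close> is at most the \<open>k\<close>-th power of a number below one, the
factor for \<open>r\<close> is bounded by compactness.\<close>

lemma exp_neg_decay:
  assumes "\<exists>t0>0. norm (exp_neg A t0) < 1"
  obtains M \<delta> where "M > 0" "\<delta> > 0" "\<And>v. v \<ge> 0 \<Longrightarrow> norm (exp_neg A v) \<le> M * exp (- \<delta> * v)"
proof -
  obtain t0 where t0: "t0 > 0" "norm (exp_neg A t0) < 1" using assms by (elim exE conjE)
  \<comment> \<open>the maximum keeps \<open>ln q\<close> meaningful when the norm is zero\<close>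
  define q where "q = max (norm (exp_neg A t0)) (1 / 2)"
  have q: "0 < q" "q < 1" "norm (exp_neg A t0) \<le> q" using t0 by (auto simp: q_def)
  have "compact (exp_neg A ` {0..t0})"
    by (intro compact_continuous_image continuous_on_exp_neg compact_Icc)
  then have "bounded (exp_neg A ` {0..t0})" by (rule compact_imp_bounded)
  then obtain M where M: "M > 0" "\<forall>x\<in>exp_neg A ` {0..t0}. norm x \<le> M"
    unfolding bounded_pos by (elim exE conjE)
  define \<delta> where "\<delta> = - ln q / t0"
  have \<delta>: "\<delta> > 0" using q t0 by (simp add: \<delta>_def divide_neg_pos)
  have "norm (exp_neg A v) \<le> (M / q) * exp (- \<delta> * v)" if v: "v \<ge> 0" for v
  proof -
    define k where "k = nat \<lfloor>v / t0\<rfloor>"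
    have k: "real k \<le> v / t0" "v / t0 - 1 \<le> real k"
      using v t0 by (auto simp: k_def)
    define r where "r = v - real k * t0"
    have r: "r \<in> {0..t0}" "v = real k * t0 + r"
      using k t0 by (auto simp: r_def field_simps)
    have "norm (exp_neg A v) \<le> norm (exp_neg A (real k * t0)) * norm (exp_neg A r)"
      unfolding r(2) exp_neg_add by (rule norm_blinfun_compose)
    also have "\<dots> \<le> q ^ k * M"
    proof (rule mult_mono)
      have "norm (exp_neg A (real k * t0)) \<le> norm (exp_neg A t0) ^ k" by (rule norm_exp_neg_multiple_le)
      also have "\<dots> \<le> q ^ k" using q by (intro power_mono) auto
      finally show "norm (exp_neg A (real k * t0)) \<le> q ^ k" .
    qed (use M r q in auto)
    also have "q ^ k = exp (ln q * real k)"
      using q by (simp add: exp_of_nat2_mult)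
    also have "\<dots> \<le> exp (ln q * (v / t0 - 1))"
      using q k by (simp add: mult_left_mono_neg)
    also have "ln q * (v / t0 - 1) = - \<delta> * v - ln q"
      using t0 by (simp add: \<delta>_def field_simps)
    also have "exp (- \<delta> * v - ln q) = exp (- \<delta> * v) / q"
      using q by (simp add: exp_diff)
    finally show ?thesis using M by (simp add: mult_ac)
  qed
  moreover have "M / q > 0" using M q by simp
  ultimately show thesis using \<delta> that[of "M / q" \<delta>] by simp
qed

section \<open>Improper integrals and nuclear bounds\<close>

lemma integral_Icc_tendsto_Ici:
  fixes f :: "real \<Rightarrow> 'b::banach"
  assumes "f integrable_on {y..}"
  shows "((\<lambda>n. integral {y..y + real n} f) \<longlonglongrightarrow> integral {y..} f)"
proof (rule LIMSEQ_I)
  fix e :: real assume e: "e > 0"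
  have not: "\<not> (\<exists>a b. {y..} = cbox a b)"
  proof
    assume "\<exists>a b. {y..} = cbox a b"
    then obtain a b where ab: "{y..} = cbox a b" by (elim exE)
    have "max y (b + 1) \<in> {y..}" by simp
    then show False unfolding ab by simp
  qed
  obtain R where R: "R > 0" "\<forall>a b. ball 0 R \<subseteq> cbox a b \<longrightarrow>
      (\<exists>z. ((\<lambda>x. if x \<in> {y..} then f x else 0) has_integral z) (cbox a b) \<and> norm (z - integral {y..} f) < e)"
    using has_integral_altD[OF integrable_integral[OF assms] not e] by metis
  obtain N :: nat where N: "R + \<bar>y\<bar> \<le> real N" using real_arch_simple[of "R + \<bar>y\<bar>"] by (elim exE)
  have "norm (integral {y..y + real n} f - integral {y..} f) < e" if n: "n \<ge> N" for n
  proof -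
    let ?a = "min (- R) y" and ?b = "y + real n"
    have "R + \<bar>y\<bar> \<le> real n" using N n by linarith
    then have "ball 0 R \<subseteq> cbox ?a ?b" by (auto simp: dist_real_def)
    then obtain z where z: "((\<lambda>x. if x \<in> {y..} then f x else 0) has_integral z) (cbox ?a ?b)"
      "norm (z - integral {y..} f) < e"
      using R(2) by metis
    have "{y..} \<inter> cbox ?a ?b = {y..y + real n}" by auto
    then have "(f has_integral z) {y..y + real n}"
      using z(1) unfolding has_integral_restrict_Int by simp
    then show ?thesis using z(2) by (simp add: integral_unique)
  qed
  then show "\<exists>N. \<forall>n\<ge>N. norm (integral {y..y + real n} f - integral {y..} f) < e"
    by (intro exI allI impI)
qed

lemma nuclear_scaleR:
  assumes "nuclear K \<nu>" "r \<ge> 0"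
  shows "nuclear (r *\<^sub>R K) (r * \<nu>)"
proof -
  have "norm (r *\<^sub>R id_blinfun :: 'a \<Rightarrow>\<^sub>L 'a) * norm (id_blinfun :: 'a \<Rightarrow>\<^sub>L 'a) \<le> r * 1 * 1"
    unfolding norm_scaleR using assms(2) norm_id_le[where 'a = 'a] by (intro mult_mono) auto
  then have le: "norm (r *\<^sub>R id_blinfun :: 'a \<Rightarrow>\<^sub>L 'a) * norm (id_blinfun :: 'a \<Rightarrow>\<^sub>L 'a) * \<nu> \<le> r * \<nu>"
    using nuclear_nonneg[OF assms(1)] by (intro mult_right_mono) auto
  have "nuclear ((r *\<^sub>R id_blinfun) o\<^sub>L K o\<^sub>L id_blinfun)
      (norm (r *\<^sub>R id_blinfun :: 'a \<Rightarrow>\<^sub>L 'a) * norm (id_blinfun :: 'a \<Rightarrow>\<^sub>L 'a) * \<nu>)"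
    by (intro nuclear_compose assms clinear_op_scaleR clinear_op_id)
  then show ?thesis using nuclear_mono[OF _ le] by (simp add: comp_scaleR_left)
qed

lemma nuclear_sum:
  assumes "\<And>i. i \<in> I \<Longrightarrow> nuclear (K i) (\<nu> i)"
  shows "nuclear (\<Sum>i\<in>I. K i) (\<Sum>i\<in>I. \<nu> i)"
  using assms
proof (induction I rule: infinite_finite_induct)
  case (insert i I)
  then show ?case by (simp add: nuclear_add)
qed (auto intro: nuclear_finite_rank finite_rank.zero)

lemma finite_rank_clinear: "finite_rank K \<nu> \<Longrightarrow> clinear_op K"
  by (induction rule: finite_rank.induct) (auto intro: clinear_op_add clinear_op_compose)

text \<open>Complex linearity of the integrals follows from this, since the defining closure only contains limits of complex-linear
operators.\<close>

lemma nuclear_clinear: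
  assumes "nuclear K \<nu>"
  shows "clinear_op K"
  unfolding clinear_op_def
proof (intro allI)
  fix c x
  obtain k where k: "\<And>n. finite_rank (k n) \<nu>" "k \<longlonglongrightarrow> K"
    using assms by (metis nuclear_sequence)
  have "(\<lambda>n. blinfun_apply (k n) (c *\<^sub>C x)) \<longlonglongrightarrow> blinfun_apply K (c *\<^sub>C x)"
    by (rule bounded_linear.tendsto[OF blinfun.bounded_linear_left k(2)])
  moreover have "(\<lambda>n. c *\<^sub>C blinfun_apply (k n) x) \<longlonglongrightarrow> (c *\<^sub>C blinfun_apply K x)"
    by (intro bounded_linear.tendsto[OF bounded_linear_scaleC]
        bounded_linear.tendsto[OF blinfun.bounded_linear_left k(2)])
  ultimately show "blinfun_apply K (c *\<^sub>C x) = c *\<^sub>C blinfun_apply K x"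
    unfolding clinear_opD[OF finite_rank_clinear[OF k(1)]] by (rule LIMSEQ_unique)
qed

text \<open>A Riemann sum of \<open>f\<close> is nuclear with the corresponding Riemann sum of \<open>g\<close> as bound. Divisions that are fine for both
integrals at once give sums for \<open>g\<close> below \<open>G + 1\<close>, and sums for \<open>f\<close> arbitrarily close to \<open>I\<close>.\<close>

lemma nuclear_has_integral:
  fixes f :: "real \<Rightarrow> ('h::complex_hilbert \<Rightarrow>\<^sub>L 'h)"
  assumes f: "(f has_integral I) {a..b}" and g: "(g has_integral G) {a..b}"
    and fg: "\<And>v. v \<in> {a..b} \<Longrightarrow> nuclear (f v) (g v)"
  shows "nuclear I (G + 1)"
proof (rule nuclear_limit)
  fix e :: real assume "e > 0"
  then obtain \<gamma> where \<gamma>: "gauge \<gamma>" "\<forall>\<D>. \<D> tagged_division_of {a..b} \<and> \<gamma> fine \<D> \<longrightarrow>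
      norm ((\<Sum>(x, k)\<in>\<D>. measure lborel k *\<^sub>R f x) - I) < e"
    using f unfolding has_integral_real by metis
  obtain \<gamma>' where \<gamma>': "gauge \<gamma>'" "\<forall>\<D>. \<D> tagged_division_of {a..b} \<and> \<gamma>' fine \<D> \<longrightarrow>
      norm ((\<Sum>(x, k)\<in>\<D>. measure lborel k *\<^sub>R g x) - G) < 1"
    using g zero_less_one unfolding has_integral_real by metis
  obtain p where p: "p tagged_division_of {a..b}" "(\<lambda>x. \<gamma> x \<inter> \<gamma>' x) fine p"
    by (rule fine_division_exists_real[OF gauge_Int[OF \<gamma>(1) \<gamma>'(1)]]) (rule that)
  have fine: "\<gamma> fine p" "\<gamma>' fine p" using p(2) by (auto simp: fine_Int)
  let ?L = "\<Sum>(x, k)\<in>p. measure lborel k *\<^sub>R f x"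
  have "nuclear (\<Sum>i\<in>p. measure lborel (snd i) *\<^sub>R f (fst i)) (\<Sum>i\<in>p. measure lborel (snd i) * g (fst i))"
  proof (rule nuclear_sum)
    fix i assume i: "i \<in> p"
    then have "fst i \<in> snd i" "snd i \<subseteq> {a..b}"
      using tagged_division_ofD(2,3)[OF p(1), of "fst i" "snd i"] by simp_all
    then have "fst i \<in> {a..b}" by (rule subsetD[rotated])
    then show "nuclear (measure lborel (snd i) *\<^sub>R f (fst i)) (measure lborel (snd i) * g (fst i))"
      by (intro nuclear_scaleR fg) auto
  qed
  then have "nuclear ?L (\<Sum>(x, k)\<in>p. measure lborel k *\<^sub>R g x)"
    by (simp add: case_prod_beta)
  moreover have "norm ((\<Sum>(x, k)\<in>p. measure lborel k *\<^sub>R g x) - G) < 1"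
    using \<gamma>'(2) p(1) fine by simp
  then have "(\<Sum>(x, k)\<in>p. measure lborel k *\<^sub>R g x) \<le> G + 1" by (simp add: abs_less_iff)
  ultimately have "nuclear ?L (G + 1)" by (rule nuclear_mono)
  moreover have "norm (?L - I) < e" using \<gamma>(2) p(1) fine by simp
  ultimately show "\<exists>L. nuclear L (G + 1) \<and> norm (L - I) < e" by (intro exI[of _ ?L] conjI)
qed

section \<open>The integral operator and its Sylvester equation\<close>

text \<open>The contractivity hypotheses make both semigroups decay exponentially, so the integral that defines \<open>R\<close> converges at
infinity.\<close>

locale admissible_pair =
  fixes A1 A2 :: "'h::complex_hilbert \<Rightarrow>\<^sub>L 'h" and B :: "complex \<Rightarrow>\<^sub>L 'h" and C :: "'h \<Rightarrow>\<^sub>L complex"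
  assumes lin: "clinear_op A1" "clinear_op A2" "clinear_op B" "clinear_op C"
    and contr1: "\<exists>t0>0. norm (exp_neg A1 t0) < 1" and contr2: "\<exists>t0>0. norm (exp_neg A2 t0) < 1"
begin

definition integrand :: "real \<Rightarrow> ('h \<Rightarrow>\<^sub>L 'h)" where
  "integrand v = exp_neg A2 v o\<^sub>L B o\<^sub>L C o\<^sub>L exp_neg A1 v"

abbreviation "R \<equiv> R_op A1 A2 B C"

lemma R_eq: "R y = integral {y..} integrand"
  by (simp add: R_op_def integrand_def[abs_def] exp_neg_def)

lemma continuous_on_integrand: "continuous_on S integrand"
  unfolding integrand_def[abs_def]
  by (intro bounded_bilinear.continuous_on[OF bounded_bilinear_blinfun_compose] continuous_on_exp_neg
      continuous_on_const)

lemma integrand_bound: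
  obtains M \<delta> where "\<delta> > 0" "\<And>v. v \<ge> 0 \<Longrightarrow> norm (exp_neg A2 v o\<^sub>L B) * norm (C o\<^sub>L exp_neg A1 v) \<le> M * exp (- \<delta> * v)"
proof -
  obtain M1 \<delta>1 where 1: "M1 > 0" "\<delta>1 > 0" "\<And>v. v \<ge> 0 \<Longrightarrow> norm (exp_neg A1 v) \<le> M1 * exp (- \<delta>1 * v)"
    by (rule exp_neg_decay[OF contr1]) (rule that)
  obtain M2 \<delta>2 where 2: "M2 > 0" "\<delta>2 > 0" "\<And>v. v \<ge> 0 \<Longrightarrow> norm (exp_neg A2 v) \<le> M2 * exp (- \<delta>2 * v)"
    by (rule exp_neg_decay[OF contr2]) (rule that)
  have "norm (exp_neg A2 v o\<^sub>L B) * norm (C o\<^sub>L exp_neg A1 v) \<le> (M2 * norm B * (norm C * M1)) * exp (- (\<delta>2 + \<delta>1) * v)"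
    if v: "v \<ge> 0" for v
  proof -
    have "norm (exp_neg A2 v o\<^sub>L B) * norm (C o\<^sub>L exp_neg A1 v) \<le> (norm (exp_neg A2 v) * norm B) * (norm C * norm (exp_neg A1 v))"
      by (intro mult_mono norm_blinfun_compose) auto
    also have "\<dots> \<le> ((M2 * exp (- \<delta>2 * v)) * norm B) * (norm C * (M1 * exp (- \<delta>1 * v)))"
      by (rule mult_mono; (rule mult_right_mono mult_left_mono)?) (use 1 2 v in auto)
    also have "\<dots> = (M2 * norm B * (norm C * M1)) * exp (- (\<delta>2 + \<delta>1) * v)"
    proof -
      have "exp (- (\<delta>2 + \<delta>1) * v) = exp (- \<delta>2 * v) * exp (- \<delta>1 * v)"
        by (simp add: exp_add[symmetric] algebra_simps)
      then show ?thesis by (simp only: mult_ac)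
    qed
    finally show ?thesis .
  qed
  moreover have "\<delta>2 + \<delta>1 > 0" using 1 2 by simp
  ultimately show thesis by (rule that[rotated])
qed

lemma norm_integrand_le: "norm (integrand v) \<le> norm (exp_neg A2 v o\<^sub>L B) * norm (C o\<^sub>L exp_neg A1 v)"
  unfolding integrand_def comp_assoc[of "exp_neg A2 v o\<^sub>L B"] by (rule norm_blinfun_compose)

lemma nuclear_integrand: "nuclear (integrand v) (norm (exp_neg A2 v o\<^sub>L B) * norm (C o\<^sub>L exp_neg A1 v))"
  unfolding integrand_def comp_assoc[of "exp_neg A2 v o\<^sub>L B"]
  by (intro nuclear_finite_rank finite_rank_rank_one clinear_op_compose clinear_exp_neg lin)

lemma integrand_integrable:
  assumes "y \<ge> 0"
  shows "integrand integrable_on {y..}"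
proof -
  obtain M \<delta> where M: "\<delta> > 0"
    "\<And>v. v \<ge> 0 \<Longrightarrow> norm (exp_neg A2 v o\<^sub>L B) * norm (C o\<^sub>L exp_neg A1 v) \<le> M * exp (- \<delta> * v)"
    by (rule integrand_bound) (rule that)
  show ?thesis
  proof (rule integrable_on_all_intervals_integrable_bound)
    fix a b
    have "{y..} \<inter> cbox a b = {max y a..b}" by auto
    then show "(\<lambda>x. if x \<in> {y..} then integrand x else 0) integrable_on cbox a b"
      unfolding integrable_restrict_Int
      by (simp add: integrable_continuous_interval continuous_on_integrand)
  next
    show "norm (integrand x) \<le> M * exp (- \<delta> * x)" if "x \<in> {y..}" for x
      using norm_integrand_le[of x] M(2)[of x] that assms by simp
    show "(\<lambda>x. M * exp (- \<delta> * x)) integrable_on {y..}"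
      by (intro integrable_on_mult_right integrable_on_exp_minus_to_infinity M(1))
  qed
qed

lemma integral_integrand_tendsto: "y \<ge> 0 \<Longrightarrow> (\<lambda>n. integral {y..y + real n} integrand) \<longlonglongrightarrow> R y"
  unfolding R_eq by (intro integral_Icc_tendsto_Ici integrand_integrable)

lemma exp_neg_tendsto_zero:
  assumes "\<exists>t0>0. norm (exp_neg A t0) < 1"
  shows "(\<lambda>n. exp_neg A (y + real n)) \<longlonglongrightarrow> 0"
proof -
  obtain M \<delta> where M: "M > 0" "\<delta> > 0" "\<And>v. v \<ge> 0 \<Longrightarrow> norm (exp_neg A v) \<le> M * exp (- \<delta> * v)"
    by (rule exp_neg_decay[OF assms]) (rule that)
  have "(\<lambda>n. exp_neg A (real n)) \<longlonglongrightarrow> 0"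
  proof (rule Lim_null_comparison)
    show "\<forall>\<^sub>F n in sequentially. norm (exp_neg A (real n)) \<le> M * exp (- \<delta>) ^ n"
      by (rule always_eventually) (use M(3) in \<open>simp add: exp_of_nat2_mult[symmetric]\<close>)
    show "(\<lambda>n. M * exp (- \<delta>) ^ n) \<longlonglongrightarrow> 0"
      using M(2) by (intro tendsto_mult_right_zero LIMSEQ_power_zero) simp
  qed
  from tendsto_comp[OF tendsto_const this, of "exp_neg A y"] show ?thesis
    by (simp add: exp_neg_add)
qed

lemma integrand_tendsto_zero: "(\<lambda>n. integrand (y + real n)) \<longlonglongrightarrow> 0"
proof -
  have "(\<lambda>n. integrand (y + real n)) \<longlonglongrightarrow> (0 o\<^sub>L B o\<^sub>L C o\<^sub>L 0)"
    unfolding integrand_def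
    by (intro tendsto_comp tendsto_const exp_neg_tendsto_zero contr1 contr2)
  then show ?thesis by simp
qed

text \<open>Differentiating \<open>exp (-v A2) K exp (-v A1)\<close> produces the Sylvester operator applied to \<open>K\<close>. With \<open>K = B C\<close> this gives the
Sylvester equation for \<open>R 0\<close>; with \<open>K = R 0\<close> it shows that the integrand of \<open>R\<close> has an elementary primitive.\<close>

lemma sandwich_has_vector_derivative:
  "((\<lambda>v. exp_neg A2 v o\<^sub>L K o\<^sub>L exp_neg A1 v) has_vector_derivative
     - (exp_neg A2 v o\<^sub>L ((A2 o\<^sub>L K) + (K o\<^sub>L A1)) o\<^sub>L exp_neg A1 v)) (at v)"
proof -
  have c2: "A2 o\<^sub>L exp_neg A2 v = exp_neg A2 v o\<^sub>L A2" by (rule exp_neg_commute) simp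
  have "((\<lambda>v. (exp_neg A2 v o\<^sub>L K) o\<^sub>L exp_neg A1 v) has_vector_derivative
      ((exp_neg A2 v o\<^sub>L K) o\<^sub>L (- (A1 o\<^sub>L exp_neg A1 v))) + ((- (A2 o\<^sub>L exp_neg A2 v) o\<^sub>L K) o\<^sub>L exp_neg A1 v)) (at v)"
    by (intro has_vector_derivative_comp exp_neg_has_vector_derivative
      bounded_linear.has_vector_derivative[OF bounded_linear_comp_left])
  also have "((exp_neg A2 v o\<^sub>L K) o\<^sub>L (- (A1 o\<^sub>L exp_neg A1 v))) + ((- (A2 o\<^sub>L exp_neg A2 v) o\<^sub>L K) o\<^sub>L exp_neg A1 v) =
      - (exp_neg A2 v o\<^sub>L ((A2 o\<^sub>L K) + (K o\<^sub>L A1)) o\<^sub>L exp_neg A1 v)"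
    unfolding c2
    by (simp add: comp_minus_left comp_minus_right comp_add_left comp_add_right comp_assoc)
  finally show ?thesis .
qed

lemma integrand_eq: "integrand v = exp_neg A2 v o\<^sub>L (B o\<^sub>L C) o\<^sub>L exp_neg A1 v"
  by (simp add: integrand_def comp_assoc)

text \<open>The left-hand side is minus the integral over \<open>(0, \<infinity>)\<close> of the derivative of the integrand.\<close>

lemma sylvester_zero: "(A2 o\<^sub>L R 0) + (R 0 o\<^sub>L A1) = B o\<^sub>L C"
proof -
  let ?I = "\<lambda>n. integral {0..0 + real n} integrand"
  have eq: "- ((A2 o\<^sub>L ?I n) + (?I n o\<^sub>L A1)) = integrand (real n) - integrand 0" for n
  proof -
    have "(integrand has_integral ?I n) {0..0 + real n}"
      by (intro integrable_integral integrable_continuous_interval continuous_on_integrand)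
    then have "((\<lambda>v. - ((A2 o\<^sub>L integrand v) + (integrand v o\<^sub>L A1))) has_integral - ((A2 o\<^sub>L ?I n) + (?I n o\<^sub>L A1))) {0..0 + real n}"
      by (intro has_integral_neg has_integral_add
          has_integral_linear[OF _ bounded_linear_comp_left, unfolded o_def]
          has_integral_linear[OF _ bounded_linear_comp_right, unfolded o_def])
    moreover have "((\<lambda>v. - ((A2 o\<^sub>L integrand v) + (integrand v o\<^sub>L A1))) has_integral integrand (real n) - integrand 0) {0..real n}"
    proof (rule fundamental_theorem_of_calculus)
      fix v
      have c2: "A2 o\<^sub>L exp_neg A2 v = exp_neg A2 v o\<^sub>L A2" by (rule exp_neg_commute) simp
      have c1: "A1 o\<^sub>L exp_neg A1 v = exp_neg A1 v o\<^sub>L A1" by (rule exp_neg_commute) simp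
      have "exp_neg A2 v o\<^sub>L ((A2 o\<^sub>L (B o\<^sub>L C)) + ((B o\<^sub>L C) o\<^sub>L A1)) o\<^sub>L exp_neg A1 v = (A2 o\<^sub>L integrand v) + (integrand v o\<^sub>L A1)"
        unfolding integrand_eq by (simp add: comp_add_left comp_add_right c1 comp_assoc)
          (simp add: comp_assoc[symmetric] c2)
      then show "(integrand has_vector_derivative - ((A2 o\<^sub>L integrand v) + (integrand v o\<^sub>L A1))) (at v within {0..real n})"
        using sandwich_has_vector_derivative[of "B o\<^sub>L C" v]
        unfolding integrand_eq[abs_def, symmetric] by (simp add: has_vector_derivative_at_within)
    qed simp
    ultimately show ?thesis by (simp add: has_integral_unique)
  qed
  have "(\<lambda>n. - ((A2 o\<^sub>L ?I n) + (?I n o\<^sub>L A1))) \<longlonglongrightarrow> - ((A2 o\<^sub>L R 0) + (R 0 o\<^sub>L A1))"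
    by (intro tendsto_minus tendsto_add tendsto_comp tendsto_const integral_integrand_tendsto order_refl)
  moreover have "(\<lambda>n. - ((A2 o\<^sub>L ?I n) + (?I n o\<^sub>L A1))) \<longlonglongrightarrow> 0 - integrand 0"
    unfolding eq using integrand_tendsto_zero[of 0] by (intro tendsto_diff tendsto_const) simp
  ultimately have "- ((A2 o\<^sub>L R 0) + (R 0 o\<^sub>L A1)) = 0 - integrand 0"
    by (rule LIMSEQ_unique)
  then have "(A2 o\<^sub>L R 0) + (R 0 o\<^sub>L A1) = integrand 0"
    by (simp only: diff_0 neg_equal_iff_equal)
  then show ?thesis by (simp add: integrand_eq)
qed

text \<open>By the Sylvester equation \<open>- exp (-v A2) (R 0) exp (-v A1)\<close> is a primitive of the integrand, and it tends to zero at
infinity.\<close>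

lemma R_eq_sandwich:
  assumes "y \<ge> 0"
  shows "R y = exp_neg A2 y o\<^sub>L R 0 o\<^sub>L exp_neg A1 y"
proof -
  let ?G = "\<lambda>v. exp_neg A2 v o\<^sub>L R 0 o\<^sub>L exp_neg A1 v"
  have "(integrand has_integral (- ?G (y + real n) - - ?G y)) {y..y + real n}" for n
  proof (rule fundamental_theorem_of_calculus)
    fix v
    have "((\<lambda>v. - ?G v) has_vector_derivative integrand v) (at v)"
      using has_vector_derivative_minus[OF sandwich_has_vector_derivative[of "R 0" v]]
      by (simp add: sylvester_zero integrand_eq)
    then show "((\<lambda>v. - ?G v) has_vector_derivative integrand v) (at v within {y..y + real n})"
      by (rule has_vector_derivative_at_within)
  qed simp
  then have eq: "integral {y..y + real n} integrand = - ?G (y + real n) - - ?G y" for n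
    by (rule integral_unique)
  have "(\<lambda>n. - ?G (y + real n) - - ?G y) \<longlonglongrightarrow> - (0 o\<^sub>L R 0 o\<^sub>L 0) - - ?G y"
    by (intro tendsto_diff tendsto_minus tendsto_comp tendsto_const exp_neg_tendsto_zero contr1 contr2)
  then have "(\<lambda>n. integral {y..y + real n} integrand) \<longlonglongrightarrow> ?G y"
    unfolding eq by simp
  with integral_integrand_tendsto[OF assms] show ?thesis by (rule LIMSEQ_unique)
qed

lemma sylvester:
  assumes "y \<ge> 0"
  shows "(A2 o\<^sub>L R y) + (R y o\<^sub>L A1) = (exp_neg A2 y o\<^sub>L B) o\<^sub>L (C o\<^sub>L exp_neg A1 y)"
proof -
  have c2: "A2 o\<^sub>L exp_neg A2 y = exp_neg A2 y o\<^sub>L A2" by (rule exp_neg_commute) simp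
  have c1: "A1 o\<^sub>L exp_neg A1 y = exp_neg A1 y o\<^sub>L A1" by (rule exp_neg_commute) simp
  have "(A2 o\<^sub>L R y) + (R y o\<^sub>L A1) = exp_neg A2 y o\<^sub>L ((A2 o\<^sub>L R 0) + (R 0 o\<^sub>L A1)) o\<^sub>L exp_neg A1 y"
    unfolding R_eq_sandwich[OF assms]
    by (simp add: comp_add_left comp_add_right c1 comp_assoc) (simp add: comp_assoc[symmetric] c2)
  then show ?thesis by (simp add: sylvester_zero comp_assoc)
qed

text \<open>The integral over \<open>[0, n]\<close> has trace norm at most the integral of an exponential, uniformly in \<open>n\<close>.\<close>

lemma nuclear_R_zero: "\<exists>\<nu>. nuclear (R 0) \<nu>"
proof -
  obtain M \<delta> where M: "\<delta> > 0"
    "\<And>v. v \<ge> 0 \<Longrightarrow> norm (exp_neg A2 v o\<^sub>L B) * norm (C o\<^sub>L exp_neg A1 v) \<le> M * exp (- \<delta> * v)"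
    by (rule integrand_bound) (rule that)
  let ?g = "\<lambda>v. M * exp (- \<delta> * v)"
  have int: "?g integrable_on {0..}"
    by (intro integrable_on_mult_right integrable_on_exp_minus_to_infinity M(1))
  have pos: "?g v \<ge> 0" if "v \<ge> 0" for v
    using M(2)[OF that] by (rule order_trans[rotated]) simp
  have I: "nuclear (integral {0..0 + real n} integrand) (integral {0..} ?g + 1)" for n
  proof -
    have nuc: "nuclear (integral {0..0 + real n} integrand) (integral {0..0 + real n} ?g + 1)"
    proof (rule nuclear_has_integral)
      show "(integrand has_integral integral {0..0 + real n} integrand) {0..0 + real n}"
        by (intro integrable_integral integrable_continuous_interval continuous_on_integrand)
      show "(?g has_integral integral {0..0 + real n} ?g) {0..0 + real n}"
        by (intro integrable_integral integrable_continuous_interval continuous_intros)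
      show "nuclear (integrand v) (?g v)" if "v \<in> {0..0 + real n}" for v
        using that by (intro nuclear_mono[OF nuclear_integrand] M(2)) simp
    qed
    have "integral {0..0 + real n} ?g \<le> integral {0..} ?g"
    proof (rule integral_subset_le[OF _ _ int])
      show "?g integrable_on {0..0 + real n}"
        by (intro integrable_continuous_interval continuous_intros)
    qed (use pos in auto)
    then have "integral {0..0 + real n} ?g + 1 \<le> integral {0..} ?g + 1"
      by (rule add_right_mono)
    with nuc show ?thesis by (rule nuclear_mono)
  qed
  have "nuclear (R 0) (integral {0..} ?g + 1)"
  proof (rule nuclear_limit)
    fix e :: real assume "e > 0"
    from LIMSEQ_D[OF integral_integrand_tendsto[OF order_refl] this]
    obtain n where "\<forall>m\<ge>n. norm (integral {0..0 + real m} integrand - R 0) < e" by (elim exE)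
    then have "norm (integral {0..0 + real n} integrand - R 0) < e" by simp
    then show "\<exists>L. nuclear L (integral {0..} ?g + 1) \<and> norm (L - R 0) < e"
      using I[of n] by (intro exI[of _ "integral {0..0 + real n} integrand"] conjI)
  qed
  then show ?thesis by (rule exI)
qed

lemma clinear_R:
  assumes "y \<ge> 0"
  shows "clinear_op (R y)"
proof -
  obtain \<nu> where "nuclear (R 0) \<nu>" using nuclear_R_zero by (elim exE)
  then show ?thesis
    by (subst R_eq_sandwich[OF assms]) (intro clinear_op_compose clinear_exp_neg lin nuclear_clinear)
qed

end

section \<open>Miwa shifts\<close>

text \<open>The \<open>j\<close>-th term of the series in the exponents of \<open>V(t)\<close> and, for \<open>- A\<close> in place of \<open>A\<close>, of \<open>W(t)\<close>.\<close>

definition time_series :: "('h::complex_hilbert \<Rightarrow>\<^sub>L 'h) \<Rightarrow> (nat \<Rightarrow> complex) \<Rightarrow> nat \<Rightarrow> ('h \<Rightarrow>\<^sub>L 'h)" where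
  "time_series A t j = scaleC_op (t (Suc j)) (op_pow A (Suc j))"

lemma V_op_eq: "V_op A t = op_exp (suminf (time_series A t))"
  by (simp add: V_op_def time_series_def[abs_def])

lemma W_op_eq: "W_op A t = op_exp (- suminf (time_series (- A) t))"
  by (simp add: W_op_def time_series_def[abs_def])

lemma summable_time_series_C0:
  assumes "t \<in> C0_inf"
  shows "summable (time_series A t)"
proof (rule summable_comparison_test_ev)
  define c where "c = 1 / (2 * (norm A + 1))"
  have pos: "norm A + 1 > 0" using norm_ge_zero[of A] by linarith
  have c: "c > 0" "c * norm A \<le> 1 / 2"
    using pos by (auto simp: c_def divide_simps)
  have "(\<lambda>j. root j (cmod (t j))) \<longlonglongrightarrow> 0" using assms by (simp add: C0_inf_def)
  then have "\<forall>\<^sub>F j in sequentially. root j (cmod (t j)) < c"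
    using c(1) by (rule order_tendstoD(2))
  then have "\<forall>\<^sub>F j in sequentially. root (Suc j) (cmod (t (Suc j))) < c"
    by (rule eventually_sequentially_Suc[THEN iffD2])
  then show "\<forall>\<^sub>F j in sequentially. norm (time_series A t j) \<le> (1 / 2) ^ Suc j"
  proof (rule eventually_mono)
    fix j assume r: "root (Suc j) (cmod (t (Suc j))) < c"
    have "cmod (t (Suc j)) = root (Suc j) (cmod (t (Suc j))) ^ Suc j"
      by (rule real_root_pow_pos2[symmetric]) auto
    also have "\<dots> \<le> c ^ Suc j"
      using r by (intro power_mono) auto
    finally have tc: "cmod (t (Suc j)) \<le> c ^ Suc j" .
    have "norm (time_series A t j) \<le> cmod (t (Suc j)) * norm (op_pow A (Suc j))"
      unfolding time_series_def by (rule norm_scaleC_op)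
    also have "\<dots> \<le> c ^ Suc j * norm A ^ Suc j"
      using tc c by (intro mult_mono norm_op_pow_le) auto
    also have "\<dots> = (c * norm A) ^ Suc j" by (simp only: power_mult_distrib)
    also have "\<dots> \<le> (1 / 2) ^ Suc j"
      using c by (intro power_mono) auto
    finally show "norm (time_series A t j) \<le> (1 / 2) ^ Suc j" .
  qed
  show "summable (\<lambda>j. (1 / 2 :: real) ^ Suc j)"
    by (subst summable_Suc_iff) (rule summable_geometric, simp)
qed

lemma time_series_add: "time_series A (\<lambda>j. t j + u j) = (\<lambda>j. time_series A t j + time_series A u j)"
  by (simp add: time_series_def[abs_def] scaleC_op_add_left)

text \<open>The times \<open>[s]\<close> turn the series of the exponent into the logarithmic series of \<open>s A\<close>.\<close>

lemma time_series_miwa: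
  assumes "clinear_op A"
  shows "time_series A (miwa s) = (\<lambda>j. op_pow (scaleC_op s A) (Suc j) /\<^sub>R real (Suc j))"
proof
  fix j
  have "op_pow (scaleC_op s A) (Suc j) /\<^sub>R real (Suc j) =
      scaleC_op (of_real (inverse (real (Suc j)))) (scaleC_op (s ^ Suc j) (op_pow A (Suc j)))"
    by (simp only: op_pow_scaleC[OF assms] scaleC_op_of_real)
  also have "\<dots> = time_series A (miwa s) j"
    by (simp add: time_series_def scaleC_op_scaleC_op miwa_def divide_inverse mult.commute del: op_pow_Suc)
  finally show "time_series A (miwa s) j = op_pow (scaleC_op s A) (Suc j) /\<^sub>R real (Suc j)" ..
qed

lemma norm_scaleC_op_less_one: "cmod s * norm A < 1 \<Longrightarrow> norm (scaleC_op s A) < 1"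
  using norm_scaleC_op[of s A] by linarith

lemma summable_time_series_miwa:
  "clinear_op A \<Longrightarrow> cmod s * norm A < 1 \<Longrightarrow> summable (time_series A (miwa s))"
  unfolding time_series_miwa by (intro summable_op_log norm_scaleC_op_less_one)

lemma suminf_time_series_miwa:
  "clinear_op A \<Longrightarrow> suminf (time_series A (miwa s)) = op_log (scaleC_op s A)"
  by (simp only: time_series_miwa op_log_def)

lemma time_series_commute:
  assumes "summable (time_series A t)" "clinear_op S" "S o\<^sub>L A = A o\<^sub>L S"
  shows "S o\<^sub>L suminf (time_series A t) = suminf (time_series A t) o\<^sub>L S"
proof -
  have c: "S o\<^sub>L time_series A t j = time_series A t j o\<^sub>L S" for j
    by (simp only: time_series_def scaleC_op_comp_left scaleC_op_comp_right[OF assms(2)]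
        op_pow_commute[OF assms(3)])
  have "S o\<^sub>L suminf (time_series A t) = (\<Sum>j. S o\<^sub>L time_series A t j)"
    by (rule bounded_linear.suminf[OF bounded_linear_comp_right assms(1)])
  also have "\<dots> = (\<Sum>j. time_series A t j o\<^sub>L S)" by (simp only: c)
  also have "\<dots> = suminf (time_series A t) o\<^sub>L S"
    by (rule bounded_linear.suminf[OF bounded_linear_comp_left assms(1), symmetric])
  finally show ?thesis .
qed

lemma clinear_time_series:
  assumes "summable (time_series A t)" "clinear_op A"
  shows "clinear_op (suminf (time_series A t))"
  by (rule clinear_op_sums[OF _ summable_sums[OF assms(1)]])
    (simp only: time_series_def clinear_op_scaleC clinear_op_pow[OF assms(2)])

lemma W_op_commute:
  assumes "summable (time_series (- A) t)" "clinear_op S" "S o\<^sub>L A = A o\<^sub>L S"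
  shows "S o\<^sub>L W_op A t = W_op A t o\<^sub>L S"
proof -
  have "S o\<^sub>L (- A) = (- A) o\<^sub>L S" by (simp only: comp_minus_left comp_minus_right assms(3))
  then have "S o\<^sub>L suminf (time_series (- A) t) = suminf (time_series (- A) t) o\<^sub>L S"
    by (rule time_series_commute[OF assms(1,2)])
  then show ?thesis
    unfolding W_op_eq by (intro op_exp_commute) (simp only: comp_minus_left comp_minus_right)
qed

lemma clinear_V_op: "summable (time_series A t) \<Longrightarrow> clinear_op A \<Longrightarrow> clinear_op (V_op A t)"
  unfolding V_op_eq by (intro clinear_op_exp clinear_time_series)

lemma clinear_W_op: "summable (time_series (- A) t) \<Longrightarrow> clinear_op A \<Longrightarrow> clinear_op (W_op A t)"
  unfolding W_op_eq by (intro clinear_op_exp clinear_op_minus clinear_time_series)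

text \<open>The inverse of \<open>I - s A\<close>, given as the exponential of a logarithm because it arises as the factor that a Miwa shift
contributes to \<open>V(t)\<close>.\<close>

definition neumann :: "('h::complex_hilbert \<Rightarrow>\<^sub>L 'h) \<Rightarrow> complex \<Rightarrow> ('h \<Rightarrow>\<^sub>L 'h)" where
  "neumann A s = op_exp (op_log (scaleC_op s A))"

lemma neumann_right: "cmod s * norm A < 1 \<Longrightarrow> (id_blinfun - scaleC_op s A) o\<^sub>L neumann A s = id_blinfun"
  unfolding neumann_def by (intro op_exp_log norm_scaleC_op_less_one)

lemma neumann_commute:
  assumes "clinear_op A" "cmod s * norm A < 1" "clinear_op S" "S o\<^sub>L A = A o\<^sub>L S"
  shows "S o\<^sub>L neumann A s = neumann A s o\<^sub>L S"
  unfolding neumann_def suminf_time_series_miwa[OF assms(1), symmetric]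
  by (intro op_exp_commute time_series_commute summable_time_series_miwa assms)

lemma neumann_left:
  assumes "clinear_op A" "cmod s * norm A < 1"
  shows "neumann A s o\<^sub>L (id_blinfun - scaleC_op s A) = id_blinfun"
proof -
  have "(id_blinfun - scaleC_op s A) o\<^sub>L neumann A s = neumann A s o\<^sub>L (id_blinfun - scaleC_op s A)"
    by (rule neumann_commute[OF assms])
      (simp_all add: clinear_op_diff clinear_op_scaleC assms comp_diff_left comp_diff_right
        scaleC_op_comp_left scaleC_op_comp_right)
  then show ?thesis using neumann_right[OF assms(2)] by simp
qed

lemma clinear_neumann: "clinear_op A \<Longrightarrow> cmod s * norm A < 1 \<Longrightarrow> clinear_op (neumann A s)"
  unfolding neumann_def suminf_time_series_miwa[symmetric]
  by (intro clinear_op_exp clinear_time_series summable_time_series_miwa)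

lemma V_op_shift:
  assumes "clinear_op A" "summable (time_series A t)" "cmod s * norm A < 1"
  shows "V_op A (\<lambda>j. t j + miwa s j) = V_op A t o\<^sub>L neumann A s"
proof -
  let ?S = "suminf (time_series A t)" and ?M = "suminf (time_series A (miwa s))"
  note sm = summable_time_series_miwa[OF assms(1,3)]
  have SA: "A o\<^sub>L ?S = ?S o\<^sub>L A" by (rule time_series_commute[OF assms(2,1) refl])
  have "?S o\<^sub>L ?M = ?M o\<^sub>L ?S"
    by (rule time_series_commute[OF sm clinear_time_series[OF assms(2,1)] SA[symmetric]])
  then show ?thesis
    unfolding V_op_eq time_series_add suminf_add[OF assms(2) sm, symmetric] neumann_def
    by (simp only: op_exp_add suminf_time_series_miwa[OF assms(1)])
qed

text \<open>The exponent of \<open>W\<close> carries the opposite sign and \<open>- A\<close>, so the shift contributes the inverse of \<open>neumann (- A) s\<close>, which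
is \<open>I + s A\<close>.\<close>

lemma W_op_shift:
  assumes "clinear_op A" "summable (time_series (- A) t)" "cmod s * norm A < 1"
  shows "W_op A (\<lambda>j. t j + miwa s j) = W_op A t o\<^sub>L (id_blinfun + scaleC_op s A)"
proof -
  let ?S = "suminf (time_series (- A) t)" and ?M = "suminf (time_series (- A) (miwa s))"
  have A: "clinear_op (- A)" "cmod s * norm (- A) < 1" using assms by (simp_all add: clinear_op_minus)
  note sm = summable_time_series_miwa[OF A]
  have SA: "(- A) o\<^sub>L ?S = ?S o\<^sub>L (- A)" by (rule time_series_commute[OF assms(2) A(1) refl])
  have c: "?S o\<^sub>L ?M = ?M o\<^sub>L ?S"
    by (rule time_series_commute[OF sm clinear_time_series[OF assms(2) A(1)] SA[symmetric]])
  have N: "scaleC_op s (- A) = - scaleC_op s A"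
    using scaleC_op_diff[of s 0 A] scaleC_op_diff[of s A A] by simp
  have "op_exp (- ?M) = ((id_blinfun - scaleC_op s (- A)) o\<^sub>L op_exp ?M) o\<^sub>L op_exp (- ?M)"
    unfolding suminf_time_series_miwa[OF A(1)]
    by (simp only: op_exp_log[OF norm_scaleC_op_less_one[OF A(2)]] comp_id)
  also have "\<dots> = id_blinfun + scaleC_op s A"
    by (simp only: comp_assoc op_exp_minus_right comp_id N) simp
  finally have e: "op_exp (- ?M) = id_blinfun + scaleC_op s A" .
  have "W_op A (\<lambda>j. t j + miwa s j) = op_exp (- ?S + - ?M)"
    unfolding W_op_eq time_series_add suminf_add[OF assms(2) sm, symmetric] by simp
  also have "\<dots> = op_exp (- ?S) o\<^sub>L op_exp (- ?M)"
    by (rule op_exp_add) (simp only: comp_minus_left comp_minus_right c)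
  finally show ?thesis by (simp only: e W_op_eq)
qed

lemma norm_neumann_le:
  assumes "cmod s * norm A < 1"
  shows "norm (neumann A s) \<le> 1 / (1 - cmod s * norm A)"
proof -
  have "neumann A s = id_blinfun + (scaleC_op s A o\<^sub>L neumann A s)"
    using neumann_right[OF assms] by (simp only: comp_diff_left comp_id diff_eq_eq)
  then have "norm (neumann A s) \<le> norm (id_blinfun :: 'a \<Rightarrow>\<^sub>L 'a) + norm (scaleC_op s A o\<^sub>L neumann A s)"
    by (metis norm_triangle_ineq)
  also have "\<dots> \<le> 1 + (cmod s * norm A) * norm (neumann A s)"
  proof (rule add_mono[OF norm_id_le])
    have "norm (scaleC_op s A o\<^sub>L neumann A s) \<le> norm (scaleC_op s A) * norm (neumann A s)"
      by (rule norm_blinfun_compose)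
    also have "\<dots> \<le> (cmod s * norm A) * norm (neumann A s)"
      by (intro mult_right_mono norm_scaleC_op) auto
    finally show "norm (scaleC_op s A o\<^sub>L neumann A s) \<le> (cmod s * norm A) * norm (neumann A s)" .
  qed
  finally have "(1 - cmod s * norm A) * norm (neumann A s) \<le> 1" by (simp add: algebra_simps)
  then show ?thesis using assms by (simp add: field_simps)
qed

text \<open>The resolvent identity in two forms: one makes doubly shifted vectors divided differences of singly shifted ones, the
other gives continuity in the shift.\<close>

lemma neumann_diff:
  assumes "clinear_op A" "cmod s * norm A < 1" "cmod r * norm A < 1"
  shows "scaleC_op (s - r) (neumann A r o\<^sub>L neumann A s) = scaleC_op s (neumann A s) - scaleC_op r (neumann A r)"
    and "neumann A s - neumann A r = scaleC_op (s - r) (neumann A r o\<^sub>L A o\<^sub>L neumann A s)"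
proof -
  let ?s = "neumann A s" and ?r = "neumann A r"
  note lin = clinear_neumann[OF assms(1,2)] clinear_neumann[OF assms(1,3)] assms(1)
  have sl: "?s = id_blinfun + scaleC_op s (A o\<^sub>L ?s)"
    using neumann_right[OF assms(2)] by (simp only: comp_diff_left comp_id diff_eq_eq scaleC_op_comp_left)
  have rl: "?r = id_blinfun + scaleC_op r (?r o\<^sub>L A)"
    using neumann_left[OF assms(1,3)] lin
    by (simp only: comp_diff_right comp_id diff_eq_eq scaleC_op_comp_right)
  have 1: "?r o\<^sub>L ?s = ?r + scaleC_op s (?r o\<^sub>L A o\<^sub>L ?s)"
    by (subst sl) (simp only: comp_add_right comp_id scaleC_op_comp_right[OF lin(2)] comp_assoc)
  have 2: "?r o\<^sub>L ?s = ?s + scaleC_op r (?r o\<^sub>L A o\<^sub>L ?s)"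
    by (subst rl) (simp only: comp_add_left comp_id scaleC_op_comp_left)
  have diff: "scaleC_op (s - r) X = scaleC_op s X - scaleC_op r X" for X :: "'a \<Rightarrow>\<^sub>L 'a"
    using scaleC_op_add_left[of "s - r" r X] by simp
  show "?s - ?r = scaleC_op (s - r) (?r o\<^sub>L A o\<^sub>L ?s)"
    using 1 2 unfolding diff by (simp add: algebra_simps)
  have "scaleC_op s (?r o\<^sub>L ?s) = scaleC_op s ?s + scaleC_op (s * r) (?r o\<^sub>L A o\<^sub>L ?s)"
    by (subst 2) (simp only: scaleC_op_add scaleC_op_scaleC_op)
  moreover have "scaleC_op r (?r o\<^sub>L ?s) = scaleC_op r ?r + scaleC_op (s * r) (?r o\<^sub>L A o\<^sub>L ?s)"
    by (subst 1) (simp only: scaleC_op_add scaleC_op_scaleC_op mult.commute)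
  ultimately show "scaleC_op (s - r) (?r o\<^sub>L ?s) = scaleC_op s ?s - scaleC_op r ?r"
    unfolding diff by simp
qed

lemma tendsto_neumann:
  assumes "clinear_op A" "(s \<longlongrightarrow> r) G" "cmod r * norm A < 1" "\<forall>\<^sub>F z in G. cmod (s z) * norm A < 1"
  shows "((\<lambda>z. neumann A (s z)) \<longlongrightarrow> neumann A r) G"
proof (rule Lim_transform[OF tendsto_const], rule Lim_null_comparison)
  let ?b = "\<lambda>z. cmod (s z - r) * (norm (neumann A r) * norm A * (1 / (1 - cmod (s z) * norm A)))"
  show "\<forall>\<^sub>F z in G. norm (neumann A (s z) - neumann A r) \<le> ?b z"
  proof (rule eventually_mono[OF assms(4)])
    fix z assume z: "cmod (s z) * norm A < 1"
    have "norm (neumann A (s z) - neumann A r) = norm (scaleC_op (s z - r) (neumann A r o\<^sub>L A o\<^sub>L neumann A (s z)))"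
      by (simp only: neumann_diff(2)[OF assms(1) z assms(3)])
    also have "\<dots> \<le> cmod (s z - r) * norm (neumann A r o\<^sub>L A o\<^sub>L neumann A (s z))"
      by (rule norm_scaleC_op)
    also have "\<dots> \<le> ?b z"
    proof (rule mult_left_mono)
      have "norm (neumann A r o\<^sub>L A o\<^sub>L neumann A (s z)) \<le> norm (neumann A r o\<^sub>L A) * norm (neumann A (s z))"
        by (rule norm_blinfun_compose)
      also have "\<dots> \<le> norm (neumann A r) * norm A * (1 / (1 - cmod (s z) * norm A))"
        by (intro mult_mono norm_blinfun_compose norm_neumann_le z) auto
      finally show "norm (neumann A r o\<^sub>L A o\<^sub>L neumann A (s z)) \<le> norm (neumann A r) * norm A * (1 / (1 - cmod (s z) * norm A))" .
    qed simp
    finally show "norm (neumann A (s z) - neumann A r) \<le> ?b z" .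
  qed
  have "(?b \<longlongrightarrow> cmod (r - r) * (norm (neumann A r) * norm A * (1 / (1 - cmod r * norm A)))) G"
    using assms(3) by (intro tendsto_mult tendsto_norm tendsto_diff tendsto_const tendsto_divide assms(2)) simp
  then show "(?b \<longlongrightarrow> 0) G" by simp
qed

section \<open>Continuity and differentiability of Fredholm determinants\<close>

text \<open>The difference of the two operators splits into \<open>(X z - X0) R (Y z)\<close> and \<open>X0 R (Y z - Y0)\<close>, whose trace norms tend to
zero.\<close>

lemma fredholm_det_tendsto:
  assumes R: "nuclear R \<nu>" and X: "(X \<longlongrightarrow> X0) G" and Y: "(Y \<longlongrightarrow> Y0) G"
    and lin: "clinear_op X0" "clinear_op Y0" "\<forall>\<^sub>F z in G. clinear_op (X z)" "\<forall>\<^sub>F z in G. clinear_op (Y z)"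
  shows "((\<lambda>z. fredholm_det (X z o\<^sub>L R o\<^sub>L Y z)) \<longlongrightarrow> fredholm_det (X0 o\<^sub>L R o\<^sub>L Y0)) G"
proof (rule Lim_transform[OF tendsto_const], rule Lim_null_comparison)
  let ?\<mu> = "\<lambda>z. norm (X z - X0) * norm (Y z) * \<nu> + norm X0 * norm (Y z - Y0) * \<nu>"
  let ?\<nu>0 = "norm X0 * norm Y0 * \<nu>"
  let ?b = "\<lambda>z. 2 * ?\<mu> z * exp (?\<nu>0 + ?\<mu> z + 1)"
  show "\<forall>\<^sub>F z in G. norm (fredholm_det (X z o\<^sub>L R o\<^sub>L Y z) - fredholm_det (X0 o\<^sub>L R o\<^sub>L Y0)) \<le> ?b z"
  proof (rule eventually_mono[OF eventually_conj[OF lin(3,4)]])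
    fix z assume z: "clinear_op (X z) \<and> clinear_op (Y z)"
    let ?L = "((X z - X0) o\<^sub>L R o\<^sub>L Y z) + (X0 o\<^sub>L R o\<^sub>L (Y z - Y0))"
    have "nuclear ?L (?\<mu> z)"
      by (intro nuclear_add nuclear_compose R clinear_op_diff lin(1,2)) (use z in auto)
    from fredholm_det_lipschitz[OF nuclear_compose[OF R lin(1,2)] this]
    have "norm (fredholm_det ((X0 o\<^sub>L R o\<^sub>L Y0) + ?L) - fredholm_det (X0 o\<^sub>L R o\<^sub>L Y0)) \<le> ?b z" .
    moreover have "(X0 o\<^sub>L R o\<^sub>L Y0) + ?L = X z o\<^sub>L R o\<^sub>L Y z"
      by (simp add: comp_diff_left comp_diff_right)
    ultimately show "norm (fredholm_det (X z o\<^sub>L R o\<^sub>L Y z) - fredholm_det (X0 o\<^sub>L R o\<^sub>L Y0)) \<le> ?b z"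
      by (simp only:)
  qed
  have "(?\<mu> \<longlongrightarrow> norm (X0 - X0) * norm Y0 * \<nu> + norm X0 * norm (Y0 - Y0) * \<nu>) G"
    by (intro tendsto_add tendsto_mult tendsto_norm tendsto_diff tendsto_const X Y)
  then have "(?\<mu> \<longlongrightarrow> 0) G" by simp
  then have "(?b \<longlongrightarrow> 2 * 0 * exp (?\<nu>0 + 0 + 1)) G"
    by (intro tendsto_mult tendsto_exp tendsto_add tendsto_const)
  then show "(?b \<longlongrightarrow> 0) G" by simp
qed

lemma fredholm_det_rank_one_affine:
  fixes B :: "complex \<Rightarrow>\<^sub>L 'h::complex_hilbert" and C :: "'h \<Rightarrow>\<^sub>L complex"
  assumes K: "nuclear K \<nu>" and BC: "clinear_op B" "clinear_op C"
  shows "fredholm_det (K + r *\<^sub>R (B o\<^sub>L C)) =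
    fredholm_det K + of_real r * (fredholm_det (K + (B o\<^sub>L C)) - fredholm_det K)"
proof (rule tendsto_unique[OF finite_subsets_at_top_neq_bot])
  have n: "nuclear (r *\<^sub>R (B o\<^sub>L C)) (norm (r *\<^sub>R B) * norm C)" for r
    using nuclear_finite_rank[OF finite_rank_rank_one[OF clinear_op_scaleR[OF BC(1)] BC(2)]]
    by (simp only: comp_scaleR_left)
  have n1: "nuclear (B o\<^sub>L C) (norm B * norm C)"
    by (intro nuclear_finite_rank finite_rank_rank_one BC)
  show "((\<lambda>F. section_det F (K + r *\<^sub>R (B o\<^sub>L C))) \<longlongrightarrow> fredholm_det (K + r *\<^sub>R (B o\<^sub>L C))) (finite_subsets_at_top onb)"
    by (rule section_det_tendsto_fredholm_det[OF nuclear_add[OF K n]])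
  have "((\<lambda>F. section_det F K + of_real r * (section_det F (K + (B o\<^sub>L C)) - section_det F K)) \<longlongrightarrow>
      fredholm_det K + of_real r * (fredholm_det (K + (B o\<^sub>L C)) - fredholm_det K)) (finite_subsets_at_top onb)"
    by (intro tendsto_add tendsto_mult tendsto_diff tendsto_const section_det_tendsto_fredholm_det[OF K]
        section_det_tendsto_fredholm_det[OF nuclear_add[OF K n1]])
  then show "((\<lambda>F. section_det F (K + r *\<^sub>R (B o\<^sub>L C))) \<longlongrightarrow>
      fredholm_det K + of_real r * (fredholm_det (K + (B o\<^sub>L C)) - fredholm_det K)) (finite_subsets_at_top onb)"
    by (rule Lim_transform_eventually)
      (rule eventually_mono[OF eventually_onb], simp add: section_det_rank_one_affine[OF _ BC(1)])
qed

text \<open>If \<open>k\<close> has derivative \<open>B o C\<close> at \<open>x\<close> in trace norm, the Lipschitz estimate allows to replace \<open>k\<close> by its tangent, along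
which the determinant is affine because \<open>B o C\<close> has rank one.\<close>

lemma fredholm_det_has_vector_derivative:
  fixes B :: "complex \<Rightarrow>\<^sub>L 'h::complex_hilbert" and C :: "'h \<Rightarrow>\<^sub>L complex"
  assumes K: "nuclear K \<nu>" and BC: "clinear_op B" "clinear_op C" and kx: "k x = K"
    and rem: "\<forall>\<^sub>F y in at x. nuclear (k y - K - (y - x) *\<^sub>R (B o\<^sub>L C)) (\<eta> y)"
    and \<eta>: "((\<lambda>y. \<eta> y / \<bar>y - x\<bar>) \<longlongrightarrow> 0) (at x)"
  shows "((\<lambda>y. fredholm_det (k y)) has_vector_derivative
    (fredholm_det (K + (B o\<^sub>L C)) - fredholm_det K)) (at x)"
  unfolding has_vector_derivative_def has_derivative_iff_norm
proof (intro conjI)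
  let ?D = "fredholm_det (K + (B o\<^sub>L C)) - fredholm_det K"
  show "bounded_linear (\<lambda>h. h *\<^sub>R ?D)" by (rule bounded_linear_scaleR_left)
  let ?\<nu>' = "\<lambda>y. \<nu> + norm ((y - x) *\<^sub>R B) * norm C"
  let ?b = "\<lambda>y. 2 * (\<eta> y / \<bar>y - x\<bar>) * exp (?\<nu>' y + \<eta> y / \<bar>y - x\<bar> * \<bar>y - x\<bar> + 1)"
  show "((\<lambda>y. norm (fredholm_det (k y) - fredholm_det (k x) - (y - x) *\<^sub>R ?D) / norm (y - x)) \<longlongrightarrow> 0) (at x)"
  proof (rule Lim_null_comparison)
    have "\<forall>\<^sub>F y in at x. y \<noteq> x" by (simp add: eventually_at_filter)
    from eventually_conj[OF rem this]
    show "\<forall>\<^sub>F y in at x. norm (norm (fredholm_det (k y) - fredholm_det (k x) - (y - x) *\<^sub>R ?D) / norm (y - x)) \<le> ?b y"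
    proof (rule eventually_mono)
      fix y assume y: "nuclear (k y - K - (y - x) *\<^sub>R (B o\<^sub>L C)) (\<eta> y) \<and> y \<noteq> x"
      let ?K = "K + (y - x) *\<^sub>R (B o\<^sub>L C)"
      have "nuclear ((y - x) *\<^sub>R (B o\<^sub>L C)) (norm ((y - x) *\<^sub>R B) * norm C)"
        using nuclear_finite_rank[OF finite_rank_rank_one[OF clinear_op_scaleR[OF BC(1)] BC(2)]]
        by (simp only: comp_scaleR_left)
      from nuclear_add[OF K this] have "nuclear ?K (?\<nu>' y)" .
      from fredholm_det_lipschitz[OF this conjunct1[OF y]]
      have "norm (fredholm_det (?K + (k y - K - (y - x) *\<^sub>R (B o\<^sub>L C))) - fredholm_det ?K) \<le>
          2 * \<eta> y * exp (?\<nu>' y + \<eta> y + 1)" .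
      moreover have "?K + (k y - K - (y - x) *\<^sub>R (B o\<^sub>L C)) = k y" by simp
      ultimately have "norm (fredholm_det (k y) - fredholm_det ?K) \<le> 2 * \<eta> y * exp (?\<nu>' y + \<eta> y + 1)"
        by (simp only:)
      moreover have "fredholm_det (k y) - fredholm_det (k x) - (y - x) *\<^sub>R ?D = fredholm_det (k y) - fredholm_det ?K"
        unfolding kx fredholm_det_rank_one_affine[OF K BC] by (simp add: scaleR_conv_of_real)
      ultimately have "norm (fredholm_det (k y) - fredholm_det (k x) - (y - x) *\<^sub>R ?D) / \<bar>y - x\<bar> \<le>
          2 * \<eta> y * exp (?\<nu>' y + \<eta> y + 1) / \<bar>y - x\<bar>"
        by (intro divide_right_mono) (simp_all only: abs_ge_zero)
      moreover have "2 * \<eta> y * exp (?\<nu>' y + \<eta> y + 1) / \<bar>y - x\<bar> = ?b y"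
        using y by simp
      ultimately show "norm (norm (fredholm_det (k y) - fredholm_det (k x) - (y - x) *\<^sub>R ?D) / norm (y - x)) \<le> ?b y"
        by (simp only: real_norm_def abs_divide abs_norm_cancel abs_abs)
    qed
    have "(?b \<longlongrightarrow> 2 * 0 * exp (\<nu> + norm ((x - x) *\<^sub>R B) * norm C + 0 * \<bar>x - x\<bar> + 1)) (at x)"
      by (intro tendsto_mult tendsto_const tendsto_exp tendsto_add tendsto_norm tendsto_scaleR
          tendsto_diff tendsto_ident_at tendsto_rabs \<eta>)
    then show "(?b \<longlongrightarrow> 0) (at x)" by simp
  qed
qed

section \<open>The tau function under Miwa shifts\<close>

text \<open>As \<open>R A1 = D - A2 R\<close>, the product \<open>R (I + s A1)\<close> equals \<open>(I - s A2) R + s D\<close>, and \<open>neumann A2 s\<close> cancels the first factor.\<close>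

lemma neumann_sandwich:
  assumes A2: "clinear_op A2" "cmod s * norm A2 < 1" and R: "clinear_op R"
    and D: "(A2 o\<^sub>L R) + (R o\<^sub>L A1) = D"
  shows "neumann A2 s o\<^sub>L R o\<^sub>L (id_blinfun + scaleC_op s A1) = R + scaleC_op s (neumann A2 s o\<^sub>L D)"
proof -
  have "R o\<^sub>L (id_blinfun + scaleC_op s A1) = ((id_blinfun - scaleC_op s A2) o\<^sub>L R) + scaleC_op s D"
    unfolding D[symmetric]
    by (simp add: comp_add_right comp_diff_left scaleC_op_comp_left scaleC_op_comp_right[OF R] scaleC_op_add)
  then have "neumann A2 s o\<^sub>L (R o\<^sub>L (id_blinfun + scaleC_op s A1)) =
      (neumann A2 s o\<^sub>L ((id_blinfun - scaleC_op s A2) o\<^sub>L R)) + scaleC_op s (neumann A2 s o\<^sub>L D)"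
    by (simp only: comp_add_right scaleC_op_comp_right[OF clinear_neumann[OF A2]])
  then show ?thesis
    by (simp only: comp_assoc[symmetric] neumann_left[OF A2] comp_id)
qed

context admissible_pair
begin

definition admissible_shift :: "complex \<Rightarrow> bool" where
  "admissible_shift s \<longleftrightarrow> cmod s * norm A1 < 1 \<and> cmod s * norm A2 < 1"

definition convergent_times :: "(nat \<Rightarrow> complex) \<Rightarrow> bool" where
  "convergent_times t \<longleftrightarrow> summable (time_series A2 t) \<and> summable (time_series (- A1) t)"

abbreviation "V \<equiv> V_op A2"
abbreviation "W \<equiv> W_op A1"

text \<open>The operator whose Fredholm determinant is the tau function.\<close>

definition tau_op :: "(nat \<Rightarrow> complex) \<Rightarrow> real \<Rightarrow> ('h \<Rightarrow>\<^sub>L 'h)" where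
  "tau_op t x = V t o\<^sub>L R x o\<^sub>L W t"

lemma tau_eq: "tau A1 A2 B C x t = fredholm_det (tau_op t x)"
  by (simp add: tau_def tau_op_def)

lemma admissible_shiftD:
  assumes "admissible_shift s"
  shows "cmod s * norm A1 < 1" "cmod s * norm A2 < 1" "cmod s * norm (- A1) < 1"
  using assms by (simp_all add: admissible_shift_def)

lemma convergent_timesD:
  assumes "convergent_times t"
  shows "summable (time_series A2 t)" "summable (time_series (- A1) t)"
    "clinear_op (V t)" "clinear_op (W t)"
  using assms clinear_V_op[of A2 t] clinear_W_op[of A1 t] lin
  by (simp_all add: convergent_times_def)

lemma convergent_times_C0: "t \<in> C0_inf \<Longrightarrow> convergent_times t"
  by (simp add: convergent_times_def summable_time_series_C0)

lemma convergent_times_shift: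
  assumes "convergent_times t" "admissible_shift s"
  shows "convergent_times (\<lambda>j. t j + miwa s j)"
  unfolding convergent_times_def time_series_add
  by (intro conjI summable_add summable_time_series_miwa convergent_timesD(1,2)[OF assms(1)]
      admissible_shiftD[OF assms(2)] clinear_op_minus lin)

lemma nuclear_R: "y \<ge> 0 \<Longrightarrow> \<exists>\<nu>. nuclear (R y) \<nu>"
proof -
  assume y: "y \<ge> 0"
  obtain \<nu> where "nuclear (R 0) \<nu>" using nuclear_R_zero by (elim exE)
  then have "nuclear (exp_neg A2 y o\<^sub>L R 0 o\<^sub>L exp_neg A1 y) (norm (exp_neg A2 y) * norm (exp_neg A1 y) * \<nu>)"
    by (intro nuclear_compose clinear_exp_neg lin)
  then show ?thesis unfolding R_eq_sandwich[OF y] by (rule exI)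
qed

lemma nuclear_tau_op:
  assumes "convergent_times t" "y \<ge> 0"
  shows "\<exists>\<nu>. nuclear (tau_op t y) \<nu>"
proof -
  obtain \<nu> where "nuclear (R y) \<nu>" using nuclear_R[OF assms(2)] by (elim exE)
  then have "nuclear (tau_op t y) (norm (V t) * norm (W t) * \<nu>)"
    unfolding tau_op_def by (intro nuclear_compose convergent_timesD[OF assms(1)])
  then show ?thesis by (rule exI)
qed

lemma section_det_tendsto_tau:
  assumes "convergent_times t" "y \<ge> 0"
  shows "((\<lambda>F. section_det F (tau_op t y)) \<longlongrightarrow> tau A1 A2 B C y t) (finite_subsets_at_top onb)"
proof -
  obtain \<nu> where "nuclear (tau_op t y) \<nu>" using nuclear_tau_op[OF assms] by (elim exE)
  then show ?thesis unfolding tau_eq by (rule section_det_tendsto_fredholm_det)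
qed

text \<open>A shift by \<open>[s]\<close> adds \<open>s\<close> times the rank one operator \<open>shift_vec o covec\<close> to \<open>tau_op\<close>.\<close>

definition shift_vec :: "(nat \<Rightarrow> complex) \<Rightarrow> real \<Rightarrow> complex \<Rightarrow> (complex \<Rightarrow>\<^sub>L 'h)" where
  "shift_vec t x s = V t o\<^sub>L neumann A2 s o\<^sub>L exp_neg A2 x o\<^sub>L B"

text \<open>The vector that a second shift \<open>[b]\<close> contributes after a first shift \<open>[a]\<close>.\<close>

definition shift_vec2 :: "(nat \<Rightarrow> complex) \<Rightarrow> real \<Rightarrow> complex \<Rightarrow> complex \<Rightarrow> (complex \<Rightarrow>\<^sub>L 'h)" where
  "shift_vec2 t x a b = V t o\<^sub>L (neumann A2 b o\<^sub>L neumann A2 a) o\<^sub>L exp_neg A2 x o\<^sub>L B"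

definition covec :: "(nat \<Rightarrow> complex) \<Rightarrow> real \<Rightarrow> ('h \<Rightarrow>\<^sub>L complex)" where
  "covec t x = C o\<^sub>L exp_neg A1 x o\<^sub>L W t"

text \<open>The functional of a shifted system is \<open>covec + s covec1\<close>, so two functionals suffice for all shifts.\<close>

definition covec1 :: "(nat \<Rightarrow> complex) \<Rightarrow> real \<Rightarrow> ('h \<Rightarrow>\<^sub>L complex)" where
  "covec1 t x = C o\<^sub>L exp_neg A1 x o\<^sub>L A1 o\<^sub>L W t"

lemma clinear_shift_vec:
  assumes "convergent_times t"
  shows "admissible_shift s \<Longrightarrow> clinear_op (shift_vec t x s)" "admissible_shift a \<Longrightarrow> admissible_shift b \<Longrightarrow> clinear_op (shift_vec2 t x a b)"
    "clinear_op (covec t x)" "clinear_op (covec1 t x)"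
  unfolding shift_vec_def shift_vec2_def covec_def covec1_def
  by (intro clinear_op_compose clinear_exp_neg clinear_neumann admissible_shiftD convergent_timesD[OF assms] lin; assumption?)+

lemma W_shift:
  assumes "convergent_times t" "admissible_shift s"
  shows "W (\<lambda>j. t j + miwa s j) = (id_blinfun + scaleC_op s A1) o\<^sub>L W t"
proof -
  have c: "A1 o\<^sub>L W t = W t o\<^sub>L A1"
    by (rule W_op_commute[OF convergent_timesD(2)[OF assms(1)] lin(1) refl])
  show ?thesis
    unfolding W_op_shift[OF lin(1) convergent_timesD(2)[OF assms(1)] admissible_shiftD(1)[OF assms(2)]]
    by (simp only: comp_add_left comp_add_right comp_id scaleC_op_comp_left c
        scaleC_op_comp_right[OF convergent_timesD(4)[OF assms(1)]])
qed

lemma V_shift: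
  assumes "convergent_times t" "admissible_shift s"
  shows "V (\<lambda>j. t j + miwa s j) = V t o\<^sub>L neumann A2 s"
  by (rule V_op_shift[OF lin(2) convergent_timesD(1)[OF assms(1)] admissible_shiftD(2)[OF assms(2)]])

lemma tau_op_shift:
  assumes t: "convergent_times t" and s: "admissible_shift s" and x: "x \<ge> 0"
  shows "tau_op (\<lambda>j. t j + miwa s j) x = tau_op t x + scaleC_op s (shift_vec t x s o\<^sub>L covec t x)"
proof -
  have "tau_op (\<lambda>j. t j + miwa s j) x =
      V t o\<^sub>L (neumann A2 s o\<^sub>L R x o\<^sub>L (id_blinfun + scaleC_op s A1)) o\<^sub>L W t"
    unfolding tau_op_def V_shift[OF t s] W_shift[OF t s] by (simp only: comp_assoc)
  also have "neumann A2 s o\<^sub>L R x o\<^sub>L (id_blinfun + scaleC_op s A1) =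
      R x + scaleC_op s (neumann A2 s o\<^sub>L ((exp_neg A2 x o\<^sub>L B) o\<^sub>L (C o\<^sub>L exp_neg A1 x)))"
    by (rule neumann_sandwich[OF lin(2) admissible_shiftD(2)[OF s] clinear_R[OF x] sylvester[OF x]])
  also have "V t o\<^sub>L (R x + scaleC_op s (neumann A2 s o\<^sub>L ((exp_neg A2 x o\<^sub>L B) o\<^sub>L (C o\<^sub>L exp_neg A1 x)))) o\<^sub>L W t =
      tau_op t x + scaleC_op s (shift_vec t x s o\<^sub>L covec t x)"
    unfolding tau_op_def shift_vec_def covec_def
    by (simp only: comp_add_left comp_add_right scaleC_op_comp_left
        scaleC_op_comp_right[OF convergent_timesD(3)[OF t]] comp_assoc)
  finally show ?thesis .
qed

lemma covec_shift:
  assumes t: "convergent_times t" and s: "admissible_shift s"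
  shows "covec (\<lambda>j. t j + miwa s j) x = covec t x + scaleC_op s (covec1 t x)"
  unfolding covec_def covec1_def W_shift[OF t s]
  by (simp only: comp_add_left comp_add_right scaleC_op_comp_left comp_id comp_assoc
      scaleC_op_comp_right[OF clinear_exp_neg[OF lin(1)]] scaleC_op_comp_right[OF lin(4)])

lemma shift_vec_shift:
  assumes t: "convergent_times t" and "admissible_shift a" "admissible_shift b"
  shows "shift_vec (\<lambda>j. t j + miwa a j) x b = shift_vec2 t x a b"
proof -
  have "neumann A2 a o\<^sub>L A2 = A2 o\<^sub>L neumann A2 a"
    by (rule neumann_commute[OF lin(2) admissible_shiftD(2)[OF assms(2)] lin(2) refl, symmetric])
  then have "neumann A2 a o\<^sub>L neumann A2 b = neumann A2 b o\<^sub>L neumann A2 a"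
    by (rule neumann_commute[OF lin(2) admissible_shiftD(2)[OF assms(3)] clinear_neumann[OF lin(2) admissible_shiftD(2)[OF assms(2)]]])
  then show ?thesis
    unfolding shift_vec_def shift_vec2_def V_shift[OF t assms(2)] by (simp only: comp_assoc[of "V t" "neumann A2 a"])
qed

text \<open>The doubly shifted vector is the divided difference of \<open>s \<mapsto> s * shift_vec\<close>.\<close>

lemma shift_vec2_eq:
  assumes "convergent_times t" "admissible_shift a" "admissible_shift b"
  shows "scaleC_op (a - b) (shift_vec2 t x a b) = scaleC_op a (shift_vec t x a) - scaleC_op b (shift_vec t x b)"
proof -
  have "scaleC_op (a - b) (shift_vec2 t x a b) = V t o\<^sub>L scaleC_op (a - b) (neumann A2 b o\<^sub>L neumann A2 a) o\<^sub>L exp_neg A2 x o\<^sub>L B"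
    unfolding shift_vec2_def by (simp only: scaleC_op_comp_left scaleC_op_comp_right[OF convergent_timesD(3)[OF assms(1)]])
  then show ?thesis
    unfolding neumann_diff(1)[OF lin(2) admissible_shiftD(2)[OF assms(2)] admissible_shiftD(2)[OF assms(3)]] shift_vec_def
    by (simp only: comp_diff_left comp_diff_right scaleC_op_comp_left
        scaleC_op_comp_right[OF convergent_timesD(3)[OF assms(1)]])
qed

subsection \<open>Shifted finite sections\<close>

text \<open>The matrix entries of \<open>I + tau_op\<close>, with the operator's argument as row index. Compressions to \<open>F\<close> of all shifted operators are
rank one or rank two perturbations of this matrix; row \<open>e\<close> of the perturbation carries the value of a functional at \<open>e\<close>.\<close>

definition tau_matrix :: "(nat \<Rightarrow> complex) \<Rightarrow> real \<Rightarrow> 'h \<Rightarrow> 'h \<Rightarrow> complex" where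
  "tau_matrix t x e f = (if e = f then 1 else 0) + cinner (blinfun_apply (tau_op t x) e) f"

abbreviation "out0 t x \<equiv> blinfun_apply (covec t x)"
abbreviation "out1 t x \<equiv> blinfun_apply (covec1 t x)"

definition shift_entry :: "(nat \<Rightarrow> complex) \<Rightarrow> real \<Rightarrow> complex \<Rightarrow> 'h \<Rightarrow> complex" where
  "shift_entry t x s f = cinner (blinfun_apply (shift_vec t x s) 1) f"

definition shift_entry2 :: "(nat \<Rightarrow> complex) \<Rightarrow> real \<Rightarrow> complex \<Rightarrow> complex \<Rightarrow> 'h \<Rightarrow> complex" where
  "shift_entry2 t x a b f = cinner (blinfun_apply (shift_vec2 t x a b) 1) f"

lemma shift_entry2_eq:
  assumes "convergent_times t" "admissible_shift a" "admissible_shift b"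
  shows "(a - b) * shift_entry2 t x a b f = a * shift_entry t x a f - b * shift_entry t x b f"
proof -
  have "blinfun_apply (scaleC_op (a - b) (shift_vec2 t x a b)) 1 + blinfun_apply (scaleC_op b (shift_vec t x b)) 1 =
      blinfun_apply (scaleC_op a (shift_vec t x a)) 1"
    unfolding shift_vec2_eq[OF assms] by (simp add: blinfun.diff_left)
  then have "cinner (blinfun_apply (scaleC_op (a - b) (shift_vec2 t x a b)) 1) f + cinner (blinfun_apply (scaleC_op b (shift_vec t x b)) 1) f =
      cinner (blinfun_apply (scaleC_op a (shift_vec t x a)) 1) f"
    by (simp only: cinner_add_left[symmetric])
  then show ?thesis
    unfolding shift_entry_def shift_entry2_def scaleC_op_apply cinner_scaleC_left by (simp add: algebra_simps)
qed

lemma section_det_tau_op: "finite F \<Longrightarrow> section_det F (tau_op t x) = sdet F (tau_matrix t x)"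
  by (simp add: section_det_eq_sdet tau_matrix_def[abs_def])

lemma section_det_shift:
  assumes t: "convergent_times t" and s: "admissible_shift s" and x: "x \<ge> 0" and F: "finite F"
  shows "section_det F (tau_op (\<lambda>j. t j + miwa s j) x) = sdet F (tau_matrix t x) + s * rank_one_term F (tau_matrix t x) (out0 t x) (shift_entry t x s)"
proof -
  have "section_det F (tau_op (\<lambda>j. t j + miwa s j) x) = sdet F (\<lambda>e f. tau_matrix t x e f + out0 t x e * (s * shift_entry t x s f))"
    unfolding section_det_eq_sdet[OF F] tau_op_shift[OF t s x] blinfun.add_left cinner_add_left scaleC_op_apply
      cinner_scaleC_left cinner_rank_one[OF clinear_shift_vec(1)[OF t s]] tau_matrix_def shift_entry_def
    by (simp only: mult_ac add_ac)
  then show ?thesis by (simp only: sdet_add_rank_one[OF F] rank_one_term_scale[OF F])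
qed

text \<open>Shifting by \<open>[a]\<close> and then by \<open>[b]\<close> gives coefficients that look asymmetric in \<open>a\<close> and \<open>b\<close>; the divided difference
formula brings them into the form required by \<open>sdet_pair_shift\<close>.\<close>

lemma section_det_shift2:
  assumes t: "convergent_times t" and ab: "admissible_shift a" "admissible_shift b" and x: "x \<ge> 0" and F: "finite F"
  shows "section_det F (tau_op (\<lambda>j. t j + miwa a j + miwa b j) x) =
    sdet F (\<lambda>e f. tau_matrix t x e f + out0 t x e * (b * shift_entry t x b f + a * shift_entry2 t x a b f) + out1 t x e * (a * b * shift_entry2 t x a b f))"
proof -
  have ent: "cinner (blinfun_apply (tau_op (\<lambda>j. t j + miwa a j + miwa b j) x) e) f =
      cinner (blinfun_apply (tau_op t x) e) f + a * (out0 t x e * shift_entry t x a f) +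
      b * ((out0 t x e + a * out1 t x e) * shift_entry2 t x a b f)" for e f
    unfolding tau_op_shift[OF convergent_times_shift[OF t ab(1)] ab(2) x] tau_op_shift[OF t ab(1) x]
      covec_shift[OF t ab(1)] shift_vec_shift[OF t ab] blinfun.add_left cinner_add_left scaleC_op_apply
      cinner_scaleC_left cinner_rank_one[OF clinear_shift_vec(1)[OF t ab(1)]]
      cinner_rank_one[OF clinear_shift_vec(2)[OF t ab]] shift_entry_def shift_entry2_def scaleC_complex_def ..
  have "cinner (blinfun_apply (tau_op (\<lambda>j. t j + miwa a j + miwa b j) x) e) f =
      cinner (blinfun_apply (tau_op t x) e) f + out0 t x e * (b * shift_entry t x b f + a * shift_entry2 t x a b f) +
      out1 t x e * (a * b * shift_entry2 t x a b f)" for e f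
    unfolding ent using shift_entry2_eq[OF t ab, of x f] by algebra
  then show ?thesis
    unfolding section_det_eq_sdet[OF F] tau_matrix_def by (simp only: add.assoc)
qed

lemma rank_one_term_linear_left: "rank_one_term F Z (\<lambda>e. a * w e + b * w' e) c = a * rank_one_term F Z w c + b * rank_one_term F Z w' c"
  by (simp add: rank_one_term_def sum_distrib_left sum.distrib algebra_simps)

text \<open>Both the shift and the derivative in \<open>x\<close> perturb along the same vector, so their sum still has rank one.\<close>

lemma section_det_derivative:
  assumes t: "convergent_times t" and s: "admissible_shift s" and x: "x \<ge> 0" and F: "finite F"
  shows "section_det F (tau_op (\<lambda>j. t j + miwa s j) x + ((- shift_vec t x s) o\<^sub>L (covec t x + scaleC_op s (covec1 t x)))) =
    sdet F (tau_matrix t x) + (s - 1) * rank_one_term F (tau_matrix t x) (out0 t x) (shift_entry t x s) - s * rank_one_term F (tau_matrix t x) (out1 t x) (shift_entry t x s)"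
proof -
  let ?w = "\<lambda>e. (s - 1) * out0 t x e + (- s) * out1 t x e"
  note cl = clinear_shift_vec(1)[OF t s, of x]
  have ent: "cinner (blinfun_apply (tau_op (\<lambda>j. t j + miwa s j) x + ((- shift_vec t x s) o\<^sub>L (covec t x + scaleC_op s (covec1 t x)))) e) f =
      cinner (blinfun_apply (tau_op t x) e) f + s * (out0 t x e * shift_entry t x s f) +
      (out0 t x e + s * out1 t x e) * (- shift_entry t x s f)" for e f
  proof -
    have m: "cinner (blinfun_apply (- shift_vec t x s) 1) f = - shift_entry t x s f"
      using cinner_add_left[of "blinfun_apply (- shift_vec t x s) 1" "blinfun_apply (shift_vec t x s) 1" f]
      by (simp add: blinfun.minus_left shift_entry_def eq_neg_iff_add_eq_0)
    show ?thesis
      unfolding tau_op_shift[OF t s x] blinfun.add_left cinner_add_left scaleC_op_apply cinner_scaleC_left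
        cinner_rank_one[OF cl] cinner_rank_one[OF clinear_op_minus[OF cl]] m shift_entry_def[symmetric] scaleC_complex_def ..
  qed
  have "section_det F (tau_op (\<lambda>j. t j + miwa s j) x + ((- shift_vec t x s) o\<^sub>L (covec t x + scaleC_op s (covec1 t x)))) =
      sdet F (\<lambda>e f. tau_matrix t x e f + ?w e * shift_entry t x s f)"
    unfolding section_det_eq_sdet[OF F] ent tau_matrix_def by (rule sdet_cong) (simp add: algebra_simps)
  then show ?thesis by (simp only: sdet_add_rank_one[OF F] rank_one_term_linear_left) simp
qed

subsection \<open>Fay's identities\<close>

theorem fay_identity:
  assumes t: "convergent_times t" and x: "x \<ge> 0"
    and s: "admissible_shift s0" "admissible_shift s1" "admissible_shift s2" "admissible_shift s3"
  defines "\<sigma> \<equiv> \<lambda>a b. (a - b) * tau A1 A2 B C x (\<lambda>j. t j + miwa a j + miwa b j)"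
  shows "\<sigma> s0 s1 * \<sigma> s2 s3 - \<sigma> s0 s2 * \<sigma> s1 s3 + \<sigma> s0 s3 * \<sigma> s1 s2 = 0"
proof -
  let ?f = "\<lambda>F a b. (a - b) * section_det F (tau_op (\<lambda>j. t j + miwa a j + miwa b j) x)"
  have lim: "((\<lambda>F. ?f F a b) \<longlongrightarrow> \<sigma> a b) (finite_subsets_at_top onb)" if "admissible_shift a" "admissible_shift b" for a b
    unfolding \<sigma>_def
    by (intro tendsto_mult_left section_det_tendsto_tau convergent_times_shift t x that)
  have "((\<lambda>F. ?f F s0 s1 * ?f F s2 s3 - ?f F s0 s2 * ?f F s1 s3 + ?f F s0 s3 * ?f F s1 s2) \<longlongrightarrow>
      \<sigma> s0 s1 * \<sigma> s2 s3 - \<sigma> s0 s2 * \<sigma> s1 s3 + \<sigma> s0 s3 * \<sigma> s1 s2) (finite_subsets_at_top onb)"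
    by (intro tendsto_add tendsto_diff tendsto_mult lim s)
  moreover have "\<forall>\<^sub>F F in finite_subsets_at_top onb.
      ?f F s0 s1 * ?f F s2 s3 - ?f F s0 s2 * ?f F s1 s3 + ?f F s0 s3 * ?f F s1 s2 = 0"
  proof (rule eventually_mono[OF eventually_onb])
    fix F :: "'h set" assume "finite F \<and> orthonormal F"
    then have F: "finite F" by simp
    show "?f F s0 s1 * ?f F s2 s3 - ?f F s0 s2 * ?f F s1 s3 + ?f F s0 s3 * ?f F s1 s2 = 0"
      unfolding section_det_shift2[OF t s(1) s(2) x F] section_det_shift2[OF t s(3) s(4) x F]
        section_det_shift2[OF t s(1) s(3) x F] section_det_shift2[OF t s(2) s(4) x F]
        section_det_shift2[OF t s(1) s(4) x F] section_det_shift2[OF t s(2) s(3) x F]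
      by (rule sdet_fay[OF F, where I = "{s. admissible_shift s}"]) (use s shift_entry2_eq[OF t] in simp_all)
  qed
  ultimately show ?thesis
    by (rule tendsto_unique[OF finite_subsets_at_top_neq_bot, OF _ tendsto_eventually])
qed

text \<open>The remainder of the first-order expansion of \<open>R y = X o R x o Z\<close> at \<open>y = x\<close>, arranged so that each summand contains a factor that is
small compared with \<open>h\<close> or two factors that tend to zero; the linear term is identified by the Sylvester equation.\<close>

lemma R_remainder:
  assumes x: "x \<ge> 0" "y \<ge> 0"
  defines "X \<equiv> exp_neg A2 (y - x)" and "Z \<equiv> exp_neg A1 (y - x)" and "h \<equiv> y - x"
  shows "R y - R x + h *\<^sub>R ((exp_neg A2 x o\<^sub>L B) o\<^sub>L (C o\<^sub>L exp_neg A1 x)) =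
    ((X - id_blinfun + h *\<^sub>R A2) o\<^sub>L R x o\<^sub>L Z) + (id_blinfun o\<^sub>L R x o\<^sub>L (Z - id_blinfun + h *\<^sub>R A1)) +
      ((- h *\<^sub>R A2) o\<^sub>L R x o\<^sub>L (Z - id_blinfun))"
proof -
  have "exp_neg A2 y = X o\<^sub>L exp_neg A2 x" "exp_neg A1 y = exp_neg A1 x o\<^sub>L Z"
    unfolding X_def Z_def exp_neg_add[symmetric] by simp_all
  then have "R y = X o\<^sub>L R x o\<^sub>L Z"
    unfolding R_eq_sandwich[OF x(1)] R_eq_sandwich[OF x(2)] by (simp only: comp_assoc)
  then show ?thesis
    unfolding sylvester[OF x(1), symmetric]
    by (simp add: comp_add_left comp_add_right comp_diff_left comp_diff_right comp_scaleR_left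
        comp_scaleR_right comp_minus_left scaleR_add_right comp_assoc algebra_simps)
qed

lemma exp_neg_difference_quotient:
  "((\<lambda>y. norm (exp_neg A (y - x) - id_blinfun + (y - x) *\<^sub>R A) / \<bar>y - x\<bar>) \<longlongrightarrow> 0) (at x)"
proof -
  have "((\<lambda>y. y - x) has_vector_derivative 1) (at x)"
    by (auto intro!: derivative_eq_intros)
  then have "((exp_neg A \<circ> (\<lambda>y. y - x)) has_vector_derivative (1 *\<^sub>R (- (A o\<^sub>L exp_neg A (x - x))))) (at x)"
    by (rule vector_diff_chain_at) (rule exp_neg_has_vector_derivative)
  then show ?thesis
    by (simp add: has_vector_derivative_def has_derivative_iff_norm o_def algebra_simps)
qed

lemma exp_neg_tendsto_id: "((\<lambda>y. exp_neg A (y - x)) \<longlongrightarrow> id_blinfun) (at x)"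
proof -
  have "isCont (exp_neg A) (x - x)"
    using continuous_on_exp_neg[of UNIV A] by (simp add: continuous_on_eq_continuous_at)
  then have "isCont (\<lambda>y. exp_neg A (y - x)) x"
    by (intro isCont_o2[of x "\<lambda>y. y - x" "exp_neg A"]) (auto intro!: continuous_intros)
  then show ?thesis by (simp add: isCont_def)
qed

text \<open>The derivative of \<open>R\<close> is \<open>- b c\<close>, of rank one, with a remainder of trace norm \<open>o(y - x)\<close>.\<close>

lemma tau_has_vector_derivative:
  assumes t: "convergent_times t" and x: "x > 0"
  shows "((\<lambda>y. tau A1 A2 B C y t) has_vector_derivative
    (fredholm_det (tau_op t x + ((- (V t o\<^sub>L exp_neg A2 x o\<^sub>L B)) o\<^sub>L covec t x)) - tau A1 A2 B C x t)) (at x)"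
proof -
  obtain \<nu> where \<nu>: "nuclear (R x) \<nu>" using nuclear_R[of x] x by auto
  obtain \<kappa> where \<kappa>: "nuclear (tau_op t x) \<kappa>" using nuclear_tau_op[OF t, of x] x by auto
  let ?X = "\<lambda>y. exp_neg A2 (y - x)" and ?Z = "\<lambda>y. exp_neg A1 (y - x)"
  let ?i = "norm (id_blinfun :: 'h \<Rightarrow>\<^sub>L 'h)"
  let ?a = "\<lambda>y. norm (?X y - id_blinfun + (y - x) *\<^sub>R A2)" and ?b = "\<lambda>y. norm (?Z y - id_blinfun + (y - x) *\<^sub>R A1)"
  let ?c = "\<lambda>y. norm (?Z y - id_blinfun)"
  let ?\<eta> = "\<lambda>y. norm (V t) * norm (W t) *
    (?a y * norm (?Z y) * \<nu> + ?i * ?b y * \<nu> + norm (- (y - x) *\<^sub>R A2) * ?c y * \<nu>)"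
  show ?thesis
    unfolding tau_eq
  proof (rule fredholm_det_has_vector_derivative[where \<eta> = ?\<eta>, OF \<kappa>])
    show "tau_op t x = tau_op t x" ..
    show "clinear_op (- (V t o\<^sub>L exp_neg A2 x o\<^sub>L B))" "clinear_op (covec t x)"
      by (intro clinear_op_minus clinear_op_compose clinear_exp_neg lin clinear_shift_vec convergent_timesD t)+
    have "\<forall>\<^sub>F y in at x. y > 0"
      using x by (rule order_tendstoD(1)[OF tendsto_ident_at])
    then show "\<forall>\<^sub>F y in at x. nuclear (tau_op t y - tau_op t x - (y - x) *\<^sub>R ((- (V t o\<^sub>L exp_neg A2 x o\<^sub>L B)) o\<^sub>L covec t x)) (?\<eta> y)"
    proof (rule eventually_mono)
      fix y :: real assume y: "y > 0"
      let ?E = "R y - R x + (y - x) *\<^sub>R ((exp_neg A2 x o\<^sub>L B) o\<^sub>L (C o\<^sub>L exp_neg A1 x))"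
      have "tau_op t y - tau_op t x - (y - x) *\<^sub>R ((- (V t o\<^sub>L exp_neg A2 x o\<^sub>L B)) o\<^sub>L covec t x) = V t o\<^sub>L ?E o\<^sub>L W t"
        unfolding tau_op_def covec_def
        by (simp add: comp_add_left comp_add_right comp_diff_left comp_diff_right comp_minus_left
            comp_scaleR_left comp_scaleR_right comp_assoc)
      moreover have "nuclear ?E (?a y * norm (?Z y) * \<nu> + ?i * ?b y * \<nu> + norm (- (y - x) *\<^sub>R A2) * ?c y * \<nu>)"
        unfolding R_remainder[OF less_imp_le[OF x] less_imp_le[OF y]]
        by (intro nuclear_add nuclear_compose \<nu> clinear_op_add clinear_op_diff clinear_op_scaleR
            clinear_op_id clinear_exp_neg lin)
      ultimately show "nuclear (tau_op t y - tau_op t x - (y - x) *\<^sub>R ((- (V t o\<^sub>L exp_neg A2 x o\<^sub>L B)) o\<^sub>L covec t x)) (?\<eta> y)"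
        by (simp only: nuclear_compose convergent_timesD[OF t])
    qed
    let ?l = "\<lambda>y. norm (V t) * norm (W t) *
      ((?a y / \<bar>y - x\<bar>) * norm (?Z y) * \<nu> + ?i * (?b y / \<bar>y - x\<bar>) * \<nu> + norm A2 * ?c y * \<nu>)"
    have "(?l \<longlongrightarrow> norm (V t) * norm (W t) *
        (0 * norm (id_blinfun :: 'h \<Rightarrow>\<^sub>L 'h) * \<nu> + ?i * 0 * \<nu> + norm A2 * norm (id_blinfun - id_blinfun :: 'h \<Rightarrow>\<^sub>L 'h) * \<nu>)) (at x)"
      by (intro tendsto_mult tendsto_add tendsto_const tendsto_norm tendsto_diff
          exp_neg_difference_quotient exp_neg_tendsto_id)
    then have "(?l \<longlongrightarrow> 0) (at x)" by simp
    moreover have "\<forall>\<^sub>F y in at x. ?l y = ?\<eta> y / \<bar>y - x\<bar>"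
      unfolding eventually_at_filter
    proof (rule always_eventually, intro allI impI)
      fix y assume "y \<noteq> x"
      have nn: "norm (- (y - x) *\<^sub>R A2) = \<bar>y - x\<bar> * norm A2"
        by (simp only: norm_scaleR abs_minus_cancel)
      have id: "c * ((\<alpha> / h) * z * n + i * (\<beta> / h) * n + m * g * n) = c * (\<alpha> * z * n + i * \<beta> * n + h * m * g * n) / h"
        if "h \<noteq> 0" for c \<alpha> \<beta> h z n i m g :: real
        using that by (simp add: field_simps)
      show "?l y = ?\<eta> y / \<bar>y - x\<bar>"
        unfolding nn by (rule id) (use \<open>y \<noteq> x\<close> in simp)
    qed
    ultimately show "((\<lambda>y. ?\<eta> y / \<bar>y - x\<bar>) \<longlongrightarrow> 0) (at x)"
      by (rule Lim_transform_eventually)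
  qed
qed

text \<open>The derivative in \<open>x\<close> of the tau function shifted by \<open>[s]\<close>, as an increment of Fredholm determinants; in this form it is a
limit of finite determinants.\<close>

definition dtau :: "(nat \<Rightarrow> complex) \<Rightarrow> real \<Rightarrow> complex \<Rightarrow> complex" where
  "dtau t x s = fredholm_det (tau_op (\<lambda>j. t j + miwa s j) x + ((- shift_vec t x s) o\<^sub>L (covec t x + scaleC_op s (covec1 t x))))
    - tau A1 A2 B C x (\<lambda>j. t j + miwa s j)"

lemma tau_shift_has_vector_derivative:
  assumes t: "convergent_times t" and s: "admissible_shift s" and x: "x > 0"
  shows "((\<lambda>y. tau A1 A2 B C y (\<lambda>j. t j + miwa s j)) has_vector_derivative dtau t x s) (at x)"
  using tau_has_vector_derivative[OF convergent_times_shift[OF t s] x]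
  unfolding covec_shift[OF t s] V_shift[OF t s] dtau_def shift_vec_def .

text \<open>For each finite section the identity follows from \<open>sdet_pair_shift\<close> and the rank one formulas; both sides converge.\<close>

theorem fay_differential:
  assumes t: "convergent_times t" and s: "admissible_shift a" "admissible_shift b" and x: "x > 0" and nz: "a \<noteq> 0" "b \<noteq> 0"
  defines "\<tau> \<equiv> tau A1 A2 B C x"
  shows "\<tau> (\<lambda>j. t j + miwa a j) * dtau t x b - \<tau> (\<lambda>j. t j + miwa b j) * dtau t x a =
    (a - b) / (a * b) * (\<tau> t * \<tau> (\<lambda>j. t j + miwa a j + miwa b j) -
      \<tau> (\<lambda>j. t j + miwa b j) * \<tau> (\<lambda>j. t j + miwa a j))"
proof (rule tendsto_unique[OF finite_subsets_at_top_neq_bot])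
  have x0: "x \<ge> 0" using x by simp
  let ?K = "\<lambda>s. tau_op (\<lambda>j. t j + miwa s j) x"
  let ?L = "\<lambda>s. ?K s + ((- shift_vec t x s) o\<^sub>L (covec t x + scaleC_op s (covec1 t x)))"
  have tau: "((\<lambda>F. section_det F (?K s)) \<longlongrightarrow> \<tau> (\<lambda>j. t j + miwa s j)) (finite_subsets_at_top onb)" if "admissible_shift s" for s
    unfolding \<tau>_def by (intro section_det_tendsto_tau convergent_times_shift t that x0)
  have dtau: "((\<lambda>F. section_det F (?L s) - section_det F (?K s)) \<longlongrightarrow> dtau t x s) (finite_subsets_at_top onb)"
    if s: "admissible_shift s" for s
  proof -
    obtain \<kappa> where "nuclear (?K s) \<kappa>"
      using nuclear_tau_op[OF convergent_times_shift[OF t s] x0] by (elim exE)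
    moreover have "nuclear ((- shift_vec t x s) o\<^sub>L (covec t x + scaleC_op s (covec1 t x)))
        (norm (- shift_vec t x s) * norm (covec t x + scaleC_op s (covec1 t x)))"
      by (intro nuclear_finite_rank finite_rank_rank_one clinear_op_minus clinear_op_add
          clinear_op_scaleC clinear_shift_vec[OF t] s)
    ultimately have "nuclear (?L s) (\<kappa> + norm (- shift_vec t x s) * norm (covec t x + scaleC_op s (covec1 t x)))"
      by (rule nuclear_add)
    then show ?thesis
      unfolding dtau_def \<tau>_def[symmetric]
      by (intro tendsto_diff section_det_tendsto_fredholm_det tau s)
  qed
  let ?l = "\<lambda>F. section_det F (?K a) * (section_det F (?L b) - section_det F (?K b)) - section_det F (?K b) * (section_det F (?L a) - section_det F (?K a))"
  let ?r = "\<lambda>F. (a - b) / (a * b) * (section_det F (tau_op t x) * section_det F (tau_op (\<lambda>j. t j + miwa a j + miwa b j) x) -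
      section_det F (?K b) * section_det F (?K a))"
  show "(?l \<longlongrightarrow> \<tau> (\<lambda>j. t j + miwa a j) * dtau t x b - \<tau> (\<lambda>j. t j + miwa b j) * dtau t x a)
      (finite_subsets_at_top onb)"
    by (intro tendsto_diff tendsto_mult tau dtau s)
  have "(?r \<longlongrightarrow> (a - b) / (a * b) * (\<tau> t * \<tau> (\<lambda>j. t j + miwa a j + miwa b j) -
      \<tau> (\<lambda>j. t j + miwa b j) * \<tau> (\<lambda>j. t j + miwa a j))) (finite_subsets_at_top onb)"
    unfolding \<tau>_def
    by (intro tendsto_mult_left tendsto_diff tendsto_mult section_det_tendsto_tau convergent_times_shift t s x0)
  moreover have "\<forall>\<^sub>F F in finite_subsets_at_top onb. ?r F = ?l F"
  proof (rule eventually_mono[OF eventually_onb])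
    fix F :: "'h set" assume "finite F \<and> orthonormal F"
    then have F: "finite F" by simp
    have "sdet F (tau_matrix t x) * ((a - b) * section_det F (tau_op (\<lambda>j. t j + miwa a j + miwa b j) x)) =
        b * (sdet F (tau_matrix t x) + b * rank_one_term F (tau_matrix t x) (out0 t x) (shift_entry t x b)) * (a\<^sup>2 * rank_one_term F (tau_matrix t x) (out1 t x) (shift_entry t x a) - sdet F (tau_matrix t x)) -
        a * (sdet F (tau_matrix t x) + a * rank_one_term F (tau_matrix t x) (out0 t x) (shift_entry t x a)) * (b\<^sup>2 * rank_one_term F (tau_matrix t x) (out1 t x) (shift_entry t x b) - sdet F (tau_matrix t x))"
      unfolding section_det_shift2[OF t s x0 F]
      by (rule sdet_pair_shift[OF F shift_entry2_eq[OF t s]])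
    then have "(a - b) * (section_det F (tau_op t x) * section_det F (tau_op (\<lambda>j. t j + miwa a j + miwa b j) x) - section_det F (?K b) * section_det F (?K a)) =
        (a * b) * ?l F"
      unfolding section_det_tau_op[OF F, of t x] section_det_derivative[OF t s(1) x0 F] section_det_derivative[OF t s(2) x0 F]
        section_det_shift[OF t s(1) x0 F] section_det_shift[OF t s(2) x0 F]
      by algebra
    then show "?r F = ?l F" using nz by (simp add: field_simps)
  qed
  ultimately show "(?l \<longlongrightarrow> (a - b) / (a * b) * (\<tau> t * \<tau> (\<lambda>j. t j + miwa a j + miwa b j) -
      \<tau> (\<lambda>j. t j + miwa b j) * \<tau> (\<lambda>j. t j + miwa a j))) (finite_subsets_at_top onb)"
    by (rule Lim_transform_eventually)
qed

lemma tau_shift_tendsto: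
  assumes t: "convergent_times t" and s: "admissible_shift r" "(s \<longlongrightarrow> r) G" "\<forall>\<^sub>F z in G. admissible_shift (s z)"
    and y: "(y \<longlongrightarrow> x) G" "x \<ge> 0" "\<forall>\<^sub>F z in G. y z \<ge> 0"
  shows "((\<lambda>z. tau A1 A2 B C (y z) (\<lambda>j. t j + miwa (s z) j)) \<longlongrightarrow> tau A1 A2 B C x (\<lambda>j. t j + miwa r j)) G"
proof -
  let ?X = "\<lambda>s y. V t o\<^sub>L neumann A2 s o\<^sub>L exp_neg A2 y"
  let ?Z = "\<lambda>s y. exp_neg A1 y o\<^sub>L ((id_blinfun + scaleC_op s A1) o\<^sub>L W t)"
  have eq: "tau A1 A2 B C y (\<lambda>j. t j + miwa s j) = fredholm_det (?X s y o\<^sub>L R 0 o\<^sub>L ?Z s y)"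
    if "admissible_shift s" "y \<ge> 0" for s y
    unfolding tau_eq tau_op_def V_shift[OF t that(1)] W_shift[OF t that(1)] R_eq_sandwich[OF that(2)]
    by (simp only: comp_assoc)
  have cl: "clinear_op (?X s y)" "clinear_op (?Z s y)" if "admissible_shift s" for s y
    by (intro clinear_op_compose clinear_op_add clinear_op_id clinear_op_scaleC clinear_neumann
        admissible_shiftD[OF that] clinear_exp_neg lin convergent_timesD[OF t])+
  have small2: "\<forall>\<^sub>F z in G. cmod (s z) * norm A2 < 1"
    by (rule eventually_mono[OF s(3)]) (rule admissible_shiftD)
  have exp_neg: "((\<lambda>z. exp_neg A (y z)) \<longlongrightarrow> exp_neg A x) G" for A
    using continuous_on_exp_neg[of UNIV A] y(1) by (auto simp: continuous_on_eq_continuous_at intro: isCont_tendsto_compose)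
  have bl: "((\<lambda>z. scaleC_op (s z) A1) \<longlongrightarrow> scaleC_op r A1) G"
  proof (rule Lim_transform[OF tendsto_const], rule Lim_null_comparison)
    show "\<forall>\<^sub>F z in G. norm (scaleC_op (s z) A1 - scaleC_op r A1) \<le> cmod (s z - r) * norm A1"
    proof (rule always_eventually, rule allI)
      fix z
      have "scaleC_op (s z) A1 - scaleC_op r A1 = scaleC_op (s z - r) A1"
        using scaleC_op_add_left[of "s z - r" r A1] by simp
      then show "norm (scaleC_op (s z) A1 - scaleC_op r A1) \<le> cmod (s z - r) * norm A1"
        by (simp only: norm_scaleC_op)
    qed
    have "((\<lambda>z. cmod (s z - r) * norm A1) \<longlongrightarrow> cmod (r - r) * norm A1) G"
      by (intro tendsto_mult tendsto_norm tendsto_diff tendsto_const s)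
    then show "((\<lambda>z. cmod (s z - r) * norm A1) \<longlongrightarrow> 0) G" by simp
  qed
  obtain \<nu> where \<nu>: "nuclear (R 0) \<nu>" using nuclear_R_zero by (elim exE)
  have "((\<lambda>z. fredholm_det (?X (s z) (y z) o\<^sub>L R 0 o\<^sub>L ?Z (s z) (y z))) \<longlongrightarrow> fredholm_det (?X r x o\<^sub>L R 0 o\<^sub>L ?Z r x)) G"
  proof (rule fredholm_det_tendsto[OF \<nu>])
    show "((\<lambda>z. ?X (s z) (y z)) \<longlongrightarrow> ?X r x) G"
      by (intro tendsto_comp tendsto_const exp_neg tendsto_neumann lin s(2) admissible_shiftD[OF s(1)] small2)
    show "((\<lambda>z. ?Z (s z) (y z)) \<longlongrightarrow> ?Z r x) G"
      by (intro tendsto_comp tendsto_add tendsto_const exp_neg bl)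
  qed (use cl s(1,3) in \<open>auto elim: eventually_mono\<close>)
  moreover have "\<forall>\<^sub>F z in G. fredholm_det (?X (s z) (y z) o\<^sub>L R 0 o\<^sub>L ?Z (s z) (y z)) =
      tau A1 A2 B C (y z) (\<lambda>j. t j + miwa (s z) j)"
    by (rule eventually_mono[OF eventually_conj[OF s(3) y(3)]], rule eq[symmetric]) (simp_all only:)
  ultimately show ?thesis
    unfolding eq[OF s(1) y(2)] by (rule Lim_transform_eventually)
qed

end

section \<open>Logarithmic derivatives\<close>

text \<open>By continuity, \<open>l y - l x\<close> is close to zero near \<open>x\<close>, where it is the principal logarithm of \<open>f y / f x\<close>.\<close>

lemma log_has_vector_derivative:
  fixes l f :: "real \<Rightarrow> complex"
  assumes l: "isCont l x" and exp: "\<forall>\<^sub>F y in nhds x. exp (l y) = f y"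
    and f: "(f has_vector_derivative f') (at x)"
  shows "(l has_vector_derivative f' / f x) (at x)"
proof -
  have fx: "exp (l x) = f x" using exp by (rule eventually_nhds_x_imp_x)
  have fx0: "f x \<noteq> 0" using exp_not_eq_zero[of "l x"] unfolding fx .
  have "(l \<longlongrightarrow> l x) (nhds x)"
    using l by (simp only: isCont_def tendsto_at_iff_tendsto_nhds)
  then have "((\<lambda>y. Im (l y - l x)) \<longlongrightarrow> Im (l x - l x)) (nhds x)"
    by (intro tendsto_Im tendsto_diff tendsto_const)
  from tendstoD[OF this pi_gt_zero] have "\<forall>\<^sub>F y in nhds x. dist (Im (l y - l x)) 0 < pi"
    by simp
  from eventually_conj[OF this exp]
  have ev: "\<forall>\<^sub>F y in nhds x. l y = l x + Ln (f y / f x)"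
  proof (rule eventually_mono)
    fix y assume y: "dist (Im (l y - l x)) 0 < pi \<and> exp (l y) = f y"
    then have "f y / f x = exp (l y - l x)" using fx by (simp add: exp_diff)
    moreover have "Ln (exp (l y - l x)) = l y - l x"
      using y by (intro Ln_exp) (auto simp: dist_real_def)
    ultimately show "l y = l x + Ln (f y / f x)" by simp
  qed
  have "((\<lambda>y. f y / f x) has_vector_derivative f' / f x) (at x)"
    using has_vector_derivative_mult_right[OF f, of "1 / f x"] by simp
  moreover have "(Ln has_field_derivative 1) (at (f x / f x))"
    using has_field_derivative_Ln[of 1] fx0 by simp
  ultimately have "((Ln \<circ> (\<lambda>y. f y / f x)) has_vector_derivative (f' / f x) * 1) (at x)"
    by (rule field_vector_diff_chain_at)
  then have "((\<lambda>y. l x + Ln (f y / f x)) has_vector_derivative f' / f x) (at x)"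
    using has_vector_derivative_add[OF has_vector_derivative_const[of "l x"]] by (simp add: o_def)
  moreover obtain S where S: "open S" "x \<in> S" "\<forall>y\<in>S. l y = l x + Ln (f y / f x)"
    using ev unfolding eventually_nhds by (elim exE conjE)
  moreover have "l x + Ln (f y / f x) = l y" if "y \<in> S" for y
    using S(3) that by simp
  ultimately show ?thesis by (intro has_vector_derivative_transform_within_open[of _ _ x S l])
qed

lemma difference_of_quotients:
  fixes a b a' b' c h :: complex
  assumes "a * b' - b * a' = h * (c - b * a)" "a \<noteq> 0" "b \<noteq> 0" "h \<noteq> 0"
  shows "c / (a * b) - 1 = (b' / b - a' / a) / h"
proof -
  have "b' / b - a' / a = (a * b' - b * a') / (a * b)"
    using assms(2,3) by (simp add: field_simps)
  also have "\<dots> = h * (c / (a * b) - 1)"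
    unfolding assms(1) using assms(2,3) by (simp add: field_simps)
  finally show ?thesis using assms(4) by simp
qed

text \<open>Near \<open>p\<close> the quotient \<open>F q / F p\<close> lies in the disc of radius one about \<open>1\<close>, which avoids the branch cut.\<close>

lemma ex_log_branch:
  assumes S: "open S" "p \<in> S" and F: "continuous_on S F" and nz: "F p \<noteq> 0"
  shows "\<exists>U L. log_branch F p U L"
proof -
  define U where "U = S \<inter> F -` ball (F p) (cmod (F p))"
  define L where "L q = Ln (F q / F p) + Ln (F p)" for q
  have U: "open U" unfolding U_def by (intro continuous_open_preimage F S open_ball)
  have near: "cmod (1 - F q / F p) < 1" if "q \<in> U" for q
  proof -
    have "cmod (F p - F q) < cmod (F p)" using that by (simp add: U_def dist_norm)
    moreover have "1 - F q / F p = (F p - F q) / F p" using nz by (simp add: field_simps)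
    ultimately show ?thesis using nz by (simp add: norm_divide)
  qed
  have slit: "F q / F p \<notin> \<real>\<^sub>\<le>\<^sub>0" if "q \<in> U" for q
  proof
    assume "F q / F p \<in> \<real>\<^sub>\<le>\<^sub>0"
    then have "Re (F q / F p) \<le> 0" by (simp add: complex_nonpos_Reals_iff)
    then have "1 \<le> Re (1 - F q / F p)" by simp
    also have "\<dots> \<le> cmod (1 - F q / F p)" by (rule complex_Re_le_cmod)
    finally show False using near[OF that] by simp
  qed
  have "continuous_on U F" using F by (rule continuous_on_subset) (simp add: U_def)
  then have "continuous_on U L"
    unfolding L_def[abs_def]
    by (intro continuous_on_add continuous_on_const continuous_on_Ln' continuous_on_divide slit) (use nz in simp_all)
  moreover have "exp (L q) = F q" if "q \<in> U" for q
  proof -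
    have "F q / F p \<noteq> 0" using slit[OF that] by auto
    then show ?thesis using nz by (simp add: L_def exp_add)
  qed
  moreover have "p \<in> U" using S nz by (simp add: U_def)
  ultimately have "log_branch F p U L" using U by (simp add: log_branch_def)
  then show ?thesis by (intro exI)
qed

context admissible_pair
begin

lemma admissible_shift_inverse:
  assumes "max (norm A1) (norm A2) < cmod z"
  shows "admissible_shift (1 / z)"
proof -
  have "0 < cmod z" using assms norm_ge_zero[of A1] by linarith
  then show ?thesis using assms by (simp add: admissible_shift_def norm_divide field_simps)
qed

lemma tau_inverse_tendsto:
  assumes t: "convergent_times t" and \<zeta>: "max (norm A1) (norm A2) < cmod \<zeta>"
    and y: "(y \<longlongrightarrow> x) G" "x > 0" and z: "(z \<longlongrightarrow> \<zeta>) G"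
  shows "((\<lambda>q. tau A1 A2 B C (y q) (\<lambda>j. t j + miwa (1 / z q) j)) \<longlongrightarrow> tau A1 A2 B C x (\<lambda>j. t j + miwa (1 / \<zeta>) j)) G"
proof (rule tau_shift_tendsto[OF t admissible_shift_inverse[OF \<zeta>] _ _ y(1)])
  have "0 < cmod \<zeta>" using \<zeta> norm_ge_zero[of A1] by linarith
  then show "((\<lambda>q. 1 / z q) \<longlongrightarrow> 1 / \<zeta>) G"
    by (intro tendsto_divide tendsto_const z) simp
  have "\<forall>\<^sub>F q in G. max (norm A1) (norm A2) < cmod (z q)"
    by (rule order_tendstoD(1)[OF tendsto_norm[OF z] \<zeta>])
  then show "\<forall>\<^sub>F q in G. admissible_shift (1 / z q)"
    by (rule eventually_mono) (rule admissible_shift_inverse)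
  show "\<forall>\<^sub>F q in G. 0 \<le> y q"
    by (rule eventually_mono[OF order_tendstoD(1)[OF y]]) simp
qed (use y in simp)

theorem log_branch_tau:
  assumes t: "convergent_times t" and x: "x > 0" and \<zeta>: "max (norm A1) (norm A2) < cmod \<zeta>"
  defines "F \<equiv> \<lambda>(y, z). tau A1 A2 B C y (\<lambda>j. t j + miwa (1 / z) j)"
  assumes nz: "F (x, \<zeta>) \<noteq> 0"
  shows "\<exists>U L. log_branch F (x, \<zeta>) U L"
proof -
  let ?S = "{0 :: real <..} \<times> {z. max (norm A1) (norm A2) < cmod z}"
  have 1: "open ?S"
    by (intro open_Times open_greaterThan open_Collect_less continuous_intros)
  have 2: "(x, \<zeta>) \<in> ?S" using x \<zeta> by simp
  have 3: "continuous_on ?S F"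
    unfolding continuous_on_def
  proof
    fix p assume p: "p \<in> ?S"
    have "((\<lambda>q. tau A1 A2 B C (fst q) (\<lambda>j. t j + miwa (1 / snd q) j)) \<longlongrightarrow>
        tau A1 A2 B C (fst p) (\<lambda>j. t j + miwa (1 / snd p) j)) (at p within ?S)"
      by (rule tau_inverse_tendsto[OF t]) (use p in \<open>auto intro!: tendsto_fst tendsto_snd tendsto_ident_at\<close>)
    moreover have "F = (\<lambda>q. tau A1 A2 B C (fst q) (\<lambda>j. t j + miwa (1 / snd q) j))"
      by (auto simp: F_def)
    ultimately show "(F \<longlongrightarrow> F p) (at p within ?S)" by (simp only:)
  qed
  show ?thesis by (rule ex_log_branch[OF 1 2 3 nz])
qed

text \<open>The derivative of \<open>L\<close> in \<open>y\<close> is \<open>dtau / tau\<close>. Its difference quotient in \<open>z\<close> is given exactly by the differential form of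
Fay's identity for the shifts \<open>1 / \<zeta>\<close> and \<open>1 / z\<close>, and the result is continuous in \<open>z\<close>.\<close>

theorem log_tau_second_derivative:
  assumes t: "convergent_times t" and x: "x > 0" and \<zeta>: "max (norm A1) (norm A2) < cmod \<zeta>"
  defines "F \<equiv> \<lambda>(y, z). tau A1 A2 B C y (\<lambda>j. t j + miwa (1 / z) j)"
  assumes L: "log_branch F (x, \<zeta>) U L"
  shows "\<forall>\<^sub>F z in nhds \<zeta>. (\<lambda>y. L (y, z)) differentiable (at x)"
    and "((\<lambda>z. vector_derivative (\<lambda>y. L (y, z)) (at x)) has_field_derivative
        tau A1 A2 B C x t * tau A1 A2 B C x (\<lambda>j. t j + 2 * miwa (1 / \<zeta>) j) / (F (x, \<zeta>))\<^sup>2 - 1) (at \<zeta>)"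
proof -
  let ?T = "tau A1 A2 B C x"
  let ?t = "\<lambda>z j. t j + miwa (1 / z) j"
  let ?g = "\<lambda>z. dtau t x (1 / z) / ?T (?t z)"
  have U: "open U" "(x, \<zeta>) \<in> U" "continuous_on U L" and expL: "\<And>q. q \<in> U \<Longrightarrow> exp (L q) = F q"
    using L by (simp_all add: log_branch_def)
  let ?N = "{z. (x, z) \<in> U \<and> max (norm A1) (norm A2) < cmod z}"
  have N: "\<forall>\<^sub>F z in nhds \<zeta>. z \<in> ?N"
  proof -
    have "((\<lambda>z. (x, z)) \<longlongrightarrow> (x, \<zeta>)) (nhds \<zeta>)"
      by (intro tendsto_Pair tendsto_const filterlim_ident)
    from topological_tendstoD[OF this U(1,2)] have "\<forall>\<^sub>F z in nhds \<zeta>. (x, z) \<in> U" .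
    moreover have "\<forall>\<^sub>F z in nhds \<zeta>. max (norm A1) (norm A2) < cmod z"
      by (rule order_tendstoD(1)[OF tendsto_norm[OF filterlim_ident] \<zeta>])
    ultimately show ?thesis by (simp add: eventually_conj)
  qed
  have nz: "?T (?t z) \<noteq> 0" if "z \<in> ?N" for z
  proof -
    have "exp (L (x, z)) = ?T (?t z)" using expL[of "(x, z)"] that by (simp add: F_def)
    then show ?thesis using exp_not_eq_zero[of "L (x, z)"] by simp
  qed
  have der: "((\<lambda>y. L (y, z)) has_vector_derivative ?g z) (at x)" if z: "z \<in> ?N" for z
  proof (rule log_has_vector_derivative[where f = "\<lambda>y. tau A1 A2 B C y (?t z)"])
    have "isCont L (x, z)"
      using U z by (simp add: continuous_on_eq_continuous_at)
    then show "isCont (\<lambda>y. L (y, z)) x"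
      by (intro isCont_o2[of x "\<lambda>y. (y, z)" L] isCont_Pair continuous_ident continuous_const)
    have "((\<lambda>y. (y, z)) \<longlongrightarrow> (x, z)) (nhds x)"
      by (intro tendsto_Pair tendsto_const filterlim_ident)
    from topological_tendstoD[OF this U(1)] z have "\<forall>\<^sub>F y in nhds x. (y, z) \<in> U" by simp
    then show "\<forall>\<^sub>F y in nhds x. exp (L (y, z)) = tau A1 A2 B C y (?t z)"
      by (rule eventually_mono) (simp add: expL F_def)
    show "((\<lambda>y. tau A1 A2 B C y (?t z)) has_vector_derivative dtau t x (1 / z)) (at x)"
      using z by (intro tau_shift_has_vector_derivative t admissible_shift_inverse x) simp
  qed
  show "\<forall>\<^sub>F z in nhds \<zeta>. (\<lambda>y. L (y, z)) differentiable (at x)"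
    by (rule eventually_mono[OF N]) (rule differentiableI_vector[OF der])
  have g: "\<forall>\<^sub>F z in nhds \<zeta>. vector_derivative (\<lambda>y. L (y, z)) (at x) = ?g z"
    by (rule eventually_mono[OF N]) (rule vector_derivative_at[OF der])
  have \<zeta>N: "\<zeta> \<in> ?N" using N by (rule eventually_nhds_x_imp_x)
  have \<zeta>0: "0 < cmod \<zeta>" using \<zeta> norm_ge_zero[of A1] by linarith
  let ?H = "\<lambda>z. ?T t * ?T (\<lambda>j. ?t \<zeta> j + miwa (1 / z) j) / (?T (?t \<zeta>) * ?T (?t z)) - 1"
  have quot: "\<forall>\<^sub>F z in at \<zeta>. ?H z = (?g z - ?g \<zeta>) / (z - \<zeta>)"
    unfolding eventually_at_filter
  proof (rule eventually_mono[OF N], intro impI)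
    fix z assume z: "z \<in> ?N" "z \<noteq> \<zeta>"
    have "norm A1 < cmod z" using z(1) by simp
    then have z0: "0 < cmod z" by (rule le_less_trans[OF norm_ge_zero])
    have ab: "(1 / \<zeta> - 1 / z) / (1 / \<zeta> * (1 / z)) = z - \<zeta>"
      using z0 \<zeta>0 by (simp add: field_simps)
    have "?T (?t \<zeta>) * dtau t x (1 / z) - ?T (?t z) * dtau t x (1 / \<zeta>) =
        (z - \<zeta>) * (?T t * ?T (\<lambda>j. ?t \<zeta> j + miwa (1 / z) j) - ?T (?t z) * ?T (?t \<zeta>))"
      unfolding ab[symmetric]
      using z z0 \<zeta>0 by (intro fay_differential t x admissible_shift_inverse \<zeta>) auto
    then show "?H z = (?g z - ?g \<zeta>) / (z - \<zeta>)"
      by (rule difference_of_quotients) (use nz[OF z(1)] nz[OF \<zeta>N] z(2) in simp_all)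
  qed
  have "(?H \<longlongrightarrow> ?T t * ?T (\<lambda>j. ?t \<zeta> j + miwa (1 / \<zeta>) j) / (?T (?t \<zeta>) * ?T (?t \<zeta>)) - 1) (at \<zeta>)"
    using nz[OF \<zeta>N]
    by (intro tendsto_diff tendsto_divide tendsto_mult tendsto_const tau_inverse_tendsto \<zeta> t x
        convergent_times_shift admissible_shift_inverse tendsto_ident_at) simp
  moreover have "(\<lambda>j. ?t \<zeta> j + miwa (1 / \<zeta>) j) = (\<lambda>j. t j + 2 * miwa (1 / \<zeta>) j)"
    by (simp add: fun_eq_iff)
  ultimately have "(?H \<longlongrightarrow> ?T t * ?T (\<lambda>j. t j + 2 * miwa (1 / \<zeta>) j) / (F (x, \<zeta>))\<^sup>2 - 1) (at \<zeta>)"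
    by (simp add: F_def power2_eq_square)
  from Lim_transform_eventually[OF this quot]
  have "(?g has_field_derivative ?T t * ?T (\<lambda>j. t j + 2 * miwa (1 / \<zeta>) j) / (F (x, \<zeta>))\<^sup>2 - 1) (at \<zeta>)"
    by (simp only: has_field_derivative_iff)
  then show "((\<lambda>z. vector_derivative (\<lambda>y. L (y, z)) (at x)) has_field_derivative
      ?T t * ?T (\<lambda>j. t j + 2 * miwa (1 / \<zeta>) j) / (F (x, \<zeta>))\<^sup>2 - 1) (at \<zeta>)"
    by (subst DERIV_cong_ev[OF refl g refl])
qed

end

theorem corollary9p6:
  fixes A1 A2 :: "'h::complex_hilbert \<Rightarrow>\<^sub>L 'h"
    and B :: "complex \<Rightarrow>\<^sub>L 'h" and C :: "'h \<Rightarrow>\<^sub>L complex"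
    and t :: "nat \<Rightarrow> complex" and x :: real
  assumes "clinear_op A1" "clinear_op A2" "clinear_op B" "clinear_op C"
    and "sectorial (- A1)" "sectorial (- A2)"
    and "\<exists>t0>0. norm (op_exp (- (t0 *\<^sub>R A1))) < 1"
    and "\<exists>t0>0. norm (op_exp (- (t0 *\<^sub>R A2))) < 1"
    and "admissible22 A1 B C" "admissible22 A2 B C"
    and "t \<in> C0_inf" "x > 0"
  defines "\<tau> \<equiv> tau A1 A2 B C"
    and "M \<equiv> max (norm A1) (norm A2)"
  shows
    "(\<forall>s0 s1 s2 s3 :: complex.
        cmod s0 * M < 1 \<and> cmod s1 * M < 1 \<and> cmod s2 * M < 1 \<and> cmod s3 * M < 1 \<longrightarrow>
        (let \<sigma> = (\<lambda>a b. (a - b) * \<tau> x (\<lambda>j. t j + miwa a j + miwa b j))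
         in \<sigma> s0 s1 * \<sigma> s2 s3 - \<sigma> s0 s2 * \<sigma> s1 s3 + \<sigma> s0 s3 * \<sigma> s1 s2 = 0)) \<and>
     (\<forall>s1 s2 :: complex.
        cmod s1 * M < 1 \<and> cmod s2 * M < 1 \<and> s1 \<noteq> 0 \<and> s2 \<noteq> 0 \<longrightarrow>
        (\<lambda>y. \<tau> y (\<lambda>j. t j + miwa s1 j)) differentiable (at x) \<and>
        (\<lambda>y. \<tau> y (\<lambda>j. t j + miwa s2 j)) differentiable (at x) \<and>
        wronskian (\<lambda>y. \<tau> y (\<lambda>j. t j + miwa s1 j)) (\<lambda>y. \<tau> y (\<lambda>j. t j + miwa s2 j)) x =
        (s1 - s2) / (s1 * s2) *
          det (vector [vector [\<tau> x t, \<tau> x (\<lambda>j. t j + miwa s2 j)],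
                       vector [\<tau> x (\<lambda>j. t j + miwa s1 j), \<tau> x (\<lambda>j. t j + miwa s1 j + miwa s2 j)]]
               :: complex ^ 2 ^ 2)) \<and>
     (\<forall>\<zeta> :: complex.
        cmod \<zeta> > M \<and> \<tau> x (\<lambda>j. t j + miwa (1 / \<zeta>) j) \<noteq> 0 \<longrightarrow>
        (let F = (\<lambda>(y, z). \<tau> y (\<lambda>j. t j + miwa (1 / z) j))
         in (\<exists>U L. log_branch F (x, \<zeta>) U L) \<and>
            (\<forall>U L. log_branch F (x, \<zeta>) U L \<longrightarrow>
               (\<forall>\<^sub>F z in nhds \<zeta>. (\<lambda>y. L (y, z)) differentiable (at x)) \<and>
               ((\<lambda>z. vector_derivative (\<lambda>y. L (y, z)) (at x)) has_field_derivative
                  \<tau> x t * \<tau> x (\<lambda>j. t j + 2 * miwa (1 / \<zeta>) j) /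
                    (\<tau> x (\<lambda>j. t j + miwa (1 / \<zeta>) j))\<^sup>2 - 1) (at \<zeta>))))"
proof -
  interpret admissible_pair A1 A2 B C
    by unfold_locales (use assms(1-8) in \<open>simp_all add: exp_neg_def\<close>)
  have t: "convergent_times t" using \<open>t \<in> C0_inf\<close> by (rule convergent_times_C0)
  have x0: "x \<ge> 0" using \<open>x > 0\<close> by simp
  have admissible_shift: "admissible_shift s" if "cmod s * M < 1" for s
  proof -
    have "cmod s * norm A1 \<le> cmod s * M" "cmod s * norm A2 \<le> cmod s * M"
      by (auto simp: M_def intro!: mult_left_mono)
    then show ?thesis using that by (simp add: admissible_shift_def)
  qed
  show ?thesis
  proof (intro conjI allI impI)
    fix s0 s1 s2 s3 :: complex
    assume "cmod s0 * M < 1 \<and> cmod s1 * M < 1 \<and> cmod s2 * M < 1 \<and> cmod s3 * M < 1"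
    then show "let \<sigma> = (\<lambda>a b. (a - b) * \<tau> x (\<lambda>j. t j + miwa a j + miwa b j))
         in \<sigma> s0 s1 * \<sigma> s2 s3 - \<sigma> s0 s2 * \<sigma> s1 s3 + \<sigma> s0 s3 * \<sigma> s1 s2 = 0"
      unfolding Let_def \<tau>_def by (intro fay_identity t x0 admissible_shift) simp_all
  next
    fix s1 s2 :: complex
    assume s: "cmod s1 * M < 1 \<and> cmod s2 * M < 1 \<and> s1 \<noteq> 0 \<and> s2 \<noteq> 0"
    have der: "((\<lambda>y. \<tau> y (\<lambda>j. t j + miwa s j)) has_vector_derivative dtau t x s) (at x)"
      if "cmod s * M < 1" for s
      unfolding \<tau>_def by (intro tau_shift_has_vector_derivative t admissible_shift that \<open>x > 0\<close>)
    show "(\<lambda>y. \<tau> y (\<lambda>j. t j + miwa s1 j)) differentiable (at x)"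
      "(\<lambda>y. \<tau> y (\<lambda>j. t j + miwa s2 j)) differentiable (at x)"
      using s by (auto intro!: differentiableI_vector[OF der])
    have "wronskian (\<lambda>y. \<tau> y (\<lambda>j. t j + miwa s1 j)) (\<lambda>y. \<tau> y (\<lambda>j. t j + miwa s2 j)) x =
        \<tau> x (\<lambda>j. t j + miwa s1 j) * dtau t x s2 - \<tau> x (\<lambda>j. t j + miwa s2 j) * dtau t x s1"
      using s by (simp add: wronskian_def vector_derivative_at[OF der])
    also have "\<dots> = (s1 - s2) / (s1 * s2) * (\<tau> x t * \<tau> x (\<lambda>j. t j + miwa s1 j + miwa s2 j) -
        \<tau> x (\<lambda>j. t j + miwa s2 j) * \<tau> x (\<lambda>j. t j + miwa s1 j))"
      unfolding \<tau>_def using s by (intro fay_differential t admissible_shift \<open>x > 0\<close>) simp_all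
    finally show "wronskian (\<lambda>y. \<tau> y (\<lambda>j. t j + miwa s1 j)) (\<lambda>y. \<tau> y (\<lambda>j. t j + miwa s2 j)) x =
        (s1 - s2) / (s1 * s2) *
          det (vector [vector [\<tau> x t, \<tau> x (\<lambda>j. t j + miwa s2 j)],
                       vector [\<tau> x (\<lambda>j. t j + miwa s1 j), \<tau> x (\<lambda>j. t j + miwa s1 j + miwa s2 j)]]
               :: complex ^ 2 ^ 2)"
      by (simp add: det_2)
  next
    fix \<zeta> :: complex
    assume \<zeta>: "cmod \<zeta> > M \<and> \<tau> x (\<lambda>j. t j + miwa (1 / \<zeta>) j) \<noteq> 0"
    let ?F = "\<lambda>(y, z). tau A1 A2 B C y (\<lambda>j. t j + miwa (1 / z) j)"
    have M: "max (norm A1) (norm A2) < cmod \<zeta>" using \<zeta> by (simp add: M_def)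
    have ex: "\<exists>U L. log_branch ?F (x, \<zeta>) U L"
      using \<zeta> by (intro log_branch_tau t M \<open>x > 0\<close>) (simp add: \<tau>_def)
    note der = log_tau_second_derivative[OF t \<open>x > 0\<close> M]
    show "let F = (\<lambda>(y, z). \<tau> y (\<lambda>j. t j + miwa (1 / z) j))
         in (\<exists>U L. log_branch F (x, \<zeta>) U L) \<and>
            (\<forall>U L. log_branch F (x, \<zeta>) U L \<longrightarrow>
               (\<forall>\<^sub>F z in nhds \<zeta>. (\<lambda>y. L (y, z)) differentiable (at x)) \<and>
               ((\<lambda>z. vector_derivative (\<lambda>y. L (y, z)) (at x)) has_field_derivative
                  \<tau> x t * \<tau> x (\<lambda>j. t j + 2 * miwa (1 / \<zeta>) j) /
                    (\<tau> x (\<lambda>j. t j + miwa (1 / \<zeta>) j))\<^sup>2 - 1) (at \<zeta>))"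
      unfolding Let_def \<tau>_def
    proof (intro conjI allI impI ex)
      fix U L assume L: "log_branch ?F (x, \<zeta>) U L"
      show "\<forall>\<^sub>F z in nhds \<zeta>. (\<lambda>y. L (y, z)) differentiable (at x)" by (rule der(1)[OF L])
      show "((\<lambda>z. vector_derivative (\<lambda>y. L (y, z)) (at x)) has_field_derivative
          tau A1 A2 B C x t * tau A1 A2 B C x (\<lambda>j. t j + 2 * miwa (1 / \<zeta>) j) /
            (tau A1 A2 B C x (\<lambda>j. t j + miwa (1 / \<zeta>) j))\<^sup>2 - 1) (at \<zeta>)"
        using der(2)[OF L] by simp
    qed
  qed
qed

end
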